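(* Let $c\in C^{2}(\mathbb{R})$ be such that $\alpha=\min_{u\in\mathbb{R}}c(u)$ and $\beta=\max_{u\in\mathbb{R}}c(u)$ satisfy $0<\alpha<\beta<\infty$, and assume that $\max_{u\in\mathbb{R}}|c'(u)|\le K_1$ and $\max_{u\in\mathbb{R}}|c''(u)|\le K_2$ for positive constants $K_1,K_2$. Consider a continuous function $w:\mathbb{R}\to\mathbb{R}$ composed of local, classical traveling wave solutions with wave speed $s\in\mathbb{R}$ of the nonlinear variational wave equation $$u_{tt}-c(u)(c(u)u_x)_x=0 .$$ If $w$ is a global traveling wave to this equation, then the following holds. If $|s|\notin[\alpha,\beta]$, then $w$ is a monotone, classical solution, which is globally unbounded. If $|s|\in(\alpha,\beta)$, two local, classical traveling wave solutions can only be glued together at points $\xi$ such that $|s|=c(w(\xi))$, and we have the following three possibilities: 1. If for some $\xi$, $|s|\neq c(w(\xi))$ and $c$ has a local maximum or minimum at $w(\xi)$, then the wave $w$ is a monotone, classical solution near $\xi$, which has an inflection point at $\xi$. 2. If for some $\xi$, $|s|=c(w(\xi))$ and $c'(w(\xi))\neq 0$, then the wave $w$ is either constant or has a singularity at $\xi$, meaning that the derivative is unbounded at $\xi$ while $w$ is continuous. Near the singularity, the wave is a monotone, classical solution on both sides of $\xi$. The following scenarios are possible: i) The derivative has the same sign (nonzero) on both sides of $\xi$, and the wave has an inflection point at $\xi$. ii) The derivative has opposite sign (nonzero) on each side of $\xi$. Then the wave is either convex or concave on both sides, and the singularity is a cusp. iii) The wave can be constant on one side of the singularity and strictly monotone on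 the other side. 3. If for some $\xi$, $|s|=c(w(\xi))$ and $c'(w(\xi))=0$, then the wave $w$ is constant. For $|s|\in[\alpha,\beta]$, a weak bounded traveling wave solution of the equation can be constructed.
   Context: Here $u=u(t,x)$ with $t\ge 0$, $x\in\mathbb{R}$. Write $\xi=x-st$ and $w_\xi$ for the derivative of $w$ with respect to $\xi$. Local, classical traveling wave solution with wave speed $s$: a function $u(t,x)=w(x-st)$ with $w\in C^2(I)$ for some interval $I$, satisfying on $I$ $$[s^2-c^2(w)]w_{\xi\xi}-c(w)c'(w)w_\xi^2=0 .$$ Multiplying by $2w_\xi$ and integrating gives $w_\xi^2[s^2-c^2(w)]=k$ for a constant $k$, so that $w_\xi=\pm\sqrt{|k|}/\sqrt{|s^2-c^2(w)|}$ wherever $|s|\ne c(w)$. Composed of (glued from) local, classical traveling wave solutions: $w$ is continuous and is obtained by joining local, classical traveling wave solutions with the same speed $s$ (possibly with different constants $k$) at gluing points, where there is a minimal positive distance between any two gluing points. Global traveling wave: $u(t,x)=w(x-st)$, with $w$ continuous on $\mathbb{R}$ and $w_\xi\in L^2_{\mathrm{loc}}(\mathbb{R})$, satisfies the weak form $$\int_0^\infty\int_{-\infty}^\infty\big[-u_t\phi_t+c(u)c'(u)u_x^2\phi+c^2(u)u_x\phi_x\big]\,dx\,dt=0\quad\text{for all }\phi\in C_c^\infty((0,\infty)\times\mathbb{R}).$$ Weak solution: a function $u$ with $u(t,\cdot)\in L^\infty(\mathbb{R})$ and $u_t(t,\cdot),u_x(t,\cdot)\in L^2(\mathbb{R})$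 for all $t\ge0$ that satisfies the weak form above for all $\phi\in C_c^\infty((0,\infty)\times\mathbb{R})$. Cusp singularity: a point where the derivative is unbounded while the solution itself is bounded and continuous.
   Formalization: Unboundedness is claimed only for non-constant w; in 1, w''=0 and w' has a local extremum, with a true inflection only if c' changes sign and w is not locally constant; in 2, constant means near ξ; in 3, w must not sweep an interval of values where c=|s|. *)

theory Defs
  imports "HOL-Analysis.Analysis"
begin

text \<open>The classes \<open>C\<^sup>n(S)\<close> for open \<open>S\<close>: the map is differentiable at every point of \<open>S\<close> and all its
  directional derivatives are of class \<open>C\<^sup>n\<^sup>-\<^sup>1\<close>.\<close>

primrec Ck_on :: "nat \<Rightarrow> 'a::euclidean_space set \<Rightarrow> ('a \<Rightarrow> real) \<Rightarrow> bool" where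
  "Ck_on 0 S f \<longleftrightarrow> continuous_on S f"
| "Ck_on (Suc n) S f \<longleftrightarrow>
     (\<exists>D. (\<forall>x\<in>S. (f has_derivative D x) (at x)) \<and> (\<forall>v. Ck_on n S (\<lambda>x. D x v)))"

text \<open>\<open>C\<^sub>c\<^sup>\<infinity>(\<Omega>)\<close>; its elements are extended by zero to the whole space.\<close>

definition test_function :: "'a::euclidean_space set \<Rightarrow> ('a \<Rightarrow> real) \<Rightarrow> bool" where
  "test_function \<Omega> \<phi> \<longleftrightarrow>
     (\<forall>n. Ck_on n UNIV \<phi>) \<and> (\<exists>K. compact K \<and> K \<subseteq> \<Omega> \<and> (\<forall>x. x \<notin> K \<longrightarrow> \<phi> x = 0))"

definition dir_deriv :: "'a::euclidean_space \<Rightarrow> ('a \<Rightarrow> real) \<Rightarrow> 'a \<Rightarrow> real" where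
  "dir_deriv v \<phi> x = frechet_derivative \<phi> (at x) v"

text \<open>\<open>g\<close> is the weak (distributional) derivative of \<open>f\<close> on \<open>\<Omega>\<close> in direction \<open>v\<close>.\<close>

definition weak_deriv ::
    "'a::euclidean_space set \<Rightarrow> 'a \<Rightarrow> ('a \<Rightarrow> real) \<Rightarrow> ('a \<Rightarrow> real) \<Rightarrow> bool" where
  "weak_deriv \<Omega> v f g \<longleftrightarrow>
     (\<forall>\<phi>. test_function \<Omega> \<phi> \<longrightarrow>
        set_integrable lborel \<Omega> (\<lambda>x. f x * dir_deriv v \<phi> x) \<and>
        set_integrable lborel \<Omega> (\<lambda>x. g x * \<phi> x) \<and>
        (LINT x:\<Omega>|lborel. f x * dir_deriv v \<phi> x) = - (LINT x:\<Omega>|lborel. g x * \<phi> x))"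

definition L2 :: "(real \<Rightarrow> real) \<Rightarrow> bool" where
  "L2 f \<longleftrightarrow> f \<in> borel_measurable borel \<and> integrable lborel (\<lambda>x. (f x)\<^sup>2)"

definition L2_loc :: "(real \<Rightarrow> real) \<Rightarrow> bool" where
  "L2_loc f \<longleftrightarrow> f \<in> borel_measurable borel \<and>
     (\<forall>K. compact K \<longrightarrow> set_integrable lborel K (\<lambda>x. (f x)\<^sup>2))"

definition Linfty :: "(real \<Rightarrow> real) \<Rightarrow> bool" where
  "Linfty f \<longleftrightarrow> f \<in> borel_measurable borel \<and> (\<exists>M. AE x in lborel. \<bar>f x\<bar> \<le> M)"

abbreviation half_plane :: "(real \<times> real) set" where
  "half_plane \<equiv> {0<..} \<times> UNIV"

text \<open>The weak form of \<open>u\<^sub>t\<^sub>t - c(u)(c(u)u\<^sub>x)\<^sub>x = 0\<close>. Points of the half plane are pairs \<open>(t, x)\<close>;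
  \<open>ut\<close> and \<open>ux\<close> stand for the derivatives of \<open>u\<close>. Integrability is required explicitly because
  the Lebesgue integral of a non-integrable function is \<open>0\<close> by convention.\<close>

definition weak_form ::
    "(real \<Rightarrow> real) \<Rightarrow> (real \<Rightarrow> real \<Rightarrow> real) \<Rightarrow> (real \<Rightarrow> real \<Rightarrow> real) \<Rightarrow> (real \<Rightarrow> real \<Rightarrow> real) \<Rightarrow> bool"
  where
  "weak_form c u ut ux \<longleftrightarrow>
     (\<forall>\<phi>. test_function half_plane \<phi> \<longrightarrow>
        (let F = (\<lambda>(t, x). - ut t x * dir_deriv (1, 0) \<phi> (t, x)
                    + c (u t x) * deriv c (u t x) * (ux t x)\<^sup>2 * \<phi> (t, x)
                    + (c (u t x))\<^sup>2 * ux t x * dir_deriv (0, 1) \<phi> (t, x))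
         in set_integrable lborel half_plane F \<and> (LINT p:half_plane|lborel. F p) = 0))"

definition weak_solution :: "(real \<Rightarrow> real) \<Rightarrow> (real \<Rightarrow> real \<Rightarrow> real) \<Rightarrow> bool" where
  "weak_solution c u \<longleftrightarrow>
     (\<exists>ut ux.
        weak_deriv half_plane (1, 0) (\<lambda>(t, x). u t x) (\<lambda>(t, x). ut t x) \<and>
        weak_deriv half_plane (0, 1) (\<lambda>(t, x). u t x) (\<lambda>(t, x). ux t x) \<and>
        (\<forall>t\<ge>0. Linfty (u t) \<and> L2 (ut t) \<and> L2 (ux t) \<and> weak_deriv UNIV 1 (u t) (ux t)) \<and>
        weak_form c u ut ux)"

text \<open>Here \<open>g\<close> is \<open>w\<^sub>\<xi>\<close>, so that \<open>u(t,x) = w(x - st)\<close> has \<open>u\<^sub>t = - s w\<^sub>\<xi>\<close> and \<open>u\<^sub>x = w\<^sub>\<xi>\<close>.\<close>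

definition global_traveling_wave :: "(real \<Rightarrow> real) \<Rightarrow> real \<Rightarrow> (real \<Rightarrow> real) \<Rightarrow> bool" where
  "global_traveling_wave c s w \<longleftrightarrow>
     continuous_on UNIV w \<and>
     (\<exists>g. weak_deriv UNIV 1 w g \<and> L2_loc g \<and>
        weak_form c (\<lambda>t x. w (x - s * t)) (\<lambda>t x. - s * g (x - s * t)) (\<lambda>t x. g (x - s * t)))"

definition local_classical_wave ::
    "(real \<Rightarrow> real) \<Rightarrow> real \<Rightarrow> (real \<Rightarrow> real) \<Rightarrow> real set \<Rightarrow> bool" where
  "local_classical_wave c s w I \<longleftrightarrow>
     open I \<and> is_interval I \<and> Ck_on 2 I w \<and>
     (\<forall>\<xi>\<in>I. (s\<^sup>2 - (c (w \<xi>))\<^sup>2) * deriv (deriv w) \<xi>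
              - c (w \<xi>) * deriv c (w \<xi>) * (deriv w \<xi>)\<^sup>2 = 0)"

text \<open>\<open>G\<close> contains all gluing points. It may be infinite, and it may contain points across which
  \<open>w\<close> happens to be a classical solution; \<open>gluing_point\<close> below is the genuine notion.\<close>

definition composed_of_local_waves :: "(real \<Rightarrow> real) \<Rightarrow> real \<Rightarrow> (real \<Rightarrow> real) \<Rightarrow> bool" where
  "composed_of_local_waves c s w \<longleftrightarrow>
     continuous_on UNIV w \<and>
     (\<exists>G d. d > 0 \<and> (\<forall>x\<in>G. \<forall>y\<in>G. x \<noteq> y \<longrightarrow> d \<le> \<bar>x - y\<bar>) \<and>
        (\<forall>I. open I \<and> is_interval I \<and> I \<inter> G = {} \<longrightarrow> local_classical_wave c s w I))"

definition gluing_point :: "(real \<Rightarrow> real) \<Rightarrow> real \<Rightarrow> (real \<Rightarrow> real) \<Rightarrow> real \<Rightarrow> bool" where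
  "gluing_point c s w \<xi> \<longleftrightarrow>
     (\<exists>\<epsilon>>0. local_classical_wave c s w {\<xi> - \<epsilon><..<\<xi>} \<and>
            local_classical_wave c s w {\<xi><..<\<xi> + \<epsilon>}) \<and>
     \<not> (\<exists>\<epsilon>>0. local_classical_wave c s w {\<xi> - \<epsilon><..<\<xi> + \<epsilon>})"

definition monotone_wave_on :: "real set \<Rightarrow> (real \<Rightarrow> real) \<Rightarrow> bool" where
  "monotone_wave_on A w \<longleftrightarrow> mono_on A w \<or> antimono_on A w"

definition strictly_monotone_wave_on :: "real set \<Rightarrow> (real \<Rightarrow> real) \<Rightarrow> bool" where
  "strictly_monotone_wave_on A w \<longleftrightarrow> strict_mono_on A w \<or> strict_antimono_on A w"

definition constant_near :: "(real \<Rightarrow> real) \<Rightarrow> real \<Rightarrow> bool" where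
  "constant_near w \<xi> \<longleftrightarrow> (\<forall>\<^sub>F \<eta> in nhds \<xi>. w \<eta> = w \<xi>)"

definition local_extremum :: "(real \<Rightarrow> real) \<Rightarrow> real \<Rightarrow> bool" where
  "local_extremum f x \<longleftrightarrow> (\<forall>\<^sub>F y in nhds x. f y \<le> f x) \<or> (\<forall>\<^sub>F y in nhds x. f x \<le> f y)"

definition changes_sign :: "(real \<Rightarrow> real) \<Rightarrow> real \<Rightarrow> bool" where
  "changes_sign f x \<longleftrightarrow>
     (\<forall>\<^sub>F y in at_left x. f y < 0) \<and> (\<forall>\<^sub>F y in at_right x. 0 < f y) \<or>
     (\<forall>\<^sub>F y in at_left x. 0 < f y) \<and> (\<forall>\<^sub>F y in at_right x. f y < 0)"

text \<open>The curvature changes sign at \<open>\<xi>\<close>. The derivatives of \<open>w\<close> need not exist at \<open>\<xi>\<close> itself.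
  Since \<open>w\<^sub>\<xi>\<^sub>\<xi> = c(w)c'(w)w\<^sub>\<xi>\<^sup>2 / (s\<^sup>2 - c\<^sup>2(w))\<close>, where \<open>\<bar>s\<bar> \<noteq> c(w)\<close> this means that \<open>c'\<close> changes sign. A
  \<open>C\<^sup>2\<close> function \<open>c\<close> may have a local extremum without that (it may be locally constant, or \<open>c'\<close> may
  oscillate); the slope \<open>w\<^sub>\<xi>\<close> then still has a local extremum.\<close>

definition inflection_point :: "(real \<Rightarrow> real) \<Rightarrow> real \<Rightarrow> bool" where
  "inflection_point w \<xi> \<longleftrightarrow>
     isCont w \<xi> \<and>
     (\<forall>\<^sub>F \<eta> in at \<xi>. w differentiable at \<eta> \<and> deriv w differentiable at \<eta>) \<and>
     changes_sign (deriv (deriv w)) \<xi>"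

definition singularity :: "(real \<Rightarrow> real) \<Rightarrow> real \<Rightarrow> bool" where
  "singularity w \<xi> \<longleftrightarrow>
     isCont w \<xi> \<and> (\<forall>\<epsilon>>0. \<not> bounded (deriv w ` ({\<xi> - \<epsilon><..<\<xi> + \<epsilon>} - {\<xi>})))"

definition cusp_singularity :: "(real \<Rightarrow> real) \<Rightarrow> real \<Rightarrow> bool" where
  "cusp_singularity w \<xi> \<longleftrightarrow>
     singularity w \<xi> \<and> (\<exists>\<epsilon>>0. bounded (w ` {\<xi> - \<epsilon><..<\<xi> + \<epsilon>}))"

text \<open>The three scenarios at a singularity, on the interval of radius \<open>\<epsilon>\<close> about \<open>\<xi>\<close>.\<close>

definition same_sign_scenario :: "(real \<Rightarrow> real) \<Rightarrow> real \<Rightarrow> real \<Rightarrow> bool" where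
  "same_sign_scenario w \<xi> \<epsilon> \<longleftrightarrow>
     ((\<forall>\<eta>\<in>{\<xi> - \<epsilon><..<\<xi>} \<union> {\<xi><..<\<xi> + \<epsilon>}. 0 < deriv w \<eta>) \<or>
      (\<forall>\<eta>\<in>{\<xi> - \<epsilon><..<\<xi>} \<union> {\<xi><..<\<xi> + \<epsilon>}. deriv w \<eta> < 0)) \<and>
     inflection_point w \<xi>"

definition opposite_sign_scenario :: "(real \<Rightarrow> real) \<Rightarrow> real \<Rightarrow> real \<Rightarrow> bool" where
  "opposite_sign_scenario w \<xi> \<epsilon> \<longleftrightarrow>
     ((\<forall>\<eta>\<in>{\<xi> - \<epsilon><..<\<xi>}. deriv w \<eta> < 0) \<and> (\<forall>\<eta>\<in>{\<xi><..<\<xi> + \<epsilon>}. 0 < deriv w \<eta>) \<or>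
      (\<forall>\<eta>\<in>{\<xi> - \<epsilon><..<\<xi>}. 0 < deriv w \<eta>) \<and> (\<forall>\<eta>\<in>{\<xi><..<\<xi> + \<epsilon>}. deriv w \<eta> < 0)) \<and>
     (convex_on {\<xi> - \<epsilon><..<\<xi>} w \<and> convex_on {\<xi><..<\<xi> + \<epsilon>} w \<or>
      concave_on {\<xi> - \<epsilon><..<\<xi>} w \<and> concave_on {\<xi><..<\<xi> + \<epsilon>} w) \<and>
     cusp_singularity w \<xi>"

definition one_sided_constant_scenario :: "(real \<Rightarrow> real) \<Rightarrow> real \<Rightarrow> real \<Rightarrow> bool" where
  "one_sided_constant_scenario w \<xi> \<epsilon> \<longleftrightarrow>
     (\<forall>\<eta>\<in>{\<xi> - \<epsilon><..\<xi>}. w \<eta> = w \<xi>) \<and> strictly_monotone_wave_on {\<xi>..<\<xi> + \<epsilon>} w \<or>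
     strictly_monotone_wave_on {\<xi> - \<epsilon><..\<xi>} w \<and> (\<forall>\<eta>\<in>{\<xi>..<\<xi> + \<epsilon>}. w \<eta> = w \<xi>)"

text \<open>The profile \<open>w\<close> sweeps through a nondegenerate interval of values on which \<open>c\<close> is identically
  \<open>\<bar>s\<bar>\<close>. There every coefficient of the travelling wave equation vanishes, so that any \<open>C\<^sup>2\<close> profile with
  values in such an interval is a solution.\<close>

definition moves_on_plateau :: "(real \<Rightarrow> real) \<Rightarrow> real \<Rightarrow> (real \<Rightarrow> real) \<Rightarrow> bool" where
  "moves_on_plateau c s w \<longleftrightarrow>
     (\<exists>a b. a < b \<and> {a..b} \<subseteq> range w \<and> (\<forall>v\<in>{a..b}. c v = \<bar>s\<bar>))"

text \<open>\<open>a < b\<close> are consecutive and nondegenerate solutions of \<open>c(v) = \<bar>s\<bar>\<close>; exactly such a pair of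
  values can be joined by a monotone piece of finite energy.\<close>

definition joinable_levels :: "(real \<Rightarrow> real) \<Rightarrow> real \<Rightarrow> real \<Rightarrow> real \<Rightarrow> bool" where
  "joinable_levels c s a b \<longleftrightarrow>
     a < b \<and> c a = \<bar>s\<bar> \<and> c b = \<bar>s\<bar> \<and> deriv c a \<noteq> 0 \<and> deriv c b \<noteq> 0 \<and>
     (\<forall>v\<in>{a<..<b}. c v \<noteq> \<bar>s\<bar>)"

end

theory Submission
  imports Defs
begin

text \<open>Write \<open>gap v = s\<^sup>2 - c\<^sup>2(v)\<close> and call a value \<open>v\<close> sonic if \<open>gap v = 0\<close>, that is \<open>\<bar>s\<bar> = c(v)\<close>. The
  proof rests on a first integral. Where \<open>w\<close> is classical, \<open>w\<^sub>\<xi>\<^sup>2 gap(w)\<close> is constant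
  (\<open>local_wave_dichotomy\<close>); where moreover \<open>w\<close> takes no sonic value, \<open>w\<^sub>\<xi> sqrt \<bar>gap(w)\<bar>\<close> is constant, so
  that \<open>w\<close> solves the first-order equation \<open>w\<^sub>\<xi> = \<kappa> / sqrt \<bar>gap(w)\<bar>\<close> (\<open>normal_form\<close>), and every solution
  of this equation is a classical wave (\<open>normal_form_imp_local_wave\<close>).

  \<^bold>\<open>Gluing.\<close> In the moving frame the weak form says that the flux \<open>(c\<^sup>2(w) - s\<^sup>2) w\<^sub>\<xi>\<close> has the locally
  integrable weak derivative \<open>c(w) c'(w) w\<^sub>\<xi>\<^sup>2\<close> (\<open>weak_form_travelling_iff\<close>). Hence the flux cannot jump. At a
  point with a nonsonic value the constants \<open>\<kappa>\<close> of the two sides must then agree, and \<open>w\<close> is classical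
  across the point (\<open>nonsonic_imp_local_wave\<close>). If \<open>\<bar>s\<bar>\<close> lies outside \<open>[\<alpha>, \<beta>]\<close>, there is one \<open>\<kappa>\<close> for the
  whole line, and a slope that is bounded away from zero makes \<open>w\<close> unbounded.

  \<^bold>\<open>Sonic values with \<open>c' \<noteq> 0\<close>.\<close> On each side of the point, either the first integral vanishes and \<open>w\<close>
  is constant, or \<open>w\<^sub>\<xi> = \<kappa> / sqrt \<bar>gap(w)\<bar>\<close> with \<open>\<kappa> \<noteq> 0\<close>, which is unbounded. Since \<open>gap\<close> has a simple zero
  at the sonic value, the differential equation gives \<open>w\<^sub>\<xi>\<^sub>\<xi>\<close> the sign of \<open>- \<kappa> (\<eta> - p)\<close> at \<open>\<eta>\<close> near the
  point \<open>p\<close> (\<open>sonic_side\<close>). Combining the two sides gives the three scenarios (\<open>regular_sonic_point\<close>).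

  \<^bold>\<open>Sonic values with \<open>c' = 0\<close>.\<close> Here \<open>gap\<close> is at most quadratic, so \<open>\<bar>w\<^sub>\<xi>\<bar> \<ge> const / \<bar>w - w(p)\<bar>\<close> if the first
  integral is not zero. Then \<open>w\<^sub>\<xi>\<^sup>2\<close> dominates the derivative of \<open>ln ((w - w(p))\<^sup>2)\<close>. Since this
  logarithm tends to \<open>-\<infinity>\<close> at \<open>p\<close>, the energy near \<open>p\<close> would be infinite (\<open>degenerate_side\<close>). So the first integral is zero. If \<open>F\<close> is
  an antiderivative of \<open>gap\<close>, then \<open>F(w)\<close> is constant, and \<open>w\<close> can move only through values where \<open>gap\<close> vanishes
  (\<open>silent_side\<close>), that is on a plateau of \<open>c\<close>.

  \<^bold>\<open>Existence.\<close> Two joinable levels \<open>a < b\<close> are connected by the inverse of \<open>y \<mapsto> \<integral> sqrt \<bar>gap\<bar>\<close> over \<open>[a, y]\<close>,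
  continued by the constants \<open>a\<close> and \<open>b\<close>. Its flux is \<open>- sqrt (gap(w))\<close> and so vanishes at the two gluing
  points, and simple zeros of \<open>gap\<close> at \<open>a\<close> and \<open>b\<close> make the energy finite (\<open>joining_wave\<close>). Without
  joinable levels, a constant is a weak solution.\<close>

section \<open>Smooth functions and bumps\<close>

lemma Ck_on_subset: "Ck_on n S f \<Longrightarrow> T \<subseteq> S \<Longrightarrow> Ck_on n T f"
proof (induction n arbitrary: f)
  case 0 then show ?case by (auto intro: continuous_on_subset)
next
  case (Suc n) then show ?case by (simp; blast)
qed

lemma Ck_on_Suc_imp: "Ck_on (Suc n) S f \<Longrightarrow> Ck_on n S f"
proof (induction n arbitrary: f)
  case 0
  then show ?case
    by (auto intro!: continuous_at_imp_continuous_on dest!: has_derivative_continuous)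
next
  case (Suc n)
  from Suc.prems obtain D where D: "\<forall>x\<in>S. (f has_derivative D x) (at x)"
    "\<forall>v. Ck_on (Suc n) S (\<lambda>x. D x v)" by (auto simp only: Ck_on.simps(2))
  with Suc.IH show ?case by (auto simp only: Ck_on.simps(2))
qed

lemma Ck_on_const: "Ck_on n S (\<lambda>x. k)"
proof (induction n arbitrary: k)
  case (Suc n)
  then show ?case by (auto intro!: exI[of _ "\<lambda>x v. 0"])
qed simp

lemma Ck_on_bounded_linear: "bounded_linear l \<Longrightarrow> Ck_on n S l"
proof (cases n)
  case (Suc m)
  assume "bounded_linear l"
  with Suc show ?thesis
    by (auto intro!: exI[of _ "\<lambda>x. l"] Ck_on_const bounded_linear_imp_has_derivative)
qed (auto intro: linear_continuous_on)

lemma Ck_on_add: "Ck_on n S f \<Longrightarrow> Ck_on n S g \<Longrightarrow> Ck_on n S (\<lambda>x. f x + g x)"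
proof (induction n arbitrary: f g)
  case 0 then show ?case by (auto intro: continuous_intros)
next
  case (Suc n)
  from Suc.prems obtain D E where "\<forall>x\<in>S. (f has_derivative D x) (at x)"
    "\<forall>v. Ck_on n S (\<lambda>x. D x v)" "\<forall>x\<in>S. (g has_derivative E x) (at x)"
    "\<forall>v. Ck_on n S (\<lambda>x. E x v)" by auto
  with Suc.IH show ?case
    by (auto intro!: exI[of _ "\<lambda>x v. D x v + E x v"] has_derivative_add)
qed

lemma Ck_on_mult: "Ck_on n S f \<Longrightarrow> Ck_on n S g \<Longrightarrow> Ck_on n S (\<lambda>x. f x * g x)"
proof (induction n arbitrary: f g)
  case 0 then show ?case by (auto intro: continuous_intros)
next
  case (Suc n)
  from Suc.prems obtain D E where DE: "\<forall>x\<in>S. (f has_derivative D x) (at x)"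
    "\<forall>v. Ck_on n S (\<lambda>x. D x v)" "\<forall>x\<in>S. (g has_derivative E x) (at x)"
    "\<forall>v. Ck_on n S (\<lambda>x. E x v)" by auto
  have "Ck_on n S f" "Ck_on n S g" using Suc.prems by (blast intro: Ck_on_Suc_imp)+
  with DE Suc.IH have "\<forall>v. Ck_on n S (\<lambda>x. f x * E x v + D x v * g x)"
    by (auto intro!: Ck_on_add)
  with DE show ?case
    by (auto intro!: exI[of _ "\<lambda>x v. f x * E x v + D x v * g x"] has_derivative_mult)
qed

lemma Ck_on_affine:
  assumes "Ck_on n UNIV f" "bounded_linear L"
  shows "Ck_on n UNIV (\<lambda>x. f (p + L x))"
  using assms(1)
proof (induction n arbitrary: f)
  case 0
  have "continuous_on UNIV (\<lambda>x. p + L x)"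
    by (intro continuous_intros linear_continuous_on assms)
  with 0 show ?case
    using continuous_on_compose2[of UNIV f UNIV "\<lambda>x. p + L x"] by simp
next
  case (Suc n)
  from Suc.prems obtain D where D: "\<forall>x. (f has_derivative D x) (at x)"
    "\<forall>v. Ck_on n UNIV (\<lambda>x. D x v)" by auto
  have "((\<lambda>x. f (p + L x)) has_derivative (\<lambda>v. D (p + L x) (L v))) (at x)" for x
  proof (rule has_derivative_compose[of "\<lambda>x. p + L x" L x UNIV f])
    show "((\<lambda>x. p + L x) has_derivative L) (at x)"
      using bounded_linear_imp_has_derivative[OF assms(2), of "at x"]
      by (auto intro!: derivative_eq_intros)
    show "(f has_derivative D (p + L x)) (at (p + L x))" using D by blast
  qed
  with Suc.IH D show ?case
    by (auto intro!: exI[of _ "\<lambda>x v. D (p + L x) (L v)"])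
qed

text \<open>The functions \<open>y\<^sup>-\<^sup>m exp(- 1/y)\<close>, continued by \<open>0\<close>. The family, unlike its member \<open>m = 0\<close>, is closed
  under differentiation up to linear combinations, so that smoothness is an induction.\<close>

definition flat :: "nat \<Rightarrow> real \<Rightarrow> real" where
  "flat m y = (if 0 < y then (1 / y) ^ m * exp (- (1 / y)) else 0)"

text \<open>The series of \<open>exp (1/y)\<close> dominates each of its terms, here the one of order \<open>m + 2\<close>. A quadratic bound is
  enough for the derivative at the origin to exist and vanish.\<close>

lemma flat_le: "0 \<le> flat m y" "flat m y \<le> fact (m + 2) * y\<^sup>2"
proof -
  show "0 \<le> flat m y" by (simp add: flat_def)
  show "flat m y \<le> fact (m + 2) * y\<^sup>2"
  proof (cases "0 < y")
    case True
    have "(1/y) ^ (m + 2) / fact (m + 2) \<le> exp (1 / y)"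
      using sum_le_suminf[OF summable_exp_generic[of "1/y"], of "{m+2}"] True
      by (simp add: exp_def divide_inverse mult.commute)
    then have "(1/y) ^ m * (1/y)\<^sup>2 \<le> fact (m + 2) * exp (1 / y)"
      unfolding power_add by (simp add: pos_divide_le_eq mult.commute)
    then have "(1/y) ^ m * (1/y)\<^sup>2 * (y\<^sup>2 * exp (-(1/y))) \<le> fact (m + 2) * exp (1 / y) * (y\<^sup>2 * exp (-(1/y)))"
      by (intro mult_right_mono) auto
    moreover have "(1/y) ^ m * (1/y)\<^sup>2 * (y\<^sup>2 * exp (-(1/y))) = flat m y"
      using True by (simp add: flat_def field_simps)
    moreover have "fact (m + 2) * exp (1 / y) * (y\<^sup>2 * exp (-(1/y))) = fact (m + 2) * y\<^sup>2"
      by (simp add: exp_minus)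
    ultimately show ?thesis by (metis (no_types))
  qed (simp add: flat_def)
qed

lemma DERIV_flat:
  "(flat m has_real_derivative flat (m + 2) y - m * flat (m + 1) y) (at y)"
proof -
  consider "0 < y" | "y < 0" | "y = 0" by linarith
  then show ?thesis
  proof cases
    case 1
    have r: "((\<lambda>y. 1 / y) has_real_derivative - ((1/y) * (1/y))) (at y)"
      using 1 by (auto intro!: derivative_eq_intros)
    have p: "((\<lambda>y. (1 / y) ^ m) has_real_derivative - (real m * (1/y) ^ (m + 1))) (at y)"
      by (rule DERIV_cong[OF DERIV_power[OF r, of m]]) (cases m; simp del: power_one_over)
    have "((\<lambda>y. (1 / y) ^ m * exp (- (1 / y))) has_real_derivative
        flat (m + 2) y - m * flat (m + 1) y) (at y)"
      using 1 by (intro DERIV_cong[OF DERIV_mult[OF p DERIV_fun_exp[OF DERIV_minus[OF r]]]])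
        (simp add: flat_def algebra_simps del: power_one_over)
    then show ?thesis
      by (rule has_field_derivative_transform_within_open[where S = "{0<..}"])
        (use 1 in \<open>auto simp: flat_def\<close>)
  next
    case 2
    have "((\<lambda>y. 0) has_real_derivative flat (m + 2) y - m * flat (m + 1) y) (at y)"
      using 2 by (auto simp: flat_def)
    then show ?thesis
      by (rule has_field_derivative_transform_within_open[where S = "{..<0}"])
        (use 2 in \<open>auto simp: flat_def\<close>)
  next
    case 3
    have "((\<lambda>h. flat m h / h) \<longlongrightarrow> 0) (at 0)"
    proof (rule Lim_null_comparison)
      have "norm (flat m h / h) \<le> fact (m + 2) * \<bar>h\<bar>" if "h \<noteq> 0" for h
      proof -
        have "norm (flat m h / h) = flat m h / \<bar>h\<bar>" using flat_le(1)[of m h] by simp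
        also have "\<dots> \<le> fact (m + 2) * h\<^sup>2 / \<bar>h\<bar>"
          by (intro divide_right_mono flat_le) simp
        also have "\<dots> = fact (m + 2) * \<bar>h\<bar>"
          using that by (simp add: abs_if power2_eq_square)
        finally show ?thesis .
      qed
      then show "\<forall>\<^sub>F h in at 0. norm (flat m h / h) \<le> fact (m + 2) * \<bar>h\<bar>"
        by (auto simp: eventually_at_filter)
      show "((\<lambda>h. fact (m + 2) * \<bar>h\<bar>) \<longlongrightarrow> 0) (at (0::real))"
        by (auto intro!: tendsto_eq_intros)
    qed
    then show ?thesis using 3 by (simp add: DERIV_def flat_def)
  qed
qed

lemma Ck_on_flat: "Ck_on n S u \<Longrightarrow> Ck_on n S (\<lambda>x. flat m (u x))"
proof (induction n arbitrary: m)
  case 0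
  have "continuous_on UNIV (flat m)"
    by (intro continuous_at_imp_continuous_on ballI DERIV_isCont[OF DERIV_flat])
  with 0 show ?case using continuous_on_compose2[of UNIV "flat m" S u] by simp
next
  case (Suc n)
  from Suc.prems obtain D where D: "\<forall>x\<in>S. (u has_derivative D x) (at x)"
    "\<forall>v. Ck_on n S (\<lambda>x. D x v)" by auto
  define d where "d x = flat (m + 2) (u x) + (- real m) * flat (m + 1) (u x)" for x
  have "Ck_on n S u" using Suc.prems by (rule Ck_on_Suc_imp)
  then have "Ck_on n S d" unfolding d_def
    by (intro Ck_on_add Ck_on_mult Ck_on_const Suc.IH)
  moreover have "((\<lambda>x. flat m (u x)) has_derivative (\<lambda>v. d x * D x v)) (at x)" if "x \<in> S" for x
    using has_derivative_compose[OF D(1)[rule_format, OF that]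
        DERIV_flat[of m "u x", unfolded has_field_derivative_def]]
    by (simp add: d_def)
  ultimately show ?case using D
    by (auto intro!: exI[of _ "\<lambda>x v. d x * D x v"] Ck_on_mult)
qed

text \<open>A bump on \<open>[a, b]\<close>. The parameter \<open>k\<close> steepens it: as \<open>k\<close> grows, it increases to the indicator of \<open>(a, b)\<close>,
  which replaces mollification in the fundamental lemma.\<close>

definition bump :: "real \<Rightarrow> real \<Rightarrow> real \<Rightarrow> real \<Rightarrow> real" where
  "bump k a b x = flat 0 (k * ((x - a) * (b - x)))"

lemma bump_nonneg: "0 \<le> bump k a b x" and bump_le_1: "bump k a b x \<le> 1"
  by (auto simp: bump_def flat_def)

lemma bump_pos: "0 < k \<Longrightarrow> a < x \<Longrightarrow> x < b \<Longrightarrow> 0 < bump k a b x"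
  by (auto simp: bump_def flat_def)

lemma bump_eq_0: "0 < k \<Longrightarrow> a \<le> b \<Longrightarrow> x \<notin> {a<..<b} \<Longrightarrow> bump k a b x = 0"
  by (auto simp: bump_def flat_def zero_less_mult_iff)

lemma Ck_on_bump: "Ck_on n S (bump k a b)"
proof -
  have "Ck_on n S (\<lambda>x. flat 0 (k * ((x + - a) * (b + (-1) * x))))"
    by (intro Ck_on_flat Ck_on_mult Ck_on_add Ck_on_const Ck_on_bounded_linear) auto
  then show ?thesis by (simp add: bump_def [abs_def])
qed

lemma test_function_bump:
  "0 < k \<Longrightarrow> a \<le> b \<Longrightarrow> {a..b} \<subseteq> \<Omega> \<Longrightarrow> test_function \<Omega> (bump k a b)"
  unfolding test_function_def
  by (auto intro!: Ck_on_bump exI[of _ "{a..b}"] bump_eq_0)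

lemma bump_tendsto_indicator:
  "a \<le> b \<Longrightarrow> (\<lambda>n. bump (real (Suc n)) a b x) \<longlonglongrightarrow> indicator {a<..<b} x"
proof (cases "x \<in> {a<..<b}")
  case True
  then have q: "0 < (x - a) * (b - x)" by simp
  have "(\<lambda>n. exp (- (inverse (real (Suc n)) * (1 / ((x - a) * (b - x)))))) \<longlonglongrightarrow> exp (- (0 * (1 / ((x - a) * (b - x)))))"
    by (intro tendsto_intros LIMSEQ_inverse_real_of_nat)
  moreover have "bump (real (Suc n)) a b x = exp (- (inverse (real (Suc n)) * (1 / ((x - a) * (b - x)))))" for n
    using True unfolding bump_def flat_def
    by (simp add: zero_less_mult_iff divide_simps)
  ultimately show ?thesis using True by simp
qed (simp add: bump_eq_0)

lemma Ck_on_2_real_iff: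
  fixes f :: "real \<Rightarrow> real"
  shows "Ck_on 2 S f \<longleftrightarrow>
    (\<exists>f1 f2. (\<forall>x\<in>S. (f has_real_derivative f1 x) (at x) \<and> (f1 has_real_derivative f2 x) (at x)) \<and>
       continuous_on S f2)" (is "?L \<longleftrightarrow> ?R")
proof
  have lin: "(h has_real_derivative D 1) (at x)" if "(h has_derivative D) (at x)" for h :: "real \<Rightarrow> real" and D x
  proof -
    have "D v = D 1 * v" for v
      using linear_scale[OF has_derivative_linear[OF that], of v 1] by simp
    then have "D = (*) (D 1)" by (rule ext)
    then show ?thesis using that by (simp add: has_field_derivative_def)
  qed
  assume ?L
  then obtain D where D: "\<forall>x\<in>S. (f has_derivative D x) (at x)"
     "Ck_on (Suc 0) S (\<lambda>x. D x 1)" unfolding numeral_2_eq_2 Ck_on.simps(2)[of "Suc 0"] by blast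
  then obtain E where E: "\<forall>x\<in>S. ((\<lambda>x. D x 1) has_derivative E x) (at x)"
     "continuous_on S (\<lambda>x. E x 1)" by auto
  show ?R
    by (intro exI[of _ "\<lambda>x. D x 1"] exI[of _ "\<lambda>x. E x 1"] conjI ballI lin E(2))
      (use D E in blast)+
next
  assume ?R
  then obtain f1 f2 where f: "\<And>x. x\<in>S \<Longrightarrow> (f has_real_derivative f1 x) (at x)"
    "\<And>x. x\<in>S \<Longrightarrow> (f1 has_real_derivative f2 x) (at x)" "continuous_on S f2" by auto
  have "\<exists>D. (\<forall>x\<in>S. ((\<lambda>x. f1 x * v) has_derivative D x) (at x)) \<and> (\<forall>u. continuous_on S (\<lambda>x. D x u))" for v
  proof (intro exI conjI ballI allI)
    fix x assume "x \<in> S"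
    then show "((\<lambda>x. f1 x * v) has_derivative (*) (f2 x * v)) (at x)"
      using f(2) DERIV_cmult_right has_field_derivative_def by blast
  qed (intro continuous_intros f(3))
  then have "\<forall>v. Ck_on (Suc 0) S (\<lambda>x. f1 x * v)" by simp
  moreover have "(f has_derivative (*) (f1 x)) (at x)" if "x \<in> S" for x
    using f(1)[OF that] by (simp add: has_field_derivative_def)
  ultimately have "Ck_on (Suc (Suc 0)) S f" unfolding Ck_on.simps(2)[of "Suc 0"]
    by (intro exI[of _ "\<lambda>x v. f1 x * v"]) blast
  then show ?L by (simp only: numeral_2_eq_2)
qed

section \<open>Test functions\<close>

lemma Ck_on_dir_deriv:
  assumes "\<forall>n. Ck_on n UNIV \<phi>"
  shows "(\<phi> has_derivative (\<lambda>v. dir_deriv v \<phi> x)) (at x)" "continuous_on UNIV (dir_deriv v \<phi>)"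
    "continuous_on UNIV \<phi>"
proof -
  from assms have "Ck_on (Suc 0) UNIV \<phi>" by blast
  then obtain D where D: "\<forall>x. (\<phi> has_derivative D x) (at x)" "\<forall>v. continuous_on UNIV (\<lambda>x. D x v)"
    by auto
  then have "D x = frechet_derivative \<phi> (at x)" for x
    using frechet_derivative_at by blast
  then have "dir_deriv v \<phi> x = D x v" for v x by (simp add: dir_deriv_def)
  with D show "(\<phi> has_derivative (\<lambda>v. dir_deriv v \<phi> x)) (at x)" "continuous_on UNIV (dir_deriv v \<phi>)"
    by (simp_all add: fun_eq_iff cong: continuous_on_cong)
  have "Ck_on 0 UNIV \<phi>" using assms by blast
  then show "continuous_on UNIV \<phi>" by simp
qed

text \<open>Outside its support a test function vanishes on an open set, so its derivatives vanish there as well.\<close>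

lemma test_functionE:
  assumes "test_function \<Omega> (\<phi> :: 'a::euclidean_space \<Rightarrow> real)"
  obtains K where "compact K" "K \<subseteq> \<Omega>" "\<And>x. x \<notin> K \<Longrightarrow> \<phi> x = 0" "\<And>x v. x \<notin> K \<Longrightarrow> dir_deriv v \<phi> x = 0"
proof -
  from assms obtain K where K: "compact K" "K \<subseteq> \<Omega>" "\<And>x. x \<notin> K \<Longrightarrow> \<phi> x = 0"
    by (auto simp: test_function_def)
  have "dir_deriv v \<phi> x = 0" if "x \<notin> K" for x v
  proof -
    have "((\<lambda>_. 0) has_derivative (\<lambda>_. 0)) (at x)" by simp
    then have "(\<phi> has_derivative (\<lambda>_. 0)) (at x)"
      by (rule has_derivative_transform_within_open[where s = "- K"])
        (use K that in \<open>auto simp: compact_imp_closed open_closed\<close>)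
    then have "frechet_derivative \<phi> (at x) = (\<lambda>_. 0)" by (rule frechet_derivative_at[symmetric])
    then show ?thesis by (simp add: dir_deriv_def)
  qed
  with K that show ?thesis by blast
qed

lemma test_function_smooth: "test_function \<Omega> \<phi> \<Longrightarrow> \<forall>n. Ck_on n UNIV \<phi>"
  by (simp add: test_function_def)

lemma test_function_mono: "test_function \<Omega> \<phi> \<Longrightarrow> \<Omega> \<subseteq> \<Omega>' \<Longrightarrow> test_function \<Omega>' \<phi>"
  by (auto simp: test_function_def)

lemma test_function_bounded:
  assumes "test_function \<Omega> (\<phi> :: 'a::euclidean_space \<Rightarrow> real)"
  obtains M where "0 \<le> M" "\<And>x. \<bar>\<phi> x\<bar> \<le> M" "\<And>x. \<bar>dir_deriv v \<phi> x\<bar> \<le> M"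
proof -
  obtain K where K: "compact K" "\<And>x. x \<notin> K \<Longrightarrow> \<phi> x = 0" "\<And>x v. x \<notin> K \<Longrightarrow> dir_deriv v \<phi> x = 0"
    using test_functionE[OF assms] by metis
  have *: "\<exists>M\<ge>0. \<forall>x. \<bar>h x\<bar> \<le> M" if "continuous_on UNIV h" "\<And>x. x \<notin> K \<Longrightarrow> h x = 0" for h :: "'a \<Rightarrow> real"
  proof -
    have "bounded (h ` K)"
      using that(1) K(1) by (intro compact_imp_bounded compact_continuous_image) (auto intro: continuous_on_subset)
    then obtain M where "\<And>x. x \<in> K \<Longrightarrow> \<bar>h x\<bar> \<le> M" by (auto simp: bounded_iff)
    then show ?thesis
      using that(2) by (intro exI[of _ "max M 0"]) (metis abs_zero max.cobounded2 max.coboundedI1)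
  qed
  from *[of \<phi>] *[of "dir_deriv v \<phi>"] Ck_on_dir_deriv[OF test_function_smooth[OF assms]] K
  obtain M1 M2 where "M1 \<ge> 0" "\<forall>x. \<bar>\<phi> x\<bar> \<le> M1" "M2 \<ge> 0" "\<forall>x. \<bar>dir_deriv v \<phi> x\<bar> \<le> M2" by metis
  then show ?thesis by (intro that[of "max M1 M2"]) (auto simp: le_max_iff_disj)
qed

lemma test_function_DERIV:
  "test_function \<Omega> (\<psi> :: real \<Rightarrow> real) \<Longrightarrow> (\<psi> has_real_derivative dir_deriv 1 \<psi> x) (at x)"
proof -
  assume "test_function \<Omega> \<psi>"
  then have d: "(\<psi> has_derivative (\<lambda>v. dir_deriv v \<psi> x)) (at x)"
    by (intro Ck_on_dir_deriv(1) test_function_smooth)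
  have "dir_deriv v \<psi> x = dir_deriv 1 \<psi> x * v" for v
    using linear_scale[OF has_derivative_linear[OF d], of v 1] by simp
  then have "(\<lambda>v. dir_deriv v \<psi> x) = (*) (dir_deriv 1 \<psi> x)" by (rule ext)
  then show ?thesis using d by (simp add: has_field_derivative_def)
qed

section \<open>Local integrability and integration by parts\<close>

definition locally_integrable :: "(real \<Rightarrow> real) \<Rightarrow> bool" where
  "locally_integrable r \<longleftrightarrow> r \<in> borel_measurable borel \<and> (\<forall>a b. set_integrable lborel {a..b} r)"

lemma set_integrable_mult_bounded:
  fixes r h :: "real \<Rightarrow> real"
  assumes "set_integrable lborel A r" "h \<in> borel_measurable borel" "\<And>x. x \<in> A \<Longrightarrow> \<bar>h x\<bar> \<le> M"
  shows "set_integrable lborel A (\<lambda>x. r x * h x)"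
  unfolding set_integrable_def
proof (rule Bochner_Integration.integrable_bound)
  show "integrable lborel (\<lambda>x. M * (indicat_real A x *\<^sub>R r x))"
    using assms(1) unfolding set_integrable_def by (intro integrable_mult_right) auto
  have "(\<lambda>x. (indicat_real A x *\<^sub>R r x) * h x) \<in> borel_measurable lborel"
    using assms(1,2) unfolding set_integrable_def
    by (intro borel_measurable_times) (auto dest: borel_measurable_integrable)
  then show "(\<lambda>x. indicat_real A x *\<^sub>R (r x * h x)) \<in> borel_measurable lborel"
    by (simp add: mult.assoc)
  show "AE x in lborel. norm (indicat_real A x *\<^sub>R (r x * h x)) \<le> norm (M * (indicat_real A x *\<^sub>R r x))"
    using assms(3)
    by (intro AE_I2)
      (auto simp: indicator_def abs_mult mult.commute intro!: mult_mono order_trans[OF assms(3) abs_ge_self])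
qed

lemma locally_integrable_mult_continuous:
  assumes "locally_integrable r" "continuous_on UNIV h"
  shows "locally_integrable (\<lambda>x. r x * h x)"
  unfolding locally_integrable_def
proof (intro conjI allI)
  have h: "h \<in> borel_measurable borel" using assms(2) by (rule borel_measurable_continuous_onI)
  then show "(\<lambda>x. r x * h x) \<in> borel_measurable borel"
    using assms(1) by (auto simp: locally_integrable_def)
  fix a b :: real
  have "bounded (h ` {a..b})"
    using assms(2) by (intro compact_imp_bounded compact_continuous_image) (auto intro: continuous_on_subset)
  then obtain M where "\<And>x. x \<in> {a..b} \<Longrightarrow> \<bar>h x\<bar> \<le> M"
    unfolding bounded_iff by (metis imageI real_norm_def)
  with assms(1) h show "set_integrable lborel {a..b} (\<lambda>x. r x * h x)"
    by (intro set_integrable_mult_bounded) (auto simp: locally_integrable_def)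
qed

lemma locally_integrable_continuous:
  assumes "continuous_on UNIV h"
  shows "locally_integrable h"
proof -
  have "h \<in> borel_measurable borel" using assms by (rule borel_measurable_continuous_onI)
  moreover have "set_integrable lborel {a..b} h" for a b
    using assms by (intro borel_integrable_atLeastAtMost' continuous_on_subset[OF assms]) auto
  ultimately show ?thesis by (simp add: locally_integrable_def)
qed

text \<open>On a bounded interval \<open>\<bar>g\<bar> \<le> 1 + g\<^sup>2\<close>, and constants are integrable there.\<close>

lemma L2_loc_imp_locally_integrable:
  assumes "L2_loc g"
  shows "locally_integrable g" "locally_integrable (\<lambda>x. (g x)\<^sup>2)"
proof -
  have m [measurable]: "g \<in> borel_measurable borel" and i: "\<And>a b. set_integrable lborel {a..b} (\<lambda>x. (g x)\<^sup>2)"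
    using assms by (auto simp: L2_loc_def)
  then show "locally_integrable (\<lambda>x. (g x)\<^sup>2)" by (simp add: locally_integrable_def)
  have "set_integrable lborel {a..b} g" for a b
  proof (rule set_integrable_bound)
    show "set_integrable lborel {a..b} (\<lambda>x. 1 + (g x)\<^sup>2)"
      using i by (intro set_integral_add) (auto intro: borel_integrable_atLeastAtMost')
    show "set_borel_measurable lborel {a..b} g" by (simp add: set_borel_measurable_def)
    have "\<bar>t\<bar> \<le> \<bar>1 + t\<^sup>2\<bar>" for t :: real
    proof -
      have "0 \<le> (\<bar>t\<bar> - 1/2)\<^sup>2 + 3/4" by simp
      then show ?thesis by (simp add: power2_eq_square algebra_simps)
    qed
    then show "AE x in lborel. x \<in> {a..b} \<longrightarrow> norm (g x) \<le> norm (1 + (g x)\<^sup>2)"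
      by simp
  qed
  with m show "locally_integrable g" by (simp add: locally_integrable_def)
qed

text \<open>The fundamental theorem for gauge integrals tolerates finitely many exceptional points and needs no
  integrability of the derivative in advance; integrability of \<open>r\<close> then turns the result into one on Lebesgue
  integrals. The endpoint terms are kept, because they detect a jump at a gluing point.\<close>

lemma integral_by_parts_piecewise:
  fixes v r \<psi> \<psi>' :: "real \<Rightarrow> real"
  assumes ab: "a \<le> b" and "finite S" and v: "continuous_on {a..b} v"
    and d: "\<And>x. x \<in> {a<..<b} - S \<Longrightarrow> (v has_real_derivative r x) (at x)"
    and r: "set_integrable lborel {a..b} r"
    and \<psi>: "\<And>x. (\<psi> has_real_derivative \<psi>' x) (at x)" "continuous_on UNIV \<psi>'"
  shows "set_integrable lborel {a..b} (\<lambda>x. v x * \<psi>' x)" "set_integrable lborel {a..b} (\<lambda>x. r x * \<psi> x)"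
    "(LINT x:{a..b}|lborel. v x * \<psi>' x) + (LINT x:{a..b}|lborel. r x * \<psi> x) = v b * \<psi> b - v a * \<psi> a"
proof -
  have c\<psi>: "continuous_on UNIV \<psi>"
    by (intro continuous_at_imp_continuous_on ballI DERIV_isCont[OF \<psi>(1)])
  show 1: "set_integrable lborel {a..b} (\<lambda>x. v x * \<psi>' x)"
    by (intro borel_integrable_atLeastAtMost' continuous_intros v continuous_on_subset[OF \<psi>(2)]) auto
  have "bounded (\<psi> ` {a..b})"
    by (intro compact_imp_bounded compact_continuous_image continuous_on_subset[OF c\<psi>]) auto
  then obtain M where "\<And>x. x \<in> {a..b} \<Longrightarrow> \<bar>\<psi> x\<bar> \<le> M"
    unfolding bounded_iff by (metis imageI real_norm_def)
  then show 2: "set_integrable lborel {a..b} (\<lambda>x. r x * \<psi> x)"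
    by (intro set_integrable_mult_bounded[OF r] borel_measurable_continuous_onI c\<psi>)
  have "((\<lambda>x. v x * \<psi>' x + r x * \<psi> x) has_integral (v b * \<psi> b - v a * \<psi> a)) {a..b}"
  proof (rule fundamental_theorem_of_calculus_interior_strong[OF \<open>finite S\<close> ab])
    show "((\<lambda>x. v x * \<psi> x) has_vector_derivative v x * \<psi>' x + r x * \<psi> x) (at x)"
      if "x \<in> {a<..<b} - S" for x
      using DERIV_mult[OF d[OF that] \<psi>(1)[of x]]
      by (simp add: has_real_derivative_iff_has_vector_derivative algebra_simps)
    show "continuous_on {a..b} (\<lambda>x. v x * \<psi> x)"
      by (intro continuous_intros v continuous_on_subset[OF c\<psi>]) auto
  qed
  moreover have "(LINT x:{a..b}|lborel. v x * \<psi>' x) + (LINT x:{a..b}|lborel. r x * \<psi> x)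
    = (LINT x:{a..b}|lborel. v x * \<psi>' x + r x * \<psi> x)"
    using 1 2 by (simp add: set_integral_add)
  ultimately show "(LINT x:{a..b}|lborel. v x * \<psi>' x) + (LINT x:{a..b}|lborel. r x * \<psi> x) = v b * \<psi> b - v a * \<psi> a"
    using set_borel_integral_eq_integral(2)[OF set_integral_add(1)[OF 1 2]]
    by (simp add: integral_unique)
qed

lemma set_integral_restrict:
  fixes f :: "'a \<Rightarrow> real"
  assumes "A \<subseteq> B" "\<And>x. x \<in> B - A \<Longrightarrow> f x = 0"
  shows "set_integrable M B f = set_integrable M A f"
    "(LINT x:B|M. f x) = (LINT x:A|M. f x)"
proof -
  have "(\<lambda>x. indicat_real B x *\<^sub>R f x) = (\<lambda>x. indicat_real A x *\<^sub>R f x)"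
    using assms by (auto simp: indicator_def fun_eq_iff)
  then show "set_integrable M B f = set_integrable M A f" "(LINT x:B|M. f x) = (LINT x:A|M. f x)"
    by (simp_all add: set_integrable_def set_lebesgue_integral_def)
qed

lemma compact_subset_Icc:
  fixes K :: "real set"
  assumes "compact K" obtains a b where "a \<le> b" "K \<subseteq> {a..b}"
proof -
  obtain B where "\<And>x. x \<in> K \<Longrightarrow> \<bar>x\<bar> \<le> B"
    using compact_imp_bounded[OF assms] by (auto simp: bounded_iff)
  then have "K \<subseteq> {-\<bar>B\<bar>..\<bar>B\<bar>}" by (force simp: abs_le_iff)
  then show ?thesis by (intro that[of "-\<bar>B\<bar>" "\<bar>B\<bar>"]) auto
qed

lemma weak_deriv_piecewise:
  fixes v r :: "real \<Rightarrow> real"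
  assumes "finite S" "continuous_on UNIV v"
    and "\<And>x. x \<notin> S \<Longrightarrow> (v has_real_derivative r x) (at x)" and "locally_integrable r"
  shows "weak_deriv UNIV 1 v r"
  unfolding weak_deriv_def
proof (intro allI impI)
  fix \<psi> :: "real \<Rightarrow> real" assume \<psi>: "test_function UNIV \<psi>"
  obtain K where K: "compact K" "\<And>x. x \<notin> K \<Longrightarrow> \<psi> x = 0" "\<And>x v. x \<notin> K \<Longrightarrow> dir_deriv v \<psi> x = 0"
    using test_functionE[OF \<psi>] by metis
  obtain a b where ab: "a \<le> b" "K \<subseteq> {a..b}" using compact_subset_Icc[OF K(1)] .
  have z: "\<And>x. x \<notin> {a..b} \<Longrightarrow> \<psi> x = 0" "\<And>x. x \<notin> {a..b} \<Longrightarrow> dir_deriv 1 \<psi> x = 0" using K ab by blast+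
  have z': "\<psi> (a - 1) = 0" "\<psi> (b + 1) = 0" using ab by (auto intro!: z(1))
  have sub: "{a-1..b+1} \<subseteq> (UNIV::real set)" by simp
  note I = integral_by_parts_piecewise[of "a - 1" "b + 1" S v r \<psi> "dir_deriv 1 \<psi>"]
  have I': "set_integrable lborel {a-1..b+1} (\<lambda>x. v x * dir_deriv 1 \<psi> x)" "set_integrable lborel {a-1..b+1} (\<lambda>x. r x * \<psi> x)"
    "(LINT x:{a-1..b+1}|lborel. v x * dir_deriv 1 \<psi> x) + (LINT x:{a-1..b+1}|lborel. r x * \<psi> x) = 0"
    using I[OF _ assms(1) continuous_on_subset[OF assms(2) subset_UNIV] assms(3) _ test_function_DERIV[OF \<psi>]
        Ck_on_dir_deriv(2)[OF test_function_smooth[OF \<psi>]]] assms(4) ab z'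
    by (auto simp: locally_integrable_def)
  have r1: "set_integrable lborel UNIV f = set_integrable lborel {a-1..b+1} f" "(LINT x:UNIV|lborel. f x) = (LINT x:{a-1..b+1}|lborel. f x)"
    if "\<And>x. x \<notin> {a..b} \<Longrightarrow> f x = 0" for f :: "real \<Rightarrow> real"
    by (rule set_integral_restrict[OF sub]; use that in auto)+
  show "set_integrable lborel UNIV (\<lambda>x. v x * dir_deriv 1 \<psi> x) \<and>
        set_integrable lborel UNIV (\<lambda>x. r x * \<psi> x) \<and>
        (LINT x:UNIV|lborel. v x * dir_deriv 1 \<psi> x) = - (LINT x:UNIV|lborel. r x * \<psi> x)"
    using I' r1[of "\<lambda>x. v x * dir_deriv 1 \<psi> x"] r1[of "\<lambda>x. r x * \<psi> x"] z by simp
qed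

section \<open>The fundamental lemma of the calculus of variations\<close>

text \<open>Open intervals form an intersection-stable generator of the Borel sets, so the integral over every Borel
  set vanishes.\<close>

lemma AE_zero_of_interval_integrals:
  fixes r :: "real \<Rightarrow> real"
  assumes r: "set_integrable lborel {p..q} r" and "p \<le> q"
    and 0: "\<And>a b. p \<le> a \<Longrightarrow> a \<le> b \<Longrightarrow> b \<le> q \<Longrightarrow> (LINT x:{a<..<b}|lborel. r x) = 0"
  shows "AE x in lborel. x \<in> {p<..<q} \<longrightarrow> r x = 0"
proof -
  have borel_eq: "borel = sigma UNIV (range (\<lambda>(a, b). {a<..<b::real}))"
  proof -
    have "(\<lambda>(a, b). {a<..<b::real}) = (\<lambda>(a, b). box a b)" by (auto simp: fun_eq_iff)
    then show ?thesis using borel_eq_box[where 'a = real] by simp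
  qed
  have int_stable: "Int_stable (range (\<lambda>(a, b). {a<..<b::real}))"
    unfolding Int_stable_def
  proof (intro ballI)
    fix A B :: "real set"
    assume "A \<in> range (\<lambda>(a, b). {a<..<b})" "B \<in> range (\<lambda>(a, b). {a<..<b})"
    then obtain a b c d where "A = {a<..<b}" "B = {c<..<d}" by auto
    then have "A \<inter> B = (\<lambda>(a, b). {a<..<b}) (max a c, min b d)" by auto
    then show "A \<inter> B \<in> range (\<lambda>(a, b). {a<..<b})" by blast
  qed
  \<comment> \<open>Restriction to \<open>(p, q)\<close> makes the function integrable on the whole line.\<close>
  define f where "f x = indicat_real {p<..<q} x * r x" for x
  have f: "integrable lborel f"
    using set_integrable_subset[OF r, of "{p<..<q}"] unfolding f_def set_integrable_def
    by (auto simp: greaterThanLessThan_subseteq_atLeastAtMost_iff)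
  have *: "(LINT x:A|lborel. f x) = 0" if "A \<in> sets borel" for A
  proof -
    have "A \<in> sigma_sets UNIV (range (\<lambda>(a, b). {a<..<b::real}))"
      using that unfolding borel_eq by (simp add: sets_measure_of)
    then have "A \<in> sigma_sets UNIV (range (\<lambda>(a, b). {a<..<b::real}))" "range (\<lambda>(a, b). {a<..<b::real}) \<subseteq> Pow UNIV"
      by auto
    from int_stable this(2,1) show ?thesis
    proof (induction rule: sigma_sets_induct_disjoint)
      case (basic A)
      then obtain a b where A: "A = {a<..<b}" by auto
      have "(LINT x:A|lborel. f x) = (LINT x:{max a p<..<min b q}|lborel. r x)"
        unfolding set_lebesgue_integral_def f_def A
        by (intro Bochner_Integration.integral_cong) (auto simp: indicator_def)
      also have "\<dots> = 0"
      proof (cases "max a p \<le> min b q")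
        case True then show ?thesis by (intro 0) auto
      next
        case False
        then have "{max a p<..<min b q} = {}" by auto
        then show ?thesis by (simp add: set_lebesgue_integral_def)
      qed
      finally show ?case .
    next
      case (compl A)
      have A: "A \<in> sets borel" using compl(1) unfolding borel_eq by (simp add: sets_measure_of)
      have "(LINT x:UNIV|lborel. f x) = (LINT x:{p<..<q}|lborel. r x)"
        unfolding set_lebesgue_integral_def f_def by simp
      then have U: "(LINT x:UNIV|lborel. f x) = 0" using 0[of p q] \<open>p \<le> q\<close> by simp
      have i: "set_integrable lborel B f" if "B \<in> sets borel" for B
        using f that unfolding set_integrable_def by (intro integrable_mult_indicator) auto
      have "(LINT x:A \<union> (UNIV - A)|lborel. f x) = (LINT x:A|lborel. f x) + (LINT x:UNIV - A|lborel. f x)"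
        using A by (intro set_integral_Un i) auto
      then show ?case using U compl by simp
    next
      case (union A)
      have A: "range A \<subseteq> sets borel" using union(2) unfolding borel_eq by (simp add: sets_measure_of)
      have "set_integrable lborel (\<Union>i. A i) f"
        using f A unfolding set_integrable_def by (intro integrable_mult_indicator) auto
      then have "(LINT x:(\<Union>i. A i)|lborel. f x) = (\<Sum>i. (LINT x:A i|lborel. f x))"
        using A union(1) by (intro lebesgue_integral_countable_add) (auto simp: disjoint_family_on_def)
      then show ?case using union(3) by simp
    qed (auto simp: set_lebesgue_integral_def)
  qed
  have "AE x in lborel. f x = 0"
    using * by (intro density_unique_real[OF f, of "\<lambda>x. 0"]) auto
  then show ?thesis by eventually_elim (auto simp: f_def)
qed

text \<open>An open set is a countable union of intervals with rational endpoints.\<close>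

lemma AE_open_of_intervals:
  fixes J :: "real set"
  assumes "open J" and P: "\<And>a b. a < b \<Longrightarrow> {a..b} \<subseteq> J \<Longrightarrow> AE x in lborel. x \<in> {a<..<b} \<longrightarrow> P x"
  shows "AE x in lborel. x \<in> J \<longrightarrow> P x"
proof -
  have "AE x in lborel. \<forall>a\<in>\<rat>. \<forall>b\<in>\<rat>. a < b \<and> {a..b} \<subseteq> J \<longrightarrow> x \<in> {a<..<b} \<longrightarrow> P x"
    using P by (intro AE_ball_countable[THEN iffD2] countable_rat ballI) (auto intro: AE_I2)
  then show ?thesis
  proof eventually_elim
    case (elim x)
    show ?case
    proof
      assume "x \<in> J"
      then obtain e where e: "e > 0" "ball x e \<subseteq> J" using \<open>open J\<close> by (auto simp: open_contains_ball)
      obtain a b where ab: "a \<in> \<rat>" "b \<in> \<rat>" "x - e < a" "a < x" "x < b" "b < x + e"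
        using Rats_dense_in_real[of "x - e" x] Rats_dense_in_real[of x "x + e"] e(1) by auto
      moreover have "{a..b} \<subseteq> ball x e" using ab by (auto simp: dist_real_def)
      ultimately show "P x" using elim e(2) by auto
    qed
  qed
qed

lemma fundamental_lemma:
  fixes r :: "real \<Rightarrow> real"
  assumes "open J" and r: "\<And>a b. {a..b} \<subseteq> J \<Longrightarrow> set_integrable lborel {a..b} r"
    and 0: "\<And>\<psi> a b. test_function {a..b} \<psi> \<Longrightarrow> a \<le> b \<Longrightarrow> {a..b} \<subseteq> J \<Longrightarrow> (LINT x:{a..b}|lborel. r x * \<psi> x) = 0"
  shows "AE x in lborel. x \<in> J \<longrightarrow> r x = 0"
proof (rule AE_open_of_intervals[OF \<open>open J\<close>])
  fix p q :: real assume pq: "p < q" "{p..q} \<subseteq> J"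
  show "AE x in lborel. x \<in> {p<..<q} \<longrightarrow> r x = 0"
  proof (rule AE_zero_of_interval_integrals)
    fix a b assume ab: "p \<le> a" "a \<le> b" "b \<le> q"
    have ri: "integrable lborel (\<lambda>x. indicator {a..b} x *\<^sub>R r x)"
      using r[of a b] ab pq by (fastforce simp: set_integrable_def)
    have "(\<lambda>n. LINT x|lborel. indicator {a..b} x *\<^sub>R (r x * bump (real (Suc n)) a b x)) \<longlonglongrightarrow>
        (LINT x|lborel. indicator {a..b} x *\<^sub>R (r x * indicator {a<..<b} x))"
    proof (rule integral_dominated_convergence[where w = "\<lambda>x. \<bar>indicator {a..b} x *\<^sub>R r x\<bar>"])
      have [measurable]: "(\<lambda>x. indicator {a..b} x *\<^sub>R r x) \<in> borel_measurable lborel"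
        using ri by (rule borel_measurable_integrable)
      have [measurable]: "bump k a b \<in> borel_measurable borel" for k
        using Ck_on_bump[of 0 UNIV k a b] by (auto intro: borel_measurable_continuous_onI)
      have "(\<lambda>x. (indicator {a..b} x *\<^sub>R r x) * indicator {a<..<b} x) \<in> borel_measurable lborel" by measurable
      then show "(\<lambda>x. indicator {a..b} x *\<^sub>R (r x * indicator {a<..<b} x)) \<in> borel_measurable lborel"
        by (simp add: mult.assoc)
      have "(\<lambda>x. (indicator {a..b} x *\<^sub>R r x) * bump (real (Suc n)) a b x) \<in> borel_measurable lborel" for n by measurable
      then show "(\<lambda>x. indicator {a..b} x *\<^sub>R (r x * bump (real (Suc n)) a b x)) \<in> borel_measurable lborel" for n
        by (simp add: mult.assoc)
      show "integrable lborel (\<lambda>x. \<bar>indicator {a..b} x *\<^sub>R r x\<bar>)" using ri by (rule integrable_abs)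
      show "AE x in lborel. (\<lambda>n. indicat_real {a..b} x *\<^sub>R (r x * bump (real (Suc n)) a b x))
           \<longlonglongrightarrow> indicat_real {a..b} x *\<^sub>R (r x * indicat_real {a<..<b} x)"
        using ab by (intro AE_I2 tendsto_intros bump_tendsto_indicator)
      show "AE x in lborel. norm (indicat_real {a..b} x *\<^sub>R (r x * bump (real (Suc n)) a b x))
          \<le> \<bar>indicat_real {a..b} x *\<^sub>R r x\<bar>" for n
        by (intro AE_I2) (auto simp: indicator_def abs_mult bump_nonneg bump_le_1 intro!: mult_left_le)
    qed
    moreover have "(LINT x|lborel. indicator {a..b} x *\<^sub>R (r x * bump (real (Suc n)) a b x)) = 0" for n
    proof -
      have "{a..b} \<subseteq> J" using ab pq by auto
      then show ?thesis using 0[OF test_function_bump[of "real (Suc n)" a b] ab(2)] ab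
        by (simp add: set_lebesgue_integral_def)
    qed
    ultimately have "(LINT x|lborel. indicator {a..b} x *\<^sub>R (r x * indicator {a<..<b} x)) = 0"
      by (simp add: LIMSEQ_const_iff)
    moreover have "(LINT x:{a<..<b}|lborel. r x) = (LINT x|lborel. indicator {a..b} x *\<^sub>R (r x * indicator {a<..<b} x))"
      unfolding set_lebesgue_integral_def by (intro Bochner_Integration.integral_cong) (auto simp: indicator_def)
    ultimately show "(LINT x:{a<..<b}|lborel. r x) = 0" by simp
  qed (use pq r in auto)
qed

text \<open>The difference of \<open>g\<close> and the classical derivative integrates to zero against all test functions on \<open>J\<close>.\<close>

lemma weak_deriv_eq_classical:
  fixes w g w1 :: "real \<Rightarrow> real"
  assumes wd: "weak_deriv UNIV 1 w g" and g: "locally_integrable g" and "open J"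
    and w1: "\<And>x. x \<in> J \<Longrightarrow> (w has_real_derivative w1 x) (at x)" "continuous_on J w1"
  shows "AE x in lborel. x \<in> J \<longrightarrow> g x = w1 x"
proof -
  have i1: "set_integrable lborel {a..b} w1" if "{a..b} \<subseteq> J" for a b
    by (intro borel_integrable_atLeastAtMost' continuous_on_subset[OF w1(2) that])
  have i2: "set_integrable lborel {a..b} g" for a b using g by (simp add: locally_integrable_def)
  have "AE x in lborel. x \<in> J \<longrightarrow> g x - w1 x = 0"
  proof (rule fundamental_lemma[OF \<open>open J\<close>])
    show "set_integrable lborel {a..b} (\<lambda>x. g x - w1 x)" if "{a..b} \<subseteq> J" for a b
      using i1[OF that] i2 by (rule set_integral_diff(1)[rotated])
    fix \<psi> :: "real \<Rightarrow> real" and a b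
    assume \<psi>: "test_function {a..b} \<psi>" and ab: "a \<le> b" "{a..b} \<subseteq> J"
    have \<psi>U: "test_function UNIV \<psi>" using \<psi> by (rule test_function_mono) simp
    obtain K where K: "compact K" "K \<subseteq> {a..b}" "\<And>x. x \<notin> K \<Longrightarrow> \<psi> x = 0" "\<And>x v. x \<notin> K \<Longrightarrow> dir_deriv v \<psi> x = 0"
      using test_functionE[OF \<psi>] by metis
    have c: "continuous_on UNIV \<psi>" using Ck_on_dir_deriv(3)[OF test_function_smooth[OF \<psi>]] .
    \<comment> \<open>The support may reach \<open>a\<close> and \<open>b\<close>, but \<open>\<psi>\<close> is continuous and vanishes outside \<open>[a, b]\<close>.\<close>
    have "\<psi> a = 0 \<and> \<psi> b = 0"
    proof -
      have *: "\<psi> y = 0" if "(\<psi> \<longlongrightarrow> \<psi> y) F" "eventually (\<lambda>x. \<psi> x = 0) F" "F \<noteq> bot" for y F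
        using tendsto_unique[OF that(3,1)] tendsto_eventually[OF that(2)] by simp
      have "(\<psi> \<longlongrightarrow> \<psi> a) (at_left a)" "(\<psi> \<longlongrightarrow> \<psi> b) (at_right b)"
        using c by (auto simp: continuous_on_eq_continuous_at isCont_def intro: filterlim_at_split[THEN iffD1, THEN conjunct1] filterlim_at_split[THEN iffD1, THEN conjunct2])
      moreover have "eventually (\<lambda>x. \<psi> x = 0) (at_left a)" "eventually (\<lambda>x. \<psi> x = 0) (at_right b)"
        using K(2,3) unfolding eventually_at_filter by (auto intro!: always_eventually intro: K(3))
      ultimately show ?thesis using * by (auto simp: trivial_limit_at_left_real trivial_limit_at_right_real)
    qed
    have dw: "(w has_real_derivative w1 x) (at x)" if "x \<in> {a..b}" for x using that ab w1 by blast
    then have cw: "continuous_on {a..b} w"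
      by (intro continuous_at_imp_continuous_on ballI DERIV_isCont)
    from \<open>\<psi> a = 0 \<and> \<psi> b = 0\<close> have e1: "set_integrable lborel {a..b} (\<lambda>x. w1 x * \<psi> x)"
      "(LINT x:{a..b}|lborel. w x * dir_deriv 1 \<psi> x) + (LINT x:{a..b}|lborel. w1 x * \<psi> x) = 0"
      using integral_by_parts_piecewise[OF ab(1) finite.emptyI cw dw i1[OF ab(2)] test_function_DERIV[OF \<psi>]
          Ck_on_dir_deriv(2)[OF test_function_smooth[OF \<psi>]]]
      by auto
    have res: "set_integrable lborel UNIV f = set_integrable lborel {a..b} f" "(LINT x:UNIV|lborel. f x) = (LINT x:{a..b}|lborel. f x)"
      if "\<And>x. x \<notin> K \<Longrightarrow> f x = 0" for f :: "real \<Rightarrow> real"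
      by (rule set_integral_restrict; use that K(2) in blast)+
    have e2: "set_integrable lborel {a..b} (\<lambda>x. g x * \<psi> x)"
      "(LINT x:{a..b}|lborel. w x * dir_deriv 1 \<psi> x) = - (LINT x:{a..b}|lborel. g x * \<psi> x)"
      using wd[unfolded weak_deriv_def, rule_format, OF \<psi>U]
        res[of "\<lambda>x. g x * \<psi> x"] res[of "\<lambda>x. w x * dir_deriv 1 \<psi> x"] K(3,4) by auto
    show "(LINT x:{a..b}|lborel. (g x - w1 x) * \<psi> x) = 0"
      using set_integral_diff(2)[OF e2(1) e1(1)] e1(2) e2(2) by (simp add: left_diff_distrib)
  qed
  then show ?thesis by simp
qed

section \<open>The moving frame\<close>

lemma locally_integrableD:
  "locally_integrable r \<Longrightarrow> r \<in> borel_measurable borel"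
  "locally_integrable r \<Longrightarrow> set_integrable lborel {a..b} r"
  by (auto simp: locally_integrable_def)

lemma measurable_moving_frame:
  fixes A :: "real \<Rightarrow> real"
  assumes "A \<in> borel_measurable borel"
  shows "(\<lambda>p. A (snd p - s * fst p)) \<in> borel_measurable (borel :: (real \<times> real) measure)"
proof (rule measurable_compose[OF _ assms])
  show "(\<lambda>p. snd p - s * fst p) \<in> borel_measurable (borel :: (real \<times> real) measure)"
    by (intro borel_measurable_continuous_onI continuous_intros)
qed

lemma integrable_product_bounded:
  fixes A :: "real \<Rightarrow> real" and B :: "real \<times> real \<Rightarrow> real"
  assumes A: "locally_integrable A" and [measurable]: "B \<in> borel_measurable borel" and "\<And>p. \<bar>B p\<bar> \<le> C"
    and "compact K" "\<And>p. p \<notin> K \<Longrightarrow> B p = 0"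
  shows "integrable lborel (\<lambda>(t, \<xi>). A \<xi> * B (t, \<xi>))"
proof -
  have [measurable]: "A \<in> borel_measurable borel" using A by (rule locally_integrableD)
  obtain M where M: "\<And>t \<xi>. (t, \<xi>) \<in> K \<Longrightarrow> \<bar>t\<bar> \<le> M \<and> \<bar>\<xi>\<bar> \<le> M"
  proof -
    obtain a where a: "\<And>x. x \<in> K \<Longrightarrow> norm x \<le> a"
      using compact_imp_bounded[OF \<open>compact K\<close>] by (auto simp: bounded_iff)
    show ?thesis
      by (rule that[of a]) (use a norm_fst_le norm_snd_le order_trans in \<open>fastforce\<close>)
  qed
  have i: "integrable (lborel \<Otimes>\<^sub>M lborel) (\<lambda>p. indicat_real {-M..M} (fst p) * (indicat_real {-M..M} (snd p) * (C * \<bar>A (snd p)\<bar>)))"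
  proof (rule lborel_pair.Fubini_integrable)
    have "set_integrable lborel {-M..M} A" using A by (rule locally_integrableD)
    then have "set_integrable lborel {-M..M} (\<lambda>x. C * \<bar>A x\<bar>)"
      by (intro set_integrable_mult_right set_integrable_abs)
    then have j: "integrable lborel (\<lambda>x. indicat_real {-M..M} x * (C * \<bar>A x\<bar>))"
      by (simp add: set_integrable_def)
    then show "AE x in lborel. integrable lborel (\<lambda>y. indicat_real {-M..M} (fst (x, y)) * (indicat_real {-M..M} (snd (x, y)) * (C * \<bar>A (snd (x, y))\<bar>)))"
      by (auto simp del: abs_mult)
    show "integrable lborel (\<lambda>x. LINT y|lborel. norm (indicat_real {-M..M} (fst (x, y)) * (indicat_real {-M..M} (snd (x, y)) * (C * \<bar>A (snd (x, y))\<bar>))))"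
      by (auto simp: abs_mult intro!: integrable_mult_left integrable_real_indicator emeasure_compact_finite)
  qed measurable
  have "integrable (lborel \<Otimes>\<^sub>M lborel) (\<lambda>p. A (snd p) * B p)"
  proof (rule Bochner_Integration.integrable_bound[OF i])
    have [measurable]: "(\<lambda>p. A (snd p)) \<in> borel_measurable (borel :: (real \<times> real) measure)"
      using measurable_moving_frame[OF locally_integrableD(1)[OF A], of 0] by simp
    show "(\<lambda>p. A (snd p) * B p) \<in> borel_measurable (lborel \<Otimes>\<^sub>M lborel)"
      unfolding lborel_prod by measurable
    show "AE p in lborel \<Otimes>\<^sub>M lborel. norm (A (snd p) * B p)
       \<le> norm (indicat_real {-M..M} (fst p) * (indicat_real {-M..M} (snd p) * (C * \<bar>A (snd p)\<bar>)))"
    proof (rule AE_I2)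
      fix p :: "real \<times> real"
      show "norm (A (snd p) * B p) \<le> norm (indicat_real {-M..M} (fst p) * (indicat_real {-M..M} (snd p) * (C * \<bar>A (snd p)\<bar>)))"
      proof (cases "p \<in> K")
        case True
        then have "\<bar>fst p\<bar> \<le> M" "\<bar>snd p\<bar> \<le> M" using M[of "fst p" "snd p"] by auto
        moreover have "\<bar>B p\<bar> \<le> \<bar>C\<bar>" using assms(3)[of p] by linarith
        ultimately show ?thesis using mult_right_mono[of "\<bar>B p\<bar>" "\<bar>C\<bar>" "\<bar>A (snd p)\<bar>"]
          by (auto simp: abs_mult indicator_def abs_le_iff mult.commute)
      qed (simp add: assms(5))
    qed
  qed
  then show ?thesis by (simp add: lborel_prod case_prod_unfold)
qed

text \<open>The passage from \<open>(t, \<xi>)\<close> to \<open>(t, x)\<close> with \<open>x = \<xi> + s t\<close>.\<close>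

definition shear :: "real \<Rightarrow> real \<times> real \<Rightarrow> real \<times> real" where
  "shear s p = (fst p, snd p + s * fst p)"

lemma shear_simps [simp]: "shear s (t, x) = (t, x + s * t)" by (simp add: shear_def)

lemma bounded_linear_shear: "bounded_linear (shear s)"
  unfolding shear_def [abs_def]
  by (intro bounded_linear_Pair bounded_linear_add bounded_linear_fst bounded_linear_snd
      bounded_linear_compose[OF bounded_linear_mult_right bounded_linear_fst])

lemma shear_shear: "shear s (shear (- s) p) = p" "shear (- s) (shear s p) = p"
  by (auto simp: shear_def)

lemma measurable_shear [measurable]: "shear s \<in> borel_measurable borel"
  by (intro borel_measurable_continuous_onI linear_continuous_on bounded_linear_shear)

text \<open>By Tonelli: for fixed \<open>t\<close> the shear is a translation in \<open>x\<close>.\<close>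

lemma distr_shear: "distr lborel borel (shear s) = lborel"
proof (rule measure_eqI)
  fix A assume "A \<in> sets (distr lborel borel (shear s))"
  then have A [measurable]: "A \<in> sets borel" by simp
  have m: "(\<lambda>p. indicator A p :: ennreal) \<in> borel_measurable (lborel \<Otimes>\<^sub>M lborel)"
    by (simp add: lborel_prod)
  have ms: "(\<lambda>p. indicator A (shear s p) :: ennreal) \<in> borel_measurable (lborel \<Otimes>\<^sub>M lborel)"
    by (simp add: lborel_prod)
  have "emeasure (distr lborel borel (shear s)) A = (\<integral>\<^sup>+p. indicator A (shear s p) \<partial>lborel)"
    by (subst nn_integral_indicator[symmetric], simp, subst nn_integral_distr) simp_all
  also have "\<dots> = (\<integral>\<^sup>+t. \<integral>\<^sup>+x. indicator A (shear s (t, x)) \<partial>lborel \<partial>lborel)"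
    by (subst lborel.nn_integral_fst[OF ms]) (simp add: lborel_prod)
  also have "\<dots> = (\<integral>\<^sup>+t. \<integral>\<^sup>+x. indicator A (t, x) \<partial>lborel \<partial>lborel)"
  proof (rule nn_integral_cong)
    fix t :: real
    show "(\<integral>\<^sup>+x. indicator A (shear s (t, x)) \<partial>lborel) = (\<integral>\<^sup>+x. indicator A (t, x) \<partial>lborel)"
      using nn_integral_real_affine[of "\<lambda>x. indicator A (t, x)" 1 "s * t"] by (simp add: add.commute)
  qed
  also have "\<dots> = emeasure lborel A"
    by (subst lborel.nn_integral_fst[OF m]) (simp add: lborel_prod)
  finally show "emeasure (distr lborel borel (shear s)) A = emeasure lborel A" .
qed simp

lemma half_plane_integral_shear:
  fixes F :: "real \<times> real \<Rightarrow> real"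
  assumes [measurable]: "F \<in> borel_measurable borel" and "\<And>p. p \<notin> half_plane \<Longrightarrow> F p = 0"
  shows "set_integrable lborel half_plane F \<longleftrightarrow> integrable lborel (\<lambda>p. F (shear s p))"
    "(LINT p:half_plane|lborel. F p) = (LINT p|lborel. F (shear s p))"
proof -
  have "(\<lambda>p. indicat_real half_plane p *\<^sub>R F p) = F" using assms(2) by (auto simp: indicator_def fun_eq_iff)
  moreover have "integrable (distr lborel borel (shear s)) F \<longleftrightarrow> integrable lborel (\<lambda>p. F (shear s p))"
    "integral\<^sup>L (distr lborel borel (shear s)) F = (LINT p|lborel. F (shear s p))"
    by (intro integrable_distr_eq integral_distr; simp)+
  ultimately show "set_integrable lborel half_plane F \<longleftrightarrow> integrable lborel (\<lambda>p. F (shear s p))"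
    "(LINT p:half_plane|lborel. F p) = (LINT p|lborel. F (shear s p))"
    by (simp_all add: set_integrable_def set_lebesgue_integral_def distr_shear)
qed

lemma test_function_shear:
  assumes "test_function half_plane \<phi>"
  shows "test_function half_plane (\<lambda>p. \<phi> (shear s p))"
proof -
  obtain K where K: "compact K" "K \<subseteq> half_plane" "\<And>x. x \<notin> K \<Longrightarrow> \<phi> x = 0"
    using assms by (auto simp: test_function_def)
  have "compact (shear (- s) ` K)"
    by (intro compact_continuous_image linear_continuous_on bounded_linear_shear K)
  moreover have "shear (- s) ` K \<subseteq> half_plane" using K(2) by (auto simp: shear_def)
  moreover have "\<phi> (shear s p) = 0" if "p \<notin> shear (- s) ` K" for p
  proof (rule K(3))
    show "shear s p \<notin> K" using that shear_shear(2)[of s p] by (metis image_eqI)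
  qed
  moreover have "Ck_on n UNIV (\<lambda>p. \<phi> (shear s p))" for n
    using Ck_on_affine[OF test_function_smooth[OF assms, rule_format] bounded_linear_shear, of n 0] by simp
  ultimately show ?thesis by (auto simp: test_function_def)
qed

lemma dir_deriv_shear:
  assumes "\<forall>n. Ck_on n UNIV \<phi>"
  shows "dir_deriv v (\<lambda>p. \<phi> (shear s p)) p = dir_deriv (shear s v) \<phi> (shear s p)"
proof -
  have "((\<lambda>p. \<phi> (shear s p)) has_derivative (\<lambda>v. dir_deriv (shear s v) \<phi> (shear s p))) (at p)"
    by (rule has_derivative_compose[OF bounded_linear_imp_has_derivative[OF bounded_linear_shear]
        Ck_on_dir_deriv(1)[OF assms]])
  from fun_cong[OF frechet_derivative_at[OF this], of v] show ?thesis by (simp add: dir_deriv_def)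
qed

lemma dir_deriv_add:
  assumes "\<forall>n. Ck_on n UNIV \<phi>"
  shows "dir_deriv (u + k *\<^sub>R v) \<phi> p = dir_deriv u \<phi> p + k * dir_deriv v \<phi> p"
proof -
  note l = has_derivative_linear[OF Ck_on_dir_deriv(1)[OF assms, of p]]
  show ?thesis using linear_add[OF l, of u "k *\<^sub>R v"] linear_scale[OF l, of k v] by simp
qed

text \<open>In the moving frame \<open>\<partial>\<^sub>t\<close> becomes \<open>\<partial>\<^sub>t - s \<partial>\<^sub>\<xi>\<close>.\<close>

lemma dir_deriv_moving_frame:
  assumes "\<forall>n. Ck_on n UNIV \<phi>"
  shows "dir_deriv (0, 1) \<phi> (shear s p) = dir_deriv (0, 1) (\<lambda>p. \<phi> (shear s p)) p"
    "dir_deriv (1, 0) \<phi> (shear s p) =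
      dir_deriv (1, 0) (\<lambda>p. \<phi> (shear s p)) p - s * dir_deriv (0, 1) (\<lambda>p. \<phi> (shear s p)) p"
proof -
  show 1: "dir_deriv (0, 1) \<phi> (shear s p) = dir_deriv (0, 1) (\<lambda>p. \<phi> (shear s p)) p"
    by (simp add: dir_deriv_shear[OF assms])
  have "dir_deriv (1, s) \<phi> (shear s p) = dir_deriv (1, 0) \<phi> (shear s p) + s * dir_deriv (0, 1) \<phi> (shear s p)"
    using dir_deriv_add[OF assms, of "(1, 0)" s "(0, 1)" "shear s p"] by simp
  then show "dir_deriv (1, 0) \<phi> (shear s p) =
      dir_deriv (1, 0) (\<lambda>p. \<phi> (shear s p)) p - s * dir_deriv (0, 1) (\<lambda>p. \<phi> (shear s p)) p"
    by (simp add: dir_deriv_shear[OF assms])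
qed

lemma test_function_slice:
  assumes "test_function \<Omega> (\<phi> :: real \<times> real \<Rightarrow> real)"
  shows "test_function UNIV (\<lambda>t. \<phi> (t, x))" "dir_deriv 1 (\<lambda>t. \<phi> (t, x)) t = dir_deriv (1, 0) \<phi> (t, x)"
    "test_function UNIV (\<lambda>x. \<phi> (t, x))" "dir_deriv 1 (\<lambda>x. \<phi> (t, x)) x = dir_deriv (0, 1) \<phi> (t, x)"
proof -
  obtain K where K: "compact K" "\<And>p. p \<notin> K \<Longrightarrow> \<phi> p = 0"
    using assms by (auto simp: test_function_def)
  note sm = test_function_smooth[OF assms]
  have l1: "bounded_linear (\<lambda>t. (t, 0) :: real \<times> real)" and l2: "bounded_linear (\<lambda>t. (0, t) :: real \<times> real)"
    by (auto intro!: bounded_linear_Pair bounded_linear_ident bounded_linear_zero)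
  have "Ck_on n UNIV (\<lambda>t. \<phi> (t, x))" for n
    using Ck_on_affine[OF sm[rule_format] l1, of n "(0, x)"] by simp
  moreover have "compact (fst ` K)" "compact (snd ` K)"
    by (auto intro!: compact_continuous_image continuous_intros K)
  ultimately show "test_function UNIV (\<lambda>t. \<phi> (t, x))"
    unfolding test_function_def using K(2) by (metis fst_conv image_eqI subset_UNIV)
  have "Ck_on n UNIV (\<lambda>x. \<phi> (t, x))" for n
    using Ck_on_affine[OF sm[rule_format] l2, of n "(t, 0)"] by simp
  with \<open>compact (snd ` K)\<close> show "test_function UNIV (\<lambda>x. \<phi> (t, x))"
    unfolding test_function_def using K(2) by (metis snd_conv image_eqI subset_UNIV)
  have "((\<lambda>t. (t, x)) has_derivative (\<lambda>t. (t, 0))) (at t)" "((\<lambda>x. (t, x)) has_derivative (\<lambda>t. (0, t))) (at x)"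
    by (auto intro!: derivative_eq_intros)
  note * = this[THEN has_derivative_compose, OF Ck_on_dir_deriv(1)[OF sm]]
  show "dir_deriv 1 (\<lambda>t. \<phi> (t, x)) t = dir_deriv (1, 0) \<phi> (t, x)"
    using frechet_derivative_at[OF *(1)] by (simp add: dir_deriv_def fun_eq_iff)
  show "dir_deriv 1 (\<lambda>x. \<phi> (t, x)) x = dir_deriv (0, 1) \<phi> (t, x)"
    using frechet_derivative_at[OF *(2)] by (simp add: dir_deriv_def fun_eq_iff)
qed

lemma test_function_measurable:
  fixes \<phi> :: "'a::euclidean_space \<Rightarrow> real"
  assumes "test_function \<Omega> \<phi>"
  shows "\<phi> \<in> borel_measurable borel" "dir_deriv v \<phi> \<in> borel_measurable borel"
  using Ck_on_dir_deriv[OF test_function_smooth[OF assms]]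
  by (auto intro: borel_measurable_continuous_onI)

lemma integrable_times_test_function:
  fixes \<phi> :: "real \<times> real \<Rightarrow> real"
  assumes "locally_integrable A" "test_function \<Omega> \<phi>"
  shows "integrable lborel (\<lambda>(t, \<xi>). A \<xi> * \<phi> (t, \<xi>))" "integrable lborel (\<lambda>(t, \<xi>). A \<xi> * dir_deriv v \<phi> (t, \<xi>))"
proof -
  obtain K where "compact K" "\<And>p. p \<notin> K \<Longrightarrow> \<phi> p = 0" "\<And>p. p \<notin> K \<Longrightarrow> dir_deriv v \<phi> p = 0"
    using test_functionE[OF assms(2)] by metis
  moreover obtain M where "\<And>p. \<bar>\<phi> p\<bar> \<le> M" "\<And>p. \<bar>dir_deriv v \<phi> p\<bar> \<le> M"
    using test_function_bounded[OF assms(2), of v] by metis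
  ultimately show "integrable lborel (\<lambda>(t, \<xi>). A \<xi> * \<phi> (t, \<xi>))" "integrable lborel (\<lambda>(t, \<xi>). A \<xi> * dir_deriv v \<phi> (t, \<xi>))"
    using integrable_product_bounded[OF assms(1) test_function_measurable(1)[OF assms(2)]]
      integrable_product_bounded[OF assms(1) test_function_measurable(2)[OF assms(2)]] by blast+
qed

lemma integrable_line_test_function:
  fixes \<psi> :: "real \<Rightarrow> real"
  assumes r: "locally_integrable r" and \<psi>: "test_function \<Omega> \<psi>"
  shows "integrable lborel (\<lambda>x. r x * \<psi> x)" "integrable lborel (\<lambda>x. r x * dir_deriv v \<psi> x)"
proof -
  obtain K where K: "compact K" "\<And>x. x \<notin> K \<Longrightarrow> \<psi> x = 0" "\<And>x v. x \<notin> K \<Longrightarrow> dir_deriv v \<psi> x = 0"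
    using test_functionE[OF \<psi>] by metis
  obtain a b where ab: "K \<subseteq> {a..b}" using compact_subset_Icc[OF K(1)] .
  have *: "integrable lborel (\<lambda>x. r x * h x)" if "continuous_on UNIV h" "\<And>x. x \<notin> K \<Longrightarrow> h x = 0" for h
  proof -
    have "set_integrable lborel {a..b} (\<lambda>x. r x * h x)"
      by (intro locally_integrableD locally_integrable_mult_continuous r that)
    moreover have "(\<lambda>x. indicat_real {a..b} x *\<^sub>R (r x * h x)) = (\<lambda>x. r x * h x)"
      using ab that(2) by (metis (no_types, opaque_lifting) indicator_simps(1) indicator_simps(2) mult_eq_0_iff
          real_scaleR_def mult_1 subsetD)
    ultimately show ?thesis by (simp add: set_integrable_def)
  qed
  show "integrable lborel (\<lambda>x. r x * \<psi> x)" "integrable lborel (\<lambda>x. r x * dir_deriv v \<psi> x)"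
    using K Ck_on_dir_deriv[OF test_function_smooth[OF \<psi>]] by (auto intro!: *)
qed

text \<open>For fixed \<open>\<xi>\<close> the integral of the time derivative over \<open>t\<close> vanishes; the factor \<open>A\<close> does not depend on \<open>t\<close>.\<close>

lemma integral_time_derivative:
  fixes \<phi> :: "real \<times> real \<Rightarrow> real"
  assumes "locally_integrable A" and \<phi>: "test_function \<Omega> \<phi>"
  shows "(LINT p|lborel. A (snd p) * dir_deriv (1, 0) \<phi> p) = 0"
proof -
  have i: "integrable (lborel \<Otimes>\<^sub>M lborel) (\<lambda>(t, \<xi>). A \<xi> * dir_deriv (1, 0) \<phi> (t, \<xi>))"
    unfolding lborel_prod by (rule integrable_times_test_function[OF assms])
  have "(LINT \<xi>|lborel. LINT t|lborel. A \<xi> * dir_deriv (1, 0) \<phi> (t, \<xi>)) =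
      integral\<^sup>L (lborel \<Otimes>\<^sub>M lborel) (\<lambda>(t, \<xi>). A \<xi> * dir_deriv (1, 0) \<phi> (t, \<xi>))"
    using i by (rule lborel_pair.integral_snd)
  moreover have "(LINT t|lborel. dir_deriv (1, 0) \<phi> (t, \<xi>)) = 0" for \<xi>
  proof -
    have "weak_deriv UNIV 1 (\<lambda>x::real. 1) (\<lambda>x. 0)"
      by (rule weak_deriv_piecewise[of "{}"]) (auto intro: locally_integrable_continuous)
    from this[unfolded weak_deriv_def, rule_format, OF test_function_slice(1)[OF \<phi>, of \<xi>]]
    show ?thesis
      by (simp add: set_lebesgue_integral_def test_function_slice(2)[OF \<phi>])
  qed
  ultimately show ?thesis by (simp add: lborel_prod case_prod_unfold)
qed

lemma integral_space_derivative:
  fixes \<phi> :: "real \<times> real \<Rightarrow> real"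
  assumes V: "locally_integrable V" and R: "locally_integrable R" and "weak_deriv UNIV 1 V R" and \<phi>: "test_function \<Omega> \<phi>"
  shows "(LINT p|lborel. V (snd p) * dir_deriv (0, 1) \<phi> p) = - (LINT p|lborel. R (snd p) * \<phi> p)"
proof -
  have "(LINT t|lborel. LINT \<xi>|lborel. V \<xi> * dir_deriv (0, 1) \<phi> (t, \<xi>)) =
      integral\<^sup>L (lborel \<Otimes>\<^sub>M lborel) (\<lambda>p. V (snd p) * dir_deriv (0, 1) \<phi> p)"
    using lborel_pair.integral_fst'[of "\<lambda>p. V (snd p) * dir_deriv (0, 1) \<phi> p"]
      integrable_times_test_function(2)[OF V \<phi>, of "(0, 1)"]
    by (simp add: lborel_prod case_prod_unfold)
  moreover have "(LINT t|lborel. LINT \<xi>|lborel. R \<xi> * \<phi> (t, \<xi>)) =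
      integral\<^sup>L (lborel \<Otimes>\<^sub>M lborel) (\<lambda>p. R (snd p) * \<phi> p)"
    using lborel_pair.integral_fst'[of "\<lambda>p. R (snd p) * \<phi> p"]
      integrable_times_test_function(1)[OF R \<phi>]
    by (simp add: lborel_prod case_prod_unfold)
  moreover have "(LINT \<xi>|lborel. V \<xi> * dir_deriv (0, 1) \<phi> (t, \<xi>)) = - (LINT \<xi>|lborel. R \<xi> * \<phi> (t, \<xi>))" for t
    using assms(3)[unfolded weak_deriv_def, rule_format, OF test_function_slice(3)[OF \<phi>, of t]]
    by (simp add: set_lebesgue_integral_def test_function_slice(4)[OF \<phi>])
  ultimately show ?thesis by (simp add: lborel_prod)
qed

text \<open>How functions of \<open>\<xi> = x - s t\<close> act on test functions of \<open>(t, x)\<close>. The last identity is the reason why a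
  travelling wave reduces to one dimension: of the time derivative only \<open>- s \<partial>\<^sub>\<xi>\<close> remains.\<close>

lemma moving_frame_integrals:
  fixes A :: "real \<Rightarrow> real" and s :: real
  assumes A: "locally_integrable A" and \<phi>: "test_function half_plane \<phi>"
  defines "\<Phi> \<equiv> (\<lambda>p. \<phi> (shear s p))"
  shows "set_integrable lborel half_plane (\<lambda>p. A (snd p - s * fst p) * \<phi> p)"
    "set_integrable lborel half_plane (\<lambda>p. A (snd p - s * fst p) * dir_deriv v \<phi> p)"
    "(LINT p:half_plane|lborel. A (snd p - s * fst p) * \<phi> p) = (LINT p|lborel. A (snd p) * \<Phi> p)"
    "(LINT p:half_plane|lborel. A (snd p - s * fst p) * dir_deriv (0, 1) \<phi> p)
      = (LINT p|lborel. A (snd p) * dir_deriv (0, 1) \<Phi> p)"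
    "(LINT p:half_plane|lborel. A (snd p - s * fst p) * dir_deriv (1, 0) \<phi> p)
      = - s * (LINT p|lborel. A (snd p) * dir_deriv (0, 1) \<Phi> p)"
proof -
  note [measurable] = test_function_measurable[OF \<phi>] measurable_moving_frame[OF locally_integrableD(1)[OF A]]
  have \<Phi>: "test_function half_plane \<Phi>" unfolding \<Phi>_def by (rule test_function_shear[OF \<phi>])
  have z: "\<phi> p = 0" "dir_deriv v \<phi> p = 0" if "p \<notin> half_plane" for p v
    using test_functionE[OF \<phi>] that by (metis subsetD)+
  note mf = dir_deriv_moving_frame[OF test_function_smooth[OF \<phi>], of s, folded \<Phi>_def]
  have sn: "snd (shear s p) - s * fst (shear s p) = snd p" for p by (simp add: shear_def)
  have f: "(LINT p:half_plane|lborel. A (snd p - s * fst p) * f p) = (LINT p|lborel. A (snd p) * f (shear s p))"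
    "set_integrable lborel half_plane (\<lambda>p. A (snd p - s * fst p) * f p) \<longleftrightarrow> integrable lborel (\<lambda>p. A (snd p) * f (shear s p))"
    if "f \<in> borel_measurable borel" "\<And>p. p \<notin> half_plane \<Longrightarrow> f p = 0" for f
    using half_plane_integral_shear[of "\<lambda>p. A (snd p - s * fst p) * f p" s] that by (simp_all add: sn)
  note i = integrable_times_test_function[OF A \<Phi>, unfolded case_prod_unfold, simplified]
  show "set_integrable lborel half_plane (\<lambda>p. A (snd p - s * fst p) * \<phi> p)"
    "(LINT p:half_plane|lborel. A (snd p - s * fst p) * \<phi> p) = (LINT p|lborel. A (snd p) * \<Phi> p)"
    using f[of \<phi>] z i(1) by (simp_all add: \<Phi>_def)
  show "set_integrable lborel half_plane (\<lambda>p. A (snd p - s * fst p) * dir_deriv v \<phi> p)"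
  proof -
    have "dir_deriv v \<phi> (shear s p) = dir_deriv (shear (- s) v) \<Phi> p" for p
      unfolding \<Phi>_def dir_deriv_shear[OF test_function_smooth[OF \<phi>]] by (simp add: shear_shear)
    then show ?thesis using f(2)[of "dir_deriv v \<phi>"] z i(2) by simp
  qed
  show "(LINT p:half_plane|lborel. A (snd p - s * fst p) * dir_deriv (0, 1) \<phi> p)
      = (LINT p|lborel. A (snd p) * dir_deriv (0, 1) \<Phi> p)"
    using f(1)[of "dir_deriv (0, 1) \<phi>"] z by (simp add: mf)
  have "(LINT p:half_plane|lborel. A (snd p - s * fst p) * dir_deriv (1, 0) \<phi> p)
      = (LINT p|lborel. A (snd p) * dir_deriv (1, 0) \<Phi> p - s * (A (snd p) * dir_deriv (0, 1) \<Phi> p))"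
    using f(1)[of "dir_deriv (1, 0) \<phi>"] z by (simp add: mf algebra_simps)
  also have "\<dots> = - s * (LINT p|lborel. A (snd p) * dir_deriv (0, 1) \<Phi> p)"
    by (simp add: i integral_time_derivative[OF A \<Phi>])
  finally show "(LINT p:half_plane|lborel. A (snd p - s * fst p) * dir_deriv (1, 0) \<phi> p)
      = - s * (LINT p|lborel. A (snd p) * dir_deriv (0, 1) \<Phi> p)" .
qed

lemma weak_deriv_travelling:
  assumes w: "locally_integrable w" and g: "locally_integrable g" and wg: "weak_deriv UNIV 1 w g"
  shows "weak_deriv half_plane (0, 1) (\<lambda>(t, x). w (x - s * t)) (\<lambda>(t, x). g (x - s * t))"
    "weak_deriv half_plane (1, 0) (\<lambda>(t, x). w (x - s * t)) (\<lambda>(t, x). - s * g (x - s * t))"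
  unfolding weak_deriv_def case_prod_unfold
proof (safe)
  fix \<phi> assume \<phi>: "test_function half_plane \<phi>"
  note W = moving_frame_integrals[OF w \<phi>, where s = s] and G = moving_frame_integrals[OF g \<phi>, where s = s]
  note S = integral_space_derivative[OF w g wg test_function_shear[OF \<phi>, of s]]
  show "set_integrable lborel half_plane (\<lambda>p. w (snd p - s * fst p) * dir_deriv (0, 1) \<phi> p)"
    "set_integrable lborel half_plane (\<lambda>p. w (snd p - s * fst p) * dir_deriv (1, 0) \<phi> p)" by (rule W(2))+
  show "set_integrable lborel half_plane (\<lambda>p. g (snd p - s * fst p) * \<phi> p)" by (rule G(1))
  then show "set_integrable lborel half_plane (\<lambda>p. - s * g (snd p - s * fst p) * \<phi> p)"
    unfolding mult.assoc by (intro set_integrable_mult_right)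
  show "(LINT p:half_plane|lborel. w (snd p - s * fst p) * dir_deriv (0, 1) \<phi> p)
      = - (LINT p:half_plane|lborel. g (snd p - s * fst p) * \<phi> p)" using W(4) G(3) S by simp
  show "(LINT p:half_plane|lborel. w (snd p - s * fst p) * dir_deriv (1, 0) \<phi> p)
      = - (LINT p:half_plane|lborel. - s * g (snd p - s * fst p) * \<phi> p)"
    unfolding mult.assoc set_integral_mult_right using W(5) G(3) S by simp
qed

lemma flux_locally_integrable:
  fixes w g c :: "real \<Rightarrow> real" and s :: real
  assumes c: "continuous_on UNIV c" "continuous_on UNIV (deriv c)" and w: "continuous_on UNIV w" and g: "L2_loc g"
  shows "locally_integrable (\<lambda>\<xi>. ((c (w \<xi>))\<^sup>2 - s\<^sup>2) * g \<xi>)"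
    "locally_integrable (\<lambda>\<xi>. c (w \<xi>) * deriv c (w \<xi>) * (g \<xi>)\<^sup>2)"
proof -
  have cw: "continuous_on UNIV (\<lambda>\<xi>. c (w \<xi>))" "continuous_on UNIV (\<lambda>\<xi>. deriv c (w \<xi>))"
    using continuous_on_compose2[OF c(1) w] continuous_on_compose2[OF c(2) w] by auto
  note gi = L2_loc_imp_locally_integrable[OF g]
  have "locally_integrable (\<lambda>\<xi>. g \<xi> * ((c (w \<xi>))\<^sup>2 - s\<^sup>2))"
    by (intro locally_integrable_mult_continuous gi continuous_intros cw)
  then show "locally_integrable (\<lambda>\<xi>. ((c (w \<xi>))\<^sup>2 - s\<^sup>2) * g \<xi>)" by (simp add: mult.commute)
  have "locally_integrable (\<lambda>\<xi>. (g \<xi>)\<^sup>2 * (c (w \<xi>) * deriv c (w \<xi>)))"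
    by (intro locally_integrable_mult_continuous gi continuous_intros cw)
  then show "locally_integrable (\<lambda>\<xi>. c (w \<xi>) * deriv c (w \<xi>) * (g \<xi>)\<^sup>2)" by (simp add: mult.commute)
qed

text \<open>The three terms of the weak form combine by \<open>moving_frame_integrals\<close>: the term \<open>- u\<^sub>t \<phi>\<^sub>t\<close> contributes
  \<open>- s\<^sup>2 g \<partial>\<^sub>\<xi>\<close>, which together with \<open>c\<^sup>2 u\<^sub>x \<phi>\<^sub>x\<close> gives the flux \<open>H\<close>.\<close>

lemma weak_form_travelling:
  fixes w g c :: "real \<Rightarrow> real" and s :: real
  assumes c: "continuous_on UNIV c" "continuous_on UNIV (deriv c)" and w: "continuous_on UNIV w" and g: "L2_loc g"
    and \<phi>: "test_function half_plane \<phi>"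
  defines "F \<equiv> (\<lambda>(t, x). - (- s * g (x - s * t)) * dir_deriv (1, 0) \<phi> (t, x)
        + c (w (x - s * t)) * deriv c (w (x - s * t)) * (g (x - s * t))\<^sup>2 * \<phi> (t, x)
        + (c (w (x - s * t)))\<^sup>2 * g (x - s * t) * dir_deriv (0, 1) \<phi> (t, x))"
    and "H \<equiv> (\<lambda>\<xi>. ((c (w \<xi>))\<^sup>2 - s\<^sup>2) * g \<xi>)" and "R \<equiv> (\<lambda>\<xi>. c (w \<xi>) * deriv c (w \<xi>) * (g \<xi>)\<^sup>2)"
    and "\<Phi> \<equiv> (\<lambda>p. \<phi> (shear s p))"
  shows "set_integrable lborel half_plane F"
    "(LINT p:half_plane|lborel. F p) = (LINT p|lborel. H (snd p) * dir_deriv (0, 1) \<Phi> p) + (LINT p|lborel. R (snd p) * \<Phi> p)"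
proof -
  have "continuous_on UNIV (\<lambda>\<xi>. (c (w \<xi>))\<^sup>2)"
    using continuous_on_compose2[OF c(1) w] by (intro continuous_intros) auto
  note gi = L2_loc_imp_locally_integrable(1)[OF g]
  define Q where "Q \<xi> = g \<xi> * (c (w \<xi>))\<^sup>2" for \<xi>
  have Q: "locally_integrable Q" unfolding Q_def by (rule locally_integrable_mult_continuous) fact+
  have R: "locally_integrable R" unfolding R_def by (rule flux_locally_integrable(2)[OF c w g])
  note I = moving_frame_integrals[OF gi \<phi>, where s = s] moving_frame_integrals[OF Q \<phi>, where s = s]
    moving_frame_integrals[OF R \<phi>, where s = s]
  have F: "F p = s * (g (snd p - s * fst p) * dir_deriv (1, 0) \<phi> p)
      + (R (snd p - s * fst p) * \<phi> p + Q (snd p - s * fst p) * dir_deriv (0, 1) \<phi> p)" for p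
    by (simp add: F_def R_def Q_def case_prod_unfold)
  show "set_integrable lborel half_plane F" unfolding F by (intro set_integral_add set_integrable_mult_right I)
  have "(LINT p:half_plane|lborel. F p) = s * (LINT p:half_plane|lborel. g (snd p - s * fst p) * dir_deriv (1, 0) \<phi> p)
      + ((LINT p:half_plane|lborel. R (snd p - s * fst p) * \<phi> p)
        + (LINT p:half_plane|lborel. Q (snd p - s * fst p) * dir_deriv (0, 1) \<phi> p))"
    unfolding F by (simp add: set_integral_add I)
  also have "\<dots> = (LINT p|lborel. R (snd p) * \<Phi> p)
      + ((LINT p|lborel. Q (snd p) * dir_deriv (0, 1) \<Phi> p) - s\<^sup>2 * (LINT p|lborel. g (snd p) * dir_deriv (0, 1) \<Phi> p))"
    by (simp add: I \<Phi>_def power2_eq_square)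
  also have "(LINT p|lborel. Q (snd p) * dir_deriv (0, 1) \<Phi> p) - s\<^sup>2 * (LINT p|lborel. g (snd p) * dir_deriv (0, 1) \<Phi> p)
      = (LINT p|lborel. Q (snd p) * dir_deriv (0, 1) \<Phi> p - s\<^sup>2 * (g (snd p) * dir_deriv (0, 1) \<Phi> p))"
    using integrable_times_test_function(2)[OF gi test_function_shear[OF \<phi>, of s]]
      integrable_times_test_function(2)[OF Q test_function_shear[OF \<phi>, of s]]
    by (simp add: \<Phi>_def case_prod_unfold)
  also have "\<dots> = (LINT p|lborel. H (snd p) * dir_deriv (0, 1) \<Phi> p)"
    by (simp add: H_def Q_def algebra_simps)
  finally show "(LINT p:half_plane|lborel. F p) = (LINT p|lborel. H (snd p) * dir_deriv (0, 1) \<Phi> p) + (LINT p|lborel. R (snd p) * \<Phi> p)"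
    by simp
qed

text \<open>Forwards, the test functions \<open>\<rho>(t) \<psi>(x - s t)\<close> are used, with a fixed bump \<open>\<rho>\<close> in time whose integral is
  not zero.\<close>

lemma weak_form_travelling_iff:
  fixes w g :: "real \<Rightarrow> real"
  assumes c: "continuous_on UNIV c" "continuous_on UNIV (deriv c)" and w: "continuous_on UNIV w" and g: "L2_loc g"
  shows "weak_form c (\<lambda>t x. w (x - s * t)) (\<lambda>t x. - s * g (x - s * t)) (\<lambda>t x. g (x - s * t)) \<longleftrightarrow>
    weak_deriv UNIV 1 (\<lambda>\<xi>. ((c (w \<xi>))\<^sup>2 - s\<^sup>2) * g \<xi>) (\<lambda>\<xi>. c (w \<xi>) * deriv c (w \<xi>) * (g \<xi>)\<^sup>2)"
    (is "?W \<longleftrightarrow> weak_deriv UNIV 1 ?H ?R")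
proof
  note I = flux_locally_integrable(1)[OF c w g, of s] flux_locally_integrable(2)[OF c w g]
  assume wd: "weak_deriv UNIV 1 ?H ?R"
  show ?W unfolding weak_form_def Let_def
  proof (intro allI impI)
    fix \<phi> assume \<phi>: "test_function half_plane \<phi>"
    note W = weak_form_travelling[OF c w g \<phi>, of s]
    note S = integral_space_derivative[OF I wd test_function_shear[OF \<phi>, of s]]
    show "set_integrable lborel half_plane (\<lambda>(t, x). - (- s * g (x - s * t)) * dir_deriv (1, 0) \<phi> (t, x)
        + c (w (x - s * t)) * deriv c (w (x - s * t)) * (g (x - s * t))\<^sup>2 * \<phi> (t, x)
        + (c (w (x - s * t)))\<^sup>2 * g (x - s * t) * dir_deriv (0, 1) \<phi> (t, x)) \<and>
      (LINT p:half_plane|lborel. (\<lambda>(t, x). - (- s * g (x - s * t)) * dir_deriv (1, 0) \<phi> (t, x)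
        + c (w (x - s * t)) * deriv c (w (x - s * t)) * (g (x - s * t))\<^sup>2 * \<phi> (t, x)
        + (c (w (x - s * t)))\<^sup>2 * g (x - s * t) * dir_deriv (0, 1) \<phi> (t, x)) p) = 0"
      using W S by simp
  qed
next
  note I = flux_locally_integrable(1)[OF c w g, of s] flux_locally_integrable(2)[OF c w g]
  assume wf: ?W
  define \<rho> where "\<rho> = bump 1 1 2"
  have "test_function {1..2} \<rho>" unfolding \<rho>_def by (rule test_function_bump) auto
  then have \<rho>s: "\<forall>n. Ck_on n UNIV \<rho>" and \<rho>0: "\<And>t. t \<notin> {1..2} \<Longrightarrow> \<rho> t = 0"
    by (auto simp: test_function_def \<rho>_def intro!: bump_eq_0)
  have [measurable]: "\<rho> \<in> borel_measurable borel"
    using Ck_on_dir_deriv(3)[OF \<rho>s] by (rule borel_measurable_continuous_onI)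
  have "set_integrable lborel {1..2} \<rho>"
    using Ck_on_dir_deriv(3)[OF \<rho>s] by (intro borel_integrable_atLeastAtMost') (auto intro: continuous_on_subset)
  moreover have "(\<lambda>t. indicat_real {1..2} t *\<^sub>R \<rho> t) = \<rho>" using \<rho>0 by (auto simp: indicator_def fun_eq_iff)
  ultimately have \<rho>i: "integrable lborel \<rho>" by (simp add: set_integrable_def)
  have \<rho>pos: "(LINT t|lborel. \<rho> t) \<noteq> 0"
  proof
    assume "(LINT t|lborel. \<rho> t) = 0"
    then have "AE t in lborel. \<rho> t = 0"
      using integral_nonneg_eq_0_iff_AE[OF \<rho>i] by (auto simp: \<rho>_def bump_nonneg)
    then have "AE t in lborel. t \<notin> {1<..<2::real}"
      by eventually_elim (use bump_pos[of 1 1 _ 2] in \<open>force simp: \<rho>_def\<close>)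
    then have "emeasure lborel {1<..<2::real} = 0"
      by (subst (asm) AE_iff_measurable[of "{1<..<2}"]) auto
    then show False by simp
  qed
  show "weak_deriv UNIV 1 ?H ?R" unfolding weak_deriv_def
  proof (intro allI impI)
    fix \<psi> :: "real \<Rightarrow> real" assume \<psi>: "test_function UNIV \<psi>"
    obtain K where K: "compact K" "\<And>x. x \<notin> K \<Longrightarrow> \<psi> x = 0" using test_functionE[OF \<psi>] by metis
    define \<Phi> where "\<Phi> = (\<lambda>p. \<rho> (fst p) * \<psi> (snd p))"
    have \<Phi>p: "\<Phi> p = \<rho> (fst p) * \<psi> (snd p)" for p by (simp add: \<Phi>_def)
    have \<Phi>: "test_function half_plane \<Phi>"
    proof -
      have "Ck_on n UNIV \<Phi>" for n
        using Ck_on_mult[OF Ck_on_affine[OF \<rho>s[rule_format] bounded_linear_fst, of n 0]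
            Ck_on_affine[OF test_function_smooth[OF \<psi>, rule_format] bounded_linear_snd, of n 0]]
        by (simp add: \<Phi>_def)
      moreover have "compact ({1..2::real} \<times> K)" "{1..2::real} \<times> K \<subseteq> half_plane" using K by (auto intro: compact_Times)
      moreover have "\<Phi> p = 0" if "p \<notin> {1..2} \<times> K" for p
        using that \<rho>0 K(2) by (cases p) (auto simp: \<Phi>_def)
      ultimately show ?thesis unfolding test_function_def by blast
    qed
    define \<phi> where "\<phi> = (\<lambda>p. \<Phi> (shear (- s) p))"
    have \<phi>: "test_function half_plane \<phi>" unfolding \<phi>_def by (rule test_function_shear[OF \<Phi>])
    have \<Phi>_eq: "(\<lambda>p. \<phi> (shear s p)) = \<Phi>" by (simp add: \<phi>_def shear_shear)
    note W = weak_form_travelling[OF c w g \<phi>, of s, unfolded \<Phi>_eq]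
    have dd: "dir_deriv (0, 1) \<Phi> p = \<rho> (fst p) * dir_deriv 1 \<psi> (snd p)" for p
    proof -
      have "((\<lambda>x. \<rho> (fst p) * \<psi> x) has_real_derivative \<rho> (fst p) * dir_deriv 1 \<psi> (snd p)) (at (snd p))"
        by (intro DERIV_cmult test_function_DERIV[OF \<psi>])
      moreover have "((\<lambda>x. \<rho> (fst p) * \<psi> x) has_real_derivative dir_deriv (0, 1) \<Phi> p) (at (snd p))"
        using test_function_DERIV[OF test_function_slice(3)[OF \<Phi>, of "fst p"], of "snd p"]
          test_function_slice(4)[OF \<Phi>, of "fst p" "snd p"] by (simp add: \<Phi>_def)
      ultimately show ?thesis by (rule DERIV_unique[symmetric])
    qed
    have prod: "(LINT p|lborel. A (snd p) * (\<rho> (fst p) * h (snd p))) = (LINT t|lborel. \<rho> t) * (LINT x|lborel. A x * h x)"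
      if "integrable lborel (\<lambda>p. A (snd p) * (\<rho> (fst p) * h (snd p)))" for A h :: "real \<Rightarrow> real"
    proof -
      have "(LINT p|lborel. A (snd p) * (\<rho> (fst p) * h (snd p))) = (LINT t|lborel. LINT x|lborel. \<rho> t * (A x * h x))"
        using lborel_pair.integral_fst'[of "\<lambda>p. A (snd p) * (\<rho> (fst p) * h (snd p))"] that
        by (simp add: lborel_prod mult.left_commute)
      then show ?thesis by simp
    qed
    have i: "integrable lborel (\<lambda>p. ?H (snd p) * (\<rho> (fst p) * dir_deriv 1 \<psi> (snd p)))"
      "integrable lborel (\<lambda>p. ?R (snd p) * (\<rho> (fst p) * \<psi> (snd p)))"
      using integrable_times_test_function(2)[OF I(1) \<Phi>, of "(0, 1)"]
        integrable_times_test_function(1)[OF I(2) \<Phi>] by (simp_all add: case_prod_unfold dd \<Phi>p)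
    have "(LINT t|lborel. \<rho> t) * (LINT x|lborel. ?H x * dir_deriv 1 \<psi> x) + (LINT t|lborel. \<rho> t) * (LINT x|lborel. ?R x * \<psi> x) = 0"
      using wf[unfolded weak_form_def Let_def, rule_format, OF \<phi>, THEN conjunct2] W(2) prod[OF i(1)] prod[OF i(2)]
      by (simp add: dd \<Phi>p fun_cong[OF \<Phi>_eq])
    then have "(LINT x|lborel. ?H x * dir_deriv 1 \<psi> x) = - (LINT x|lborel. ?R x * \<psi> x)"
      using \<rho>pos by (simp flip: distrib_left add: add_eq_0_iff)
    moreover have "integrable lborel (\<lambda>x. ?H x * dir_deriv 1 \<psi> x)" "integrable lborel (\<lambda>x. ?R x * \<psi> x)"
      using integrable_line_test_function[OF I(1) \<psi>] integrable_line_test_function[OF I(2) \<psi>] by auto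
    ultimately show "set_integrable lborel UNIV (\<lambda>x. ?H x * dir_deriv 1 \<psi> x) \<and> set_integrable lborel UNIV (\<lambda>x. ?R x * \<psi> x) \<and>
       (LINT x:UNIV|lborel. ?H x * dir_deriv 1 \<psi> x) = - (LINT x:UNIV|lborel. ?R x * \<psi> x)"
      by (simp add: set_integrable_def set_lebesgue_integral_def)
  qed
qed

section \<open>Classical waves and their first integral\<close>

locale wave_speed =
  fixes c :: "real \<Rightarrow> real" and s :: real
  assumes c_C2: "Ck_on 2 UNIV c" and c_pos: "\<And>v. 0 < c v"
begin

lemma DERIV_c: "(c has_real_derivative deriv c v) (at v)"
  and DERIV_deriv_c: "(deriv c has_real_derivative deriv (deriv c) v) (at v)"
proof -
  obtain f1 f2 where f: "\<And>x. (c has_real_derivative f1 x) (at x)" "\<And>x. (f1 has_real_derivative f2 x) (at x)"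
    using c_C2 by (auto simp: Ck_on_2_real_iff)
  have "deriv c = f1" using f(1) by (auto intro: DERIV_imp_deriv)
  moreover from this have "deriv (deriv c) = f2" using f(2) by (auto intro: DERIV_imp_deriv)
  ultimately show "(c has_real_derivative deriv c v) (at v)" "(deriv c has_real_derivative deriv (deriv c) v) (at v)"
    using f by auto
qed

lemma continuous_c: "continuous_on UNIV c" and continuous_deriv_c: "continuous_on UNIV (deriv c)"
  by (auto intro!: continuous_at_imp_continuous_on DERIV_isCont[OF DERIV_c] DERIV_isCont[OF DERIV_deriv_c])

definition gap :: "real \<Rightarrow> real" where "gap v = s\<^sup>2 - (c v)\<^sup>2"

text \<open>Positivity of \<open>c\<close> rules out \<open>c v = - \<bar>s\<bar>\<close>.\<close>

lemma gap_eq_0_iff: "gap v = 0 \<longleftrightarrow> \<bar>s\<bar> = c v"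
  using c_pos[of v] by (simp add: gap_def) (metis abs_of_pos power2_abs power2_eq_iff_nonneg abs_ge_zero less_imp_le)

lemma DERIV_gap: "(gap has_real_derivative - 2 * c v * deriv c v) (at v)"
  unfolding gap_def [abs_def] by (auto intro!: derivative_eq_intros DERIV_c)

lemma continuous_gap: "continuous_on UNIV gap"
  by (auto intro!: continuous_at_imp_continuous_on DERIV_isCont[OF DERIV_gap])

lemma DERIV_sqrt_gap:
  assumes "gap v \<noteq> 0"
  shows "((\<lambda>v. sqrt \<bar>gap v\<bar>) has_real_derivative - (sgn (gap v) * c v * deriv c v / sqrt \<bar>gap v\<bar>)) (at v)"
proof -
  have "((\<lambda>y. sqrt \<bar>y\<bar>) has_real_derivative sgn y / (2 * sqrt \<bar>y\<bar>)) (at y)" if "y \<noteq> 0" for y :: real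
  proof -
    have "(abs has_real_derivative sgn y) (at y)"
    proof (cases "y > 0")
      case True
      have "((\<lambda>y. y) has_real_derivative sgn y) (at y)" using True by simp
      then show ?thesis
        by (rule has_field_derivative_transform_within_open[where S = "{0<..}"]) (use True in auto)
    next
      case False
      then have "((\<lambda>y. - y) has_real_derivative sgn y) (at y)"
        using that by (auto intro!: derivative_eq_intros)
      then show ?thesis
        by (rule has_field_derivative_transform_within_open[where S = "{..<0}"]) (use False that in auto)
    qed
    note A = this
    have B: "(sqrt has_real_derivative inverse (sqrt \<bar>y\<bar>) / 2) (at \<bar>y\<bar>)"
      by (rule DERIV_real_sqrt) (use that in simp)
    have "inverse (sqrt \<bar>y\<bar>) / 2 * sgn y = sgn y / (2 * sqrt \<bar>y\<bar>)" by (simp add: field_simps)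
    with DERIV_chain2[where f = sqrt and g = abs and x = y and s = UNIV, OF B A] show ?thesis by metis
  qed
  from DERIV_chain2[OF this[OF assms] DERIV_gap] show ?thesis by (simp add: mult.assoc)
qed

lemma local_waveD:
  assumes "local_classical_wave c s w J" "\<xi> \<in> J"
  shows "(w has_real_derivative deriv w \<xi>) (at \<xi>)"
    "(deriv w has_real_derivative deriv (deriv w) \<xi>) (at \<xi>)"
    "gap (w \<xi>) * deriv (deriv w) \<xi> = c (w \<xi>) * deriv c (w \<xi>) * (deriv w \<xi>)\<^sup>2"
proof -
  have J: "open J" and ode: "(s\<^sup>2 - (c (w \<xi>))\<^sup>2) * deriv (deriv w) \<xi> - c (w \<xi>) * deriv c (w \<xi>) * (deriv w \<xi>)\<^sup>2 = 0"
    using assms by (auto simp: local_classical_wave_def)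
  obtain f1 f2 where f: "\<And>x. x \<in> J \<Longrightarrow> (w has_real_derivative f1 x) (at x)" "\<And>x. x \<in> J \<Longrightarrow> (f1 has_real_derivative f2 x) (at x)"
    using assms(1) by (auto simp: local_classical_wave_def Ck_on_2_real_iff)
  have 1: "deriv w x = f1 x" if "x \<in> J" for x using f(1)[OF that] by (rule DERIV_imp_deriv)
  have "(deriv w has_real_derivative f2 \<xi>) (at \<xi>)"
    by (rule has_field_derivative_transform_within_open[OF f(2)[OF assms(2)] J assms(2)]) (simp add: 1)
  with f(1)[OF assms(2)] show "(w has_real_derivative deriv w \<xi>) (at \<xi>)"
    "(deriv w has_real_derivative deriv (deriv w) \<xi>) (at \<xi>)"
    by (simp_all add: DERIV_imp_deriv 1 assms(2))
  show "gap (w \<xi>) * deriv (deriv w) \<xi> = c (w \<xi>) * deriv c (w \<xi>) * (deriv w \<xi>)\<^sup>2"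
    using ode by (simp add: gap_def)
qed

text \<open>The flux equation behind the weak form, for a classical wave.\<close>

lemma DERIV_flux:
  assumes "local_classical_wave c s w J" "\<eta> \<in> J"
  shows "((\<lambda>\<eta>. - gap (w \<eta>) * deriv w \<eta>) has_real_derivative
    c (w \<eta>) * deriv c (w \<eta>) * (deriv w \<eta>)\<^sup>2) (at \<eta>)"
proof -
  note W = local_waveD[OF assms]
  have "((\<lambda>\<eta>. - gap (w \<eta>) * deriv w \<eta>) has_real_derivative
     2 * c (w \<eta>) * deriv c (w \<eta>) * (deriv w \<eta>)\<^sup>2 - gap (w \<eta>) * deriv (deriv w) \<eta>) (at \<eta>)"
    by (rule derivative_eq_intros DERIV_chain2[OF DERIV_gap] W refl | simp add: algebra_simps power2_eq_square)+
  then show ?thesis using W(3) by (simp add: mult.assoc)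
qed

lemma local_waveI:
  assumes "open J" "is_interval J" "\<And>\<xi>. \<xi> \<in> J \<Longrightarrow> (w has_real_derivative w1 \<xi>) (at \<xi>)"
    "\<And>\<xi>. \<xi> \<in> J \<Longrightarrow> (w1 has_real_derivative w2 \<xi>) (at \<xi>)" "continuous_on J w2"
    "\<And>\<xi>. \<xi> \<in> J \<Longrightarrow> gap (w \<xi>) * w2 \<xi> = c (w \<xi>) * deriv c (w \<xi>) * (w1 \<xi>)\<^sup>2"
  shows "local_classical_wave c s w J"
proof -
  have 1: "deriv w x = w1 x" if "x \<in> J" for x using assms(3)[OF that] by (rule DERIV_imp_deriv)
  have 2: "deriv (deriv w) x = w2 x" if "x \<in> J" for x
    by (rule DERIV_imp_deriv, rule has_field_derivative_transform_within_open[OF assms(4)[OF that] assms(1) that])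
      (simp add: 1)
  have "Ck_on 2 J w" using assms by (auto simp: Ck_on_2_real_iff)
  then show ?thesis using assms(1,2,6) by (auto simp: local_classical_wave_def 1 2 gap_def)
qed

lemma local_wave_subset:
  "local_classical_wave c s w J \<Longrightarrow> open I \<Longrightarrow> is_interval I \<Longrightarrow> I \<subseteq> J \<Longrightarrow> local_classical_wave c s w I"
  by (auto simp: local_classical_wave_def intro: Ck_on_subset)

lemma local_wave_continuous_deriv: "local_classical_wave c s w J \<Longrightarrow> continuous_on J (deriv w)"
  by (auto intro!: continuous_at_imp_continuous_on dest!: local_waveD(2) intro: DERIV_isCont)

text \<open>The derivative of \<open>w\<^sub>\<xi> sqrt \<bar>gap(w)\<bar>\<close> is the differential equation divided by \<open>sqrt \<bar>gap(w)\<bar>\<close>, up to sign. Unlike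
  \<open>w\<^sub>\<xi>\<^sup>2 gap(w)\<close> this first integral keeps the sign of the slope.\<close>

lemma normal_form:
  assumes "is_interval J" and loc: "\<And>\<xi>. \<xi> \<in> J \<Longrightarrow> \<exists>I. \<xi> \<in> I \<and> local_classical_wave c s w I"
    and gap: "\<And>\<xi>. \<xi> \<in> J \<Longrightarrow> gap (w \<xi>) \<noteq> 0"
  shows "\<exists>k. \<forall>\<xi>\<in>J. deriv w \<xi> = k / sqrt \<bar>gap (w \<xi>)\<bar>"
proof -
  have "((\<lambda>\<xi>. deriv w \<xi> * sqrt \<bar>gap (w \<xi>)\<bar>) has_real_derivative 0) (at \<xi>)" if \<xi>: "\<xi> \<in> J" for \<xi>
  proof -
    obtain I where I: "\<xi> \<in> I" "local_classical_wave c s w I" using loc[OF \<xi>] by blast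
    note D = local_waveD[OF I(2,1)]
    let ?y = "gap (w \<xi>)"
    have y: "?y \<noteq> 0" using gap \<xi> by blast
    have sq: "sqrt \<bar>?y\<bar> * sqrt \<bar>?y\<bar> = sgn ?y * ?y" by (simp add: sgn_if)
    have "deriv (deriv w) \<xi> * sqrt \<bar>?y\<bar> + - (sgn ?y * c (w \<xi>) * deriv c (w \<xi>) / sqrt \<bar>?y\<bar>) * deriv w \<xi> * deriv w \<xi>
      = sgn ?y * (?y * deriv (deriv w) \<xi> - c (w \<xi>) * deriv c (w \<xi>) * (deriv w \<xi>)\<^sup>2) / sqrt \<bar>?y\<bar>"
    proof -
      have "d2 * r + - (\<sigma> * a * b / r) * d1 * d1 = \<sigma> * (z * d2 - a * b * d1\<^sup>2) / r"
        if "r \<noteq> 0" "r * r = \<sigma> * z" for d2 r \<sigma> a b d1 z :: real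
      proof -
        have "(d2 * r + - (\<sigma> * a * b / r) * d1 * d1) * r = d2 * (r * r) - \<sigma> * a * b * d1 * d1"
          using that(1) by (simp add: algebra_simps)
        also have "\<dots> = \<sigma> * (z * d2 - a * b * d1\<^sup>2)"
          unfolding that(2) by (simp add: algebra_simps power2_eq_square)
        finally show ?thesis using that(1) by (simp add: eq_divide_eq)
      qed
      from this[OF _ sq] y show ?thesis by simp
    qed
    also have "\<dots> = 0" using D(3) by simp
    finally show ?thesis
      using DERIV_mult[OF D(2) DERIV_chain2[OF DERIV_sqrt_gap[OF y] D(1)]] by (simp add: mult.commute mult.left_commute)
  qed
  then have "\<And>\<xi>. \<xi> \<in> J \<Longrightarrow> ((\<lambda>\<xi>. deriv w \<xi> * sqrt \<bar>gap (w \<xi>)\<bar>) has_real_derivative 0) (at \<xi> within J)"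
    by (blast intro: has_field_derivative_at_within)
  from has_field_derivative_zero_constant[OF _ this] assms(1)
  obtain k where "\<And>\<xi>. \<xi> \<in> J \<Longrightarrow> deriv w \<xi> * sqrt \<bar>gap (w \<xi>)\<bar> = k"
    by (auto simp: is_interval_convex_1)
  then show ?thesis using gap by (intro exI[of _ k]) (auto simp: field_simps)
qed

lemma normal_form_imp_local_wave:
  assumes "open J" "is_interval J" and gap: "\<And>\<xi>. \<xi> \<in> J \<Longrightarrow> gap (w \<xi>) \<noteq> 0"
    and D: "\<And>\<xi>. \<xi> \<in> J \<Longrightarrow> (w has_real_derivative k / sqrt \<bar>gap (w \<xi>)\<bar>) (at \<xi>)"
  shows "local_classical_wave c s w J"
proof (rule local_waveI[OF assms(1,2)])
  let ?w1 = "\<lambda>\<xi>. k / sqrt \<bar>gap (w \<xi>)\<bar>"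
  let ?w2 = "\<lambda>\<xi>. c (w \<xi>) * deriv c (w \<xi>) * (?w1 \<xi>)\<^sup>2 / gap (w \<xi>)"
  show "(w has_real_derivative ?w1 \<xi>) (at \<xi>)" if "\<xi> \<in> J" for \<xi> using D that .
  show "(?w1 has_real_derivative ?w2 \<xi>) (at \<xi>)" if \<xi>: "\<xi> \<in> J" for \<xi>
  proof -
    let ?y = "gap (w \<xi>)"
    have y: "?y \<noteq> 0" using gap \<xi> by blast
    then have sy: "sqrt \<bar>?y\<bar> \<noteq> 0" by simp
    have sq: "sqrt \<bar>?y\<bar> * sqrt \<bar>?y\<bar> = sgn ?y * ?y" by (simp add: sgn_if)
    have sg: "sgn ?y * sgn ?y = 1" using y by (simp add: sgn_if)
    have eq: "k * - (- (\<sigma> * a * b / r) * (k / r) * inverse (r ^ Suc (Suc 0))) = a * b * (k / r)\<^sup>2 / y"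
      if "r \<noteq> 0" "y \<noteq> 0" "r * r = \<sigma> * y" "\<sigma> * \<sigma> = 1" for r \<sigma> a b y :: real
    proof -
      have "k * - (- (\<sigma> * a * b / r) * (k / r) * inverse (r ^ Suc (Suc 0))) = (a * b * (k / r)\<^sup>2) * (\<sigma> / (r * r))"
        by (simp add: divide_inverse power2_eq_square mult_ac)
      also have "\<sigma> / (r * r) = 1 / y" unfolding that(3) using that(2,4) by (auto simp: field_simps)
      finally show ?thesis by simp
    qed
    have "((\<lambda>\<xi>. k * inverse (sqrt \<bar>gap (w \<xi>)\<bar>)) has_real_derivative ?w2 \<xi>) (at \<xi>)"
      by (rule DERIV_cong[OF DERIV_cmult[OF DERIV_inverse_fun[OF DERIV_chain2[OF DERIV_sqrt_gap[OF y] D[OF \<xi>]] sy]]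
          eq[OF sy y sq sg]])
    moreover have "(\<lambda>\<xi>. k * inverse (sqrt \<bar>gap (w \<xi>)\<bar>)) = ?w1" by (simp add: divide_inverse)
    ultimately show ?thesis by simp
  qed
  have cw: "continuous_on J w" by (intro continuous_at_imp_continuous_on ballI) (rule DERIV_isCont[OF D])
  have "continuous_on J (\<lambda>\<xi>. c (w \<xi>))" "continuous_on J (\<lambda>\<xi>. deriv c (w \<xi>))" "continuous_on J (\<lambda>\<xi>. gap (w \<xi>))"
    by (auto intro: continuous_on_compose2[OF continuous_c cw] continuous_on_compose2[OF continuous_deriv_c cw]
      continuous_on_compose2[OF continuous_gap cw])
  then show "continuous_on J ?w2" by (intro continuous_intros) (auto simp: gap)
  show "gap (w \<xi>) * ?w2 \<xi> = c (w \<xi>) * deriv c (w \<xi>) * (?w1 \<xi>)\<^sup>2" if "\<xi> \<in> J" for \<xi> using gap that by simp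
qed

text \<open>The two cases are \<open>k = 0\<close> and \<open>k \<noteq> 0\<close> for the constant \<open>k = w\<^sub>\<xi>\<^sup>2 gap(w)\<close>. This first integral is available also
  where \<open>w\<close> takes sonic values.\<close>

lemma local_wave_dichotomy:
  assumes "local_classical_wave c s w J"
  shows "(\<forall>\<xi>\<in>J. gap (w \<xi>) * deriv w \<xi> = 0) \<or> (\<forall>\<xi>\<in>J. gap (w \<xi>) \<noteq> 0 \<and> deriv w \<xi> \<noteq> 0)"
proof -
  have "((\<lambda>\<xi>. gap (w \<xi>) * (deriv w \<xi>)\<^sup>2) has_real_derivative 0) (at \<xi> within J)" if \<xi>: "\<xi> \<in> J" for \<xi>
  proof (rule has_field_derivative_at_within)
    note D = local_waveD[OF assms \<xi>]
    have "((\<lambda>\<xi>. gap (w \<xi>) * (deriv w \<xi>)\<^sup>2) has_real_derivative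
       2 * deriv w \<xi> * (gap (w \<xi>) * deriv (deriv w) \<xi> - c (w \<xi>) * deriv c (w \<xi>) * (deriv w \<xi>)\<^sup>2)) (at \<xi>)"
      by (rule derivative_eq_intros DERIV_chain2[OF DERIV_gap] D refl | simp add: algebra_simps power2_eq_square)+
    then show "((\<lambda>\<xi>. gap (w \<xi>) * (deriv w \<xi>)\<^sup>2) has_real_derivative 0) (at \<xi>)" using D(3) by simp
  qed
  from has_field_derivative_zero_constant[OF _ this] assms
  obtain k where k: "\<And>\<xi>. \<xi> \<in> J \<Longrightarrow> gap (w \<xi>) * (deriv w \<xi>)\<^sup>2 = k"
    by (auto simp: is_interval_convex_1 local_classical_wave_def)
  show ?thesis
  proof (cases "k = 0")
    case True
    then show ?thesis using k by fastforce
  next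
    case False
    then show ?thesis using k by fastforce
  qed
qed

section \<open>No gluing at nonsonic values\<close>

text \<open>Gluing points keep a positive distance, so a punctured neighbourhood of \<open>p\<close> contains none of them.\<close>

lemma composed_sides:
  assumes "composed_of_local_waves c s w"
  obtains \<epsilon> where "\<epsilon> > 0" "local_classical_wave c s w {p - \<epsilon><..<p}" "local_classical_wave c s w {p<..<p + \<epsilon>}"
proof -
  obtain G d where d: "d > 0" "\<forall>x\<in>G. \<forall>y\<in>G. x \<noteq> y \<longrightarrow> d \<le> \<bar>x - y\<bar>"
    and G: "\<And>I. open I \<Longrightarrow> is_interval I \<Longrightarrow> I \<inter> G = {} \<Longrightarrow> local_classical_wave c s w I"
    using assms by (auto simp: composed_of_local_waves_def)
  have "\<exists>\<epsilon>>0. \<forall>y\<in>G. y \<noteq> p \<longrightarrow> \<epsilon> \<le> \<bar>y - p\<bar>"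
  proof (cases "\<exists>y\<in>G. y \<noteq> p \<and> \<bar>y - p\<bar> < d / 2")
    case True
    then obtain y where y: "y \<in> G" "y \<noteq> p" "\<bar>y - p\<bar> < d / 2" by blast
    have "\<bar>y - p\<bar> \<le> \<bar>z - p\<bar>" if "z \<in> G" "z \<noteq> p" for z
    proof (cases "y = z")
      case False
      then have "d \<le> \<bar>y - z\<bar>" using d(2) y(1) that(1) by blast
      then show ?thesis using y(3) by linarith
    qed simp
    then show ?thesis using y by (intro exI[of _ "\<bar>y - p\<bar>"]) auto
  next
    case False
    then show ?thesis using d(1) by (intro exI[of _ "d / 2"]) (auto simp: not_less)
  qed
  then obtain \<epsilon> where "\<epsilon> > 0" and e: "\<And>y. y \<in> G \<Longrightarrow> y \<noteq> p \<Longrightarrow> \<epsilon> \<le> \<bar>y - p\<bar>" by blast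
  have "{p - \<epsilon><..<p} \<inter> G = {}" "{p<..<p + \<epsilon>} \<inter> G = {}" using e by force+
  then show ?thesis using \<open>\<epsilon> > 0\<close> G by (intro that[of \<epsilon>]) auto
qed

lemma nonsonic_neighbourhood:
  fixes w :: "real \<Rightarrow> real"
  assumes "isCont w p" "gap (w p) \<noteq> 0"
  obtains \<epsilon> where "\<epsilon> > 0" "\<And>\<eta>. \<bar>\<eta> - p\<bar> < \<epsilon> \<Longrightarrow> gap (w \<eta>) \<noteq> 0"
proof -
  have "isCont (\<lambda>\<eta>. gap (w \<eta>)) p"
    using assms(1) by (intro isCont_o2[OF _ DERIV_isCont[OF DERIV_gap]])
  from continuous_at_avoid[where f = "\<lambda>\<eta>. gap (w \<eta>)" and a = 0, OF this assms(2)] obtain e where "e > 0" "\<forall>y. dist p y < e \<longrightarrow> gap (w y) \<noteq> 0" by blast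
  then show ?thesis by (intro that[of e]) (auto simp: dist_real_def abs_minus_commute)
qed

text \<open>L'Hospital's rule, applied to the difference quotient.\<close>

lemma DERIV_extend_at_point:
  fixes w f :: "real \<Rightarrow> real"
  assumes "isCont w p" "isCont f p" "\<epsilon> > 0"
    "\<And>\<eta>. \<bar>\<eta> - p\<bar> < \<epsilon> \<Longrightarrow> \<eta> \<noteq> p \<Longrightarrow> (w has_real_derivative f \<eta>) (at \<eta>)"
  shows "(w has_real_derivative f p) (at p)"
proof -
  have "((\<lambda>\<eta>. (w \<eta> - w p) / (\<eta> - p)) \<longlongrightarrow> f p) (at p)"
  proof (rule lhopital)
    show "((\<lambda>\<eta>. w \<eta> - w p) \<longlongrightarrow> 0) (at p)" using assms(1) by (simp add: isCont_def LIM_zero)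
    show "((\<lambda>\<eta>. \<eta> - p) \<longlongrightarrow> 0) (at p)" by (auto intro!: tendsto_eq_intros)
    show "((\<lambda>\<eta>. f \<eta> / 1) \<longlongrightarrow> f p) (at p)" using assms(2) by (simp add: isCont_def)
    show "\<forall>\<^sub>F x in at p. ((\<lambda>\<eta>. w \<eta> - w p) has_real_derivative f x) (at x)"
      unfolding eventually_at using assms(3,4)
      by (intro exI[of _ \<epsilon>]) (auto simp: dist_real_def intro!: derivative_eq_intros)
    show "\<forall>\<^sub>F x in at p. ((\<lambda>\<eta>. \<eta> - p) has_real_derivative 1) (at x)"
      by (intro always_eventually allI) (auto intro!: derivative_eq_intros)
  qed (auto simp: eventually_at_filter)
  then show ?thesis by (simp add: has_field_derivative_iff)
qed

text \<open>On the two sides of \<open>p\<close> the slope is \<open>\<kappa> E\<close> with \<open>E = 1 / sqrt \<bar>gap(w)\<bar>\<close> continuous across \<open>p\<close> and two constants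
  \<open>\<kappa>\<close>. Testing the flux equation with a bump \<open>\<psi>\<close> around \<open>p\<close> and integrating by parts on each side leaves the
  difference of the two boundary terms at \<open>p\<close>. It vanishes, so the constants agree, and the normal form extends
  over \<open>p\<close>.\<close>

lemma nonsonic_imp_local_wave:
  assumes comp: "composed_of_local_waves c s w" and glob: "global_traveling_wave c s w" and ns: "gap (w p) \<noteq> 0"
  obtains \<epsilon> where "\<epsilon> > 0" "local_classical_wave c s w {p - \<epsilon><..<p + \<epsilon>}" "\<And>\<eta>. \<bar>\<eta> - p\<bar> < \<epsilon> \<Longrightarrow> gap (w \<eta>) \<noteq> 0"
proof -
  have cw: "continuous_on UNIV w" using glob by (simp add: global_traveling_wave_def)
  then have wc: "isCont w \<eta>" for \<eta> by (simp add: continuous_on_eq_continuous_at)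
  obtain g where g: "weak_deriv UNIV 1 w g" "L2_loc g"
    "weak_form c (\<lambda>t x. w (x - s * t)) (\<lambda>t x. - s * g (x - s * t)) (\<lambda>t x. g (x - s * t))"
    using glob by (auto simp: global_traveling_wave_def)
  define H where "H = (\<lambda>\<xi>. ((c (w \<xi>))\<^sup>2 - s\<^sup>2) * g \<xi>)"
  define R where "R = (\<lambda>\<xi>. c (w \<xi>) * deriv c (w \<xi>) * (g \<xi>)\<^sup>2)"
  have HR: "weak_deriv UNIV 1 H R"
    using g(3) weak_form_travelling_iff[OF continuous_c continuous_deriv_c cw g(2)] by (simp add: H_def R_def)
  obtain \<epsilon>0 where e0: "\<epsilon>0 > 0" "local_classical_wave c s w {p - \<epsilon>0<..<p}" "local_classical_wave c s w {p<..<p + \<epsilon>0}"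
    using composed_sides[OF comp, of p] by blast
  obtain \<epsilon>1 where e1: "\<epsilon>1 > 0" "\<And>\<eta>. \<bar>\<eta> - p\<bar> < \<epsilon>1 \<Longrightarrow> gap (w \<eta>) \<noteq> 0"
    using nonsonic_neighbourhood[OF wc ns] by blast
  define \<delta> where "\<delta> = min \<epsilon>0 \<epsilon>1"
  have \<delta>: "\<delta> > 0" "\<delta> \<le> \<epsilon>0" "\<delta> \<le> \<epsilon>1" using e0(1) e1(1) by (auto simp: \<delta>_def)
  have nsd: "gap (w \<eta>) \<noteq> 0" if "\<bar>\<eta> - p\<bar> < \<delta>" for \<eta> using e1(2) that \<delta> by simp
  have L: "local_classical_wave c s w {p - \<delta><..<p}" by (rule local_wave_subset[OF e0(2)]) (use \<delta> in auto)
  have Rr: "local_classical_wave c s w {p<..<p + \<delta>}" by (rule local_wave_subset[OF e0(3)]) (use \<delta> in auto)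
  define E where "E \<eta> = 1 / sqrt \<bar>gap (w \<eta>)\<bar>" for \<eta>
  obtain kl where kl: "\<And>\<eta>. \<eta> \<in> {p - \<delta><..<p} \<Longrightarrow> deriv w \<eta> = kl * E \<eta>"
  proof -
    have "\<exists>k. \<forall>\<xi>\<in>{p - \<delta><..<p}. deriv w \<xi> = k / sqrt \<bar>gap (w \<xi>)\<bar>"
    proof (rule normal_form)
      show "\<exists>I. \<xi> \<in> I \<and> local_classical_wave c s w I" if "\<xi> \<in> {p - \<delta><..<p}" for \<xi> using L that by blast
      show "gap (w \<xi>) \<noteq> 0" if "\<xi> \<in> {p - \<delta><..<p}" for \<xi> using that by (intro nsd) auto
    qed simp
    then obtain k where "\<forall>\<xi>\<in>{p - \<delta><..<p}. deriv w \<xi> = k / sqrt \<bar>gap (w \<xi>)\<bar>" by blast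
    then show ?thesis by (intro that[of k]) (simp add: E_def)
  qed
  obtain kr where kr: "\<And>\<eta>. \<eta> \<in> {p<..<p + \<delta>} \<Longrightarrow> deriv w \<eta> = kr * E \<eta>"
  proof -
    have "\<exists>k. \<forall>\<xi>\<in>{p<..<p + \<delta>}. deriv w \<xi> = k / sqrt \<bar>gap (w \<xi>)\<bar>"
    proof (rule normal_form)
      show "\<exists>I. \<xi> \<in> I \<and> local_classical_wave c s w I" if "\<xi> \<in> {p<..<p + \<delta>}" for \<xi> using Rr that by blast
      show "gap (w \<xi>) \<noteq> 0" if "\<xi> \<in> {p<..<p + \<delta>}" for \<xi> using that by (intro nsd) auto
    qed simp
    then obtain k where "\<forall>\<xi>\<in>{p<..<p + \<delta>}. deriv w \<xi> = k / sqrt \<bar>gap (w \<xi>)\<bar>" by blast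
    then show ?thesis by (intro that[of k]) (simp add: E_def)
  qed
  have cg: "continuous_on UNIV (\<lambda>\<eta>. gap (w \<eta>))" "continuous_on UNIV (\<lambda>\<eta>. c (w \<eta>))" "continuous_on UNIV (\<lambda>\<eta>. deriv c (w \<eta>))"
    using continuous_on_compose2[OF continuous_gap cw] continuous_on_compose2[OF continuous_c cw]
      continuous_on_compose2[OF continuous_deriv_c cw] by auto
  have cE: "continuous_on {p - \<delta><..<p + \<delta>} E" unfolding E_def
    by (intro continuous_intros continuous_on_subset[OF cg(1)]) (auto simp: nsd)
  have D: "(w has_real_derivative deriv w \<eta>) (at \<eta>)" if "\<bar>\<eta> - p\<bar> < \<delta>" "\<eta> \<noteq> p" for \<eta>
    using local_waveD(1)[OF L, of \<eta>] local_waveD(1)[OF Rr, of \<eta>] that by (cases "\<eta> < p") auto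
  define J where "J = {p - \<delta><..<p} \<union> {p<..<p + \<delta>}"
  have ae: "AE \<eta> in lborel. \<eta> \<in> J \<longrightarrow> g \<eta> = deriv w \<eta>"
  proof (rule weak_deriv_eq_classical[OF g(1) L2_loc_imp_locally_integrable(1)[OF g(2)]])
    show "open J" by (auto simp: J_def)
    show "(w has_real_derivative deriv w x) (at x)" if "x \<in> J" for x using that by (intro D) (auto simp: J_def)
    show "continuous_on J (deriv w)" unfolding J_def
      by (intro continuous_on_open_Un local_wave_continuous_deriv L Rr) auto
  qed
  define \<psi> where "\<psi> = bump 1 (p - \<delta> / 2) (p + \<delta> / 2)"
  have \<psi>t: "test_function UNIV \<psi>" unfolding \<psi>_def by (rule test_function_bump) (use \<delta> in auto)
  have \<psi>p: "\<psi> p > 0" unfolding \<psi>_def by (rule bump_pos) (use \<delta> in auto)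
  define a b where "a = p - \<delta> / 2" and "b = p + \<delta> / 2"
  have ab: "a < p" "p < b" "p - \<delta> < a" "b < p + \<delta>" using \<delta> by (auto simp: a_def b_def)
  have "test_function {a..b} \<psi>" unfolding \<psi>_def a_def[symmetric] b_def[symmetric] by (rule test_function_bump) (use ab in auto)
  then have \<psi>0: "\<psi> x = 0" "dir_deriv 1 \<psi> x = 0" if "x \<notin> {a..b}" for x using that by (metis test_functionE subsetD)+
  have \<psi>ab: "\<psi> a = 0" "\<psi> b = 0" unfolding \<psi>_def a_def[symmetric] b_def[symmetric] by (auto intro!: bump_eq_0 simp: ab less_imp_le[OF less_trans[OF ab(1,2)]])
  let ?\<psi>' = "dir_deriv 1 \<psi>"
  let ?v = "\<lambda>k \<eta>. - gap (w \<eta>) * (k * E \<eta>)"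
  let ?r = "\<lambda>k \<eta>. c (w \<eta>) * deriv c (w \<eta>) * (k * E \<eta>)\<^sup>2"
  have vd: "(?v k has_real_derivative ?r k \<eta>) (at \<eta>)"
    if I: "local_classical_wave c s w I" "\<eta> \<in> I" "\<And>\<eta>. \<eta> \<in> I \<Longrightarrow> deriv w \<eta> = k * E \<eta>" for \<eta> I k
  proof -
    have "((\<lambda>\<eta>. - gap (w \<eta>) * deriv w \<eta>) has_real_derivative ?r k \<eta>) (at \<eta>)"
      using DERIV_flux[OF I(1,2)] by (simp add: I(3)[OF I(2)])
    then show ?thesis
      by (rule has_field_derivative_transform_within_open[where S = I])
        (use I in \<open>auto simp: local_classical_wave_def\<close>)
  qed
  have cvr: "continuous_on {a..b} (?v k)" "continuous_on {a..b} (?r k)" for k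
    by (intro continuous_intros continuous_on_subset[OF cE] continuous_on_subset[OF cg(1)]
      continuous_on_subset[OF cg(2)] continuous_on_subset[OF cg(3)]; use ab in auto)+
  note \<psi>D = test_function_DERIV[OF \<psi>t] Ck_on_dir_deriv(2)[OF test_function_smooth[OF \<psi>t]]
  have ibp: "set_integrable lborel {lo..hi} (\<lambda>x. ?v k x * ?\<psi>' x)" "set_integrable lborel {lo..hi} (\<lambda>x. ?r k x * \<psi> x)"
    "(LINT x:{lo..hi}|lborel. ?v k x * ?\<psi>' x) + (LINT x:{lo..hi}|lborel. ?r k x * \<psi> x) = ?v k hi * \<psi> hi - ?v k lo * \<psi> lo"
    if lohi: "lo \<le> hi" "{lo..hi} \<subseteq> {a..b}" and I: "{lo<..<hi} \<subseteq> I" "local_classical_wave c s w I"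
      "\<And>\<eta>. \<eta> \<in> I \<Longrightarrow> deriv w \<eta> = k * E \<eta>" for lo hi I k
  proof -
    have "continuous_on {lo..hi} (?v k)" "continuous_on {lo..hi} (?r k)"
      using lohi(2) cvr[of k] by (blast intro: continuous_on_subset)+
    moreover from this(2) have "set_integrable lborel {lo..hi} (?r k)" by (rule borel_integrable_atLeastAtMost')
    moreover have "(?v k has_real_derivative ?r k x) (at x)" if "x \<in> {lo<..<hi} - {}" for x
      using that I(1) by (intro vd[OF I(2) _ I(3)]) auto
    ultimately show "set_integrable lborel {lo..hi} (\<lambda>x. ?v k x * ?\<psi>' x)" "set_integrable lborel {lo..hi} (\<lambda>x. ?r k x * \<psi> x)"
      "(LINT x:{lo..hi}|lborel. ?v k x * ?\<psi>' x) + (LINT x:{lo..hi}|lborel. ?r k x * \<psi> x) = ?v k hi * \<psi> hi - ?v k lo * \<psi> lo"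
      using integral_by_parts_piecewise[OF lohi(1) finite.emptyI, of "?v k" "?r k", OF _ _ _ \<psi>D] by blast+
  qed
  have sub: "{a..p} \<subseteq> {a..b}" "{p..b} \<subseteq> {a..b}" "{a<..<p} \<subseteq> {p - \<delta><..<p}" "{p<..<b} \<subseteq> {p<..<p + \<delta>}"
    using ab by auto
  note il = ibp[OF less_imp_le[OF ab(1)] sub(1,3) L kl] and ir = ibp[OF less_imp_le[OF ab(2)] sub(2,4) Rr kr]
  have HRi: "integrable lborel (\<lambda>x. H x * ?\<psi>' x)" "integrable lborel (\<lambda>x. R x * \<psi> x)"
    "(LINT x|lborel. H x * ?\<psi>' x) = - (LINT x|lborel. R x * \<psi> x)"
    using HR[unfolded weak_deriv_def, rule_format, OF \<psi>t] by (auto simp: set_integrable_def set_lebesgue_integral_def)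
  let ?fl = "\<lambda>x. indicat_real {a..p} x *\<^sub>R (?v kl x * ?\<psi>' x) + indicat_real {a..p} x *\<^sub>R (?r kl x * \<psi> x)"
  let ?fr = "\<lambda>x. indicat_real {p..b} x *\<^sub>R (?v kr x * ?\<psi>' x) + indicat_real {p..b} x *\<^sub>R (?r kr x * \<psi> x)"
  have "AE x in lborel. H x * ?\<psi>' x + R x * \<psi> x = ?fl x + ?fr x"
    using ae AE_lborel_singleton[of p]
  proof eventually_elim
    case (elim x)
    consider "x < a" | "a \<le> x" "x < p" | "p < x" "x \<le> b" | "b < x" using elim(2) by linarith
    then show ?case
    proof cases
      case 2
      then have "x \<in> J" "x \<in> {p - \<delta><..<p}" using ab by (auto simp: J_def)
      with elim have "g x = kl * E x" using kl by auto
      with 2 show ?thesis by (simp add: H_def R_def gap_def)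
    next
      case 3
      then have "x \<in> J" "x \<in> {p<..<p + \<delta>}" using ab by (auto simp: J_def)
      with elim have "g x = kr * E x" using kr by auto
      with 3 show ?thesis by (simp add: H_def R_def gap_def)
    qed (use \<psi>0 ab in auto)
  qed
  then have "(LINT x|lborel. H x * ?\<psi>' x + R x * \<psi> x) = (LINT x|lborel. ?fl x + ?fr x)"
    using HRi(1,2) il(1,2) ir(1,2) unfolding set_integrable_def
    by (intro integral_cong_AE borel_measurable_add borel_measurable_integrable) auto
  moreover have "(LINT x|lborel. ?fl x + ?fr x) = (?v kl p * \<psi> p - ?v kl a * \<psi> a) + (?v kr b * \<psi> b - ?v kr p * \<psi> p)"
    using il ir unfolding set_integrable_def set_lebesgue_integral_def by simp
  moreover have "(LINT x|lborel. H x * ?\<psi>' x + R x * \<psi> x) = 0" using HRi by simp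
  ultimately have "(?v kl p * \<psi> p - ?v kl a * \<psi> a) + (?v kr b * \<psi> b - ?v kr p * \<psi> p) = 0"
    by (simp only:)
  then have "?v kl p * \<psi> p = ?v kr p * \<psi> p" unfolding \<psi>ab by linarith
  then have "gap (w p) * E p * \<psi> p * (kl - kr) = 0" by (simp add: algebra_simps)
  then have k: "kl = kr" using \<psi>p ns by (simp add: E_def)
  have D': "(w has_real_derivative kr * E \<eta>) (at \<eta>)" if "\<bar>\<eta> - p\<bar> < \<delta>" "\<eta> \<noteq> p" for \<eta>
    using D[OF that] kl[of \<eta>] kr[of \<eta>] k that by (cases "\<eta> < p") auto
  have "isCont (\<lambda>\<eta>. kr * E \<eta>) p"
    using cE \<delta> by (intro continuous_intros) (auto simp: continuous_on_eq_continuous_at)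
  then have "(w has_real_derivative kr * E p) (at p)"
    using DERIV_extend_at_point[where f = "\<lambda>\<eta>. kr * E \<eta>", OF wc] D' \<delta>(1) by blast
  with D' have D'': "(w has_real_derivative kr / sqrt \<bar>gap (w \<eta>)\<bar>) (at \<eta>)" if "\<bar>\<eta> - p\<bar> < \<delta>" for \<eta>
    using that by (cases "\<eta> = p") (auto simp: E_def)
  have "local_classical_wave c s w {p - \<delta><..<p + \<delta>}"
    by (rule normal_form_imp_local_wave[OF _ _ nsd D'']) auto
  then show ?thesis using that \<delta>(1) nsd by blast
qed

end

section \<open>Monotonicity\<close>

lemma strict_mono_on_intervalI:
  fixes w :: "real \<Rightarrow> real"
  assumes "is_interval J" "continuous_on J w"
    and d: "\<And>x. x \<in> interior J \<Longrightarrow> (w has_real_derivative d x) (at x) \<and> 0 < d x"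
  shows "strict_mono_on J w"
proof (rule strict_mono_onI)
  fix x y assume xy: "x \<in> J" "y \<in> J" "x < y"
  have sub: "{x..y} \<subseteq> J" using mem_is_interval_1_I[OF assms(1) xy(1,2)] by auto
  then have "{x<..<y} \<subseteq> interior J" using interior_mono[OF sub] by simp
  then have "\<exists>m. (w has_real_derivative m) (at z) \<and> 0 < m" if "x < z" "z < y" for z
    using d[of z] that by (meson greaterThanLessThan_iff subsetD)
  then show "w x < w y"
    by (rule DERIV_pos_imp_increasing_open[OF xy(3) _ continuous_on_subset[OF assms(2) sub]])
qed

lemma strictly_monotone_on_intervalI:
  fixes w :: "real \<Rightarrow> real"
  assumes "is_interval J" "continuous_on J w" "\<And>x. x \<in> interior J \<Longrightarrow> (w has_real_derivative d x) (at x)"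
    and "(\<forall>x\<in>interior J. 0 < d x) \<or> (\<forall>x\<in>interior J. d x < 0)"
  shows "strictly_monotone_wave_on J w"
  using assms(4)
proof
  assume "\<forall>x\<in>interior J. 0 < d x"
  then have "strict_mono_on J w" using assms(3) by (intro strict_mono_on_intervalI[OF assms(1,2), of d]) blast
  then show ?thesis by (simp add: strictly_monotone_wave_on_def)
next
  assume "\<forall>x\<in>interior J. d x < 0"
  then have "strict_mono_on J (\<lambda>x. - w x)"
    using assms(3) by (intro strict_mono_on_intervalI[where d = "\<lambda>x. - d x"] assms(1) continuous_on_minus assms(2))
      (auto intro: DERIV_minus)
  then show ?thesis by (auto simp: strictly_monotone_wave_on_def monotone_on_def)
qed

lemma strictly_monotone_imp_monotone:
  "strictly_monotone_wave_on J w \<Longrightarrow> monotone_wave_on J w"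
  unfolding strictly_monotone_wave_on_def monotone_wave_on_def
  by (auto simp: monotone_on_def le_less)

lemma constant_imp_monotone: "\<forall>\<eta>\<in>A. w \<eta> = k \<Longrightarrow> monotone_wave_on A w"
  by (simp add: monotone_wave_on_def monotone_on_def)

text \<open>Segments instead of intervals, so that one statement serves both sides of a point.\<close>

lemma eq_at_endpoint:
  fixes f :: "real \<Rightarrow> real"
  assumes "continuous_on (closed_segment p \<xi>) f"
    and "\<And>x. x \<in> open_segment p \<xi> \<Longrightarrow> (f has_real_derivative 0) (at x)"
  shows "f \<xi> = f p"
proof -
  consider "p < \<xi>" | "\<xi> < p" | "p = \<xi>" by linarith
  then show ?thesis
  proof cases
    case 1
    then show ?thesis using assms by (intro DERIV_isconst_end) (auto simp: closed_segment_eq_real_ivl open_segment_eq_real_ivl)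
  next
    case 2
    then show ?thesis using assms by (intro DERIV_isconst_end[symmetric]) (auto simp: closed_segment_eq_real_ivl open_segment_eq_real_ivl)
  qed simp
qed

lemma mean_value_from_endpoint:
  fixes w :: "real \<Rightarrow> real"
  assumes cw: "continuous_on UNIV w" and "p \<noteq> \<eta>"
    and D: "\<And>x. x \<in> open_segment p \<eta> \<Longrightarrow> (w has_real_derivative d x) (at x)"
  shows "\<exists>z\<in>open_segment p \<eta>. w \<eta> - w p = (\<eta> - p) * d z"
proof -
  have *: "\<exists>z. a < z \<and> z < b \<and> w b - w a = (b - a) * d z"
    if "a < b" "\<And>x. a < x \<Longrightarrow> x < b \<Longrightarrow> (w has_real_derivative d x) (at x)" for a b
  proof -
    have "\<exists>l z. a < z \<and> z < b \<and> (w has_real_derivative l) (at z) \<and> w b - w a = (b - a) * l"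
      using that by (intro MVT continuous_on_subset[OF cw]) (auto simp: real_differentiable_def)
    then show ?thesis using that(2) DERIV_unique by blast
  qed
  show ?thesis
  proof (cases "p < \<eta>")
    case True
    then show ?thesis using *[of p \<eta>] D by (auto simp: open_segment_eq_real_ivl)
  next
    case False
    then obtain z where "\<eta> < z" "z < p" "w p - w \<eta> = (p - \<eta>) * d z"
      using *[of \<eta> p] D \<open>p \<noteq> \<eta>\<close> by (auto simp: open_segment_eq_real_ivl)
    then show ?thesis by (intro bexI[of _ z]) (auto simp: open_segment_eq_real_ivl algebra_simps)
  qed
qed

context wave_speed begin

lemma local_wave_normal_form:
  assumes "local_classical_wave c s w J" "\<And>\<xi>. \<xi> \<in> J \<Longrightarrow> gap (w \<xi>) \<noteq> 0"
  obtains \<kappa> where "\<And>\<xi>. \<xi> \<in> J \<Longrightarrow> deriv w \<xi> = \<kappa> / sqrt \<bar>gap (w \<xi>)\<bar>"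
proof -
  have "is_interval J" using assms(1) by (simp add: local_classical_wave_def)
  from normal_form[OF this, of w] assms that show ?thesis by blast
qed

lemma normal_form_monotone:
  assumes "is_interval J" "\<And>\<xi>. \<xi> \<in> J \<Longrightarrow> gap (w \<xi>) \<noteq> 0"
    and D: "\<And>\<xi>. \<xi> \<in> J \<Longrightarrow> (w has_real_derivative \<kappa> / sqrt \<bar>gap (w \<xi>)\<bar>) (at \<xi>)"
  shows "\<kappa> = 0 \<Longrightarrow> w constant_on J" "\<kappa> \<noteq> 0 \<Longrightarrow> strictly_monotone_wave_on J w" "monotone_wave_on J w"
proof -
  have cw: "continuous_on J w" by (intro continuous_at_imp_continuous_on ballI) (rule DERIV_isCont[OF D])
  have i: "x \<in> J" if "x \<in> interior J" for x using that interior_subset by blast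
  show z: "w constant_on J" if "\<kappa> = 0"
  proof -
    have "\<And>\<xi>. \<xi> \<in> J \<Longrightarrow> (w has_real_derivative 0) (at \<xi> within J)"
      using D that by (auto intro: has_field_derivative_at_within)
    from has_field_derivative_zero_constant[OF _ this] assms(1)
    show ?thesis by (auto simp: constant_on_def is_interval_convex_1)
  qed
  show st: "strictly_monotone_wave_on J w" if "\<kappa> \<noteq> 0"
  proof (rule strictly_monotone_on_intervalI[OF assms(1) cw D])
    show "(\<forall>\<xi>\<in>interior J. 0 < \<kappa> / sqrt \<bar>gap (w \<xi>)\<bar>) \<or> (\<forall>\<xi>\<in>interior J. \<kappa> / sqrt \<bar>gap (w \<xi>)\<bar> < 0)"
      using that assms(2) i by (cases "\<kappa> > 0") (auto simp: divide_less_0_iff zero_less_divide_iff)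
  qed (rule i)
  show "monotone_wave_on J w"
  proof (cases "\<kappa> = 0")
    case True
    then obtain y where "\<forall>\<xi>\<in>J. w \<xi> = y" using z by (auto simp: constant_on_def)
    then show ?thesis by (rule constant_imp_monotone)
  qed (use st strictly_monotone_imp_monotone in blast)
qed

section \<open>Speeds outside the range of the wave speed\<close>

text \<open>The slope \<open>\<kappa> / sqrt \<bar>gap(w)\<bar>\<close> is at least \<open>\<bar>\<kappa>\<bar> / sqrt M\<close> in absolute value, so by the mean value theorem \<open>w\<close> grows
  at least linearly unless \<open>\<kappa> = 0\<close>.\<close>

lemma nonsonic_speed:
  assumes comp: "composed_of_local_waves c s w" and glob: "global_traveling_wave c s w"
    and ns: "\<And>v. gap v \<noteq> 0" and M: "\<And>v. \<bar>gap v\<bar> \<le> M"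
  shows "monotone_wave_on UNIV w" "local_classical_wave c s w UNIV"
    "\<not> w constant_on UNIV \<Longrightarrow> \<not> bounded (range w)"
proof -
  have loc: "\<exists>I. \<xi> \<in> I \<and> local_classical_wave c s w I" for \<xi>
    using nonsonic_imp_local_wave[OF comp glob ns, of \<xi>]
    by (metis add_strict_increasing diff_less_eq greaterThanLessThan_iff le_less less_add_same_cancel1)
  have "\<exists>\<kappa>. \<forall>\<xi>\<in>UNIV. deriv w \<xi> = \<kappa> / sqrt \<bar>gap (w \<xi>)\<bar>"
    by (rule normal_form) (auto simp: loc ns)
  then obtain \<kappa> where \<kappa>: "\<And>\<xi>. deriv w \<xi> = \<kappa> / sqrt \<bar>gap (w \<xi>)\<bar>" by blast
  have D: "(w has_real_derivative \<kappa> / sqrt \<bar>gap (w \<xi>)\<bar>) (at \<xi>)" for \<xi>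
    using loc[of \<xi>] local_waveD(1) \<kappa>[of \<xi>] by metis
  note N = normal_form_monotone[of UNIV w, OF _ ns D]
  show "monotone_wave_on UNIV w" by (rule N(3)) simp
  show "local_classical_wave c s w UNIV" by (rule normal_form_imp_local_wave[OF _ _ ns D]) auto
  show "\<not> bounded (range w)" if "\<not> w constant_on UNIV"
  proof
    assume "bounded (range w)"
    then obtain B where B: "\<And>x. \<bar>w x\<bar> \<le> B" by (auto simp: bounded_iff)
    have k: "\<kappa> \<noteq> 0" using that N(1) by auto
    have "0 < \<bar>gap 0\<bar>" using ns by simp
    then have M0: "M > 0" using M[of 0] by linarith
    define m where "m = \<bar>\<kappa>\<bar> / sqrt M"
    have m: "m > 0" using k M0 by (simp add: m_def)
    have dm: "m \<le> \<bar>\<kappa> / sqrt \<bar>gap (w \<xi>)\<bar>\<bar>" for \<xi>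
      using M[of "w \<xi>"] ns[of "w \<xi>"] unfolding m_def by (auto simp: abs_divide intro!: divide_left_mono)
    \<comment> \<open>Over an interval of this length \<open>w\<close> changes by more than the diameter \<open>2 B\<close> of its range.\<close>
    define x where "x = (2 * B + 1) / m"
    have "B \<ge> 0" using B[of 0] by linarith
    then have "x > 0" using m by (simp add: x_def)
    then obtain z where "w x - w 0 = (x - 0) * (\<kappa> / sqrt \<bar>gap (w z)\<bar>)"
      using MVT2[of 0 x w "\<lambda>z. \<kappa> / sqrt \<bar>gap (w z)\<bar>"] D by auto
    then have "\<bar>w x - w 0\<bar> = x * \<bar>\<kappa> / sqrt \<bar>gap (w z)\<bar>\<bar>" using \<open>x > 0\<close> by (simp add: abs_mult)
    also have "\<dots> \<ge> x * m" using dm \<open>x > 0\<close> by (intro mult_left_mono) auto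
    also have "x * m = 2 * B + 1" using m by (simp add: x_def)
    finally show False using B[of x] B[of 0] by linarith
  qed
qed

lemma gluing_point_sonic:
  assumes "composed_of_local_waves c s w" "global_traveling_wave c s w" "gluing_point c s w \<xi>"
  shows "\<bar>s\<bar> = c (w \<xi>)"
proof (rule ccontr)
  assume "\<bar>s\<bar> \<noteq> c (w \<xi>)"
  then have "gap (w \<xi>) \<noteq> 0" by (simp add: gap_eq_0_iff)
  from nonsonic_imp_local_wave[OF assms(1,2) this] assms(3) show False
    by (auto simp: gluing_point_def)
qed

section \<open>Extrema of the wave speed at nonsonic values\<close>

lemma local_extremum_mono:
  fixes f h :: "real \<Rightarrow> real"
  assumes "local_extremum f x"
    and "\<forall>\<^sub>F y in nhds x. (f y \<le> f x \<longrightarrow> h y \<le> h x) \<and> (f x \<le> f y \<longrightarrow> h x \<le> h y)"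
  shows "local_extremum h x"
  using assms(1) unfolding local_extremum_def
proof (elim disjE)
  assume "\<forall>\<^sub>F y in nhds x. f y \<le> f x"
  with assms(2) have "\<forall>\<^sub>F y in nhds x. h y \<le> h x" by eventually_elim simp
  then show "(\<forall>\<^sub>F y in nhds x. h y \<le> h x) \<or> (\<forall>\<^sub>F y in nhds x. h x \<le> h y)" ..
next
  assume "\<forall>\<^sub>F y in nhds x. f x \<le> f y"
  with assms(2) have "\<forall>\<^sub>F y in nhds x. h x \<le> h y" by eventually_elim simp
  then show "(\<forall>\<^sub>F y in nhds x. h y \<le> h x) \<or> (\<forall>\<^sub>F y in nhds x. h x \<le> h y)" ..
qed

lemma local_extremum_uminus:
  fixes f :: "real \<Rightarrow> real"
  shows "local_extremum (\<lambda>y. - f y) x \<longleftrightarrow> local_extremum f x"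
  by (auto simp: local_extremum_def)

lemma local_extremum_compose:
  fixes w f :: "real \<Rightarrow> real"
  assumes "isCont w \<xi>" "local_extremum f (w \<xi>)"
  shows "local_extremum (\<lambda>\<eta>. f (w \<eta>)) \<xi>"
proof -
  have "filterlim w (nhds (w \<xi>)) (nhds \<xi>)"
    using assms(1) by (simp add: isCont_def tendsto_at_iff_tendsto_nhds)
  then show ?thesis using assms(2) unfolding local_extremum_def filterlim_iff by blast
qed

text \<open>The factor \<open>\<tau>\<close> may be negative: a change of sign survives a reflection.\<close>

lemma changes_sign_sgn:
  fixes f h :: "real \<Rightarrow> real"
  assumes "changes_sign f x" "\<tau> \<noteq> 0" and "\<forall>\<^sub>F y in at x. sgn (h y) = sgn (\<tau> * f y)"
  shows "changes_sign h x"
proof -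
  have ev: "\<forall>\<^sub>F y in at_left x. sgn (h y) = sgn (\<tau> * f y)" "\<forall>\<^sub>F y in at_right x. sgn (h y) = sgn (\<tau> * f y)"
    using assms(3) by (auto simp: eventually_at_split)
  have pt: "0 < f y \<Longrightarrow> 0 < \<tau> * h y" "f y < 0 \<Longrightarrow> \<tau> * h y < 0" if "sgn (h y) = sgn (\<tau> * f y)" for y
  proof -
    have "sgn (\<tau> * h y) = sgn (\<tau> * \<tau>) * sgn (f y)" using that by (simp add: sgn_mult mult.assoc)
    also have "sgn (\<tau> * \<tau>) = 1" using assms(2) by (simp add: sgn_mult)
    finally have "sgn (\<tau> * h y) = sgn (f y)" by simp
    then show "0 < f y \<Longrightarrow> 0 < \<tau> * h y" "f y < 0 \<Longrightarrow> \<tau> * h y < 0" by (metis sgn_greater sgn_less)+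
  qed
  have pos: "\<forall>\<^sub>F y in F. 0 < \<tau> * h y" if "\<forall>\<^sub>F y in F. 0 < f y" "\<forall>\<^sub>F y in F. sgn (h y) = sgn (\<tau> * f y)" for F
    using that by eventually_elim (rule pt)
  have neg: "\<forall>\<^sub>F y in F. \<tau> * h y < 0" if "\<forall>\<^sub>F y in F. f y < 0" "\<forall>\<^sub>F y in F. sgn (h y) = sgn (\<tau> * f y)" for F
    using that by eventually_elim (rule pt)
  from assms(1) have "changes_sign (\<lambda>y. \<tau> * h y) x"
    unfolding changes_sign_def using pos[OF _ ev(1)] pos[OF _ ev(2)] neg[OF _ ev(1)] neg[OF _ ev(2)] by blast
  then show ?thesis using assms(2) by (cases "\<tau> > 0") (auto simp: changes_sign_def zero_less_mult_iff mult_less_0_iff)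
qed

lemma changes_sign_compose:
  fixes w f :: "real \<Rightarrow> real"
  assumes "changes_sign f (w x)"
    and "filterlim w (at_left (w x)) (at_left x) \<and> filterlim w (at_right (w x)) (at_right x)
       \<or> filterlim w (at_right (w x)) (at_left x) \<and> filterlim w (at_left (w x)) (at_right x)"
  shows "changes_sign (\<lambda>y. f (w y)) x"
  using assms unfolding changes_sign_def filterlim_iff by blast

lemma strictly_monotone_crossing:
  fixes w :: "real \<Rightarrow> real"
  assumes "isCont w x" "open J" "x \<in> J" "strictly_monotone_wave_on J w"
  shows "filterlim w (at_left (w x)) (at_left x) \<and> filterlim w (at_right (w x)) (at_right x)
       \<or> filterlim w (at_right (w x)) (at_left x) \<and> filterlim w (at_left (w x)) (at_right x)"
proof -
  have t: "(w \<longlongrightarrow> w x) (at_left x)" "(w \<longlongrightarrow> w x) (at_right x)"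
    using assms(1) by (auto simp: isCont_def filterlim_at_split)
  have ev: "\<forall>\<^sub>F y in at_left x. y \<in> J \<and> y < x" "\<forall>\<^sub>F y in at_right x. y \<in> J \<and> x < y"
    using eventually_nhds_in_open[OF assms(2,3)] by (auto simp: eventually_at_filter elim: eventually_mono)
  show ?thesis
  proof (cases "strict_mono_on J w")
    case True
    then have "\<forall>\<^sub>F y in at_left x. w y < w x" "\<forall>\<^sub>F y in at_right x. w x < w y"
      using assms(3) by (auto intro!: eventually_mono[OF ev(1)] eventually_mono[OF ev(2)] simp: monotone_on_def)
    then have "filterlim w (at_left (w x)) (at_left x)" "filterlim w (at_right (w x)) (at_right x)"
      using t by (auto simp: filterlim_at elim: eventually_mono)
    then show ?thesis by blast
  next
    case False
    then have "strict_antimono_on J w" using assms(4) by (simp add: strictly_monotone_wave_on_def)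
    then have "\<forall>\<^sub>F y in at_left x. w x < w y" "\<forall>\<^sub>F y in at_right x. w y < w x"
      using assms(3) by (auto intro!: eventually_mono[OF ev(1)] eventually_mono[OF ev(2)] simp: monotone_on_def)
    then have "filterlim w (at_right (w x)) (at_left x)" "filterlim w (at_left (w x)) (at_right x)"
      using t by (auto simp: filterlim_at elim: eventually_mono)
    then show ?thesis by blast
  qed
qed

lemma eventually_gap_sgn:
  assumes "gap v0 \<noteq> 0"
  shows "\<forall>\<^sub>F v in nhds v0. sgn (gap v) = sgn (gap v0)"
proof -
  have t: "(gap \<longlongrightarrow> gap v0) (nhds v0)"
    using DERIV_isCont[OF DERIV_gap, of v0] by (simp add: isCont_def tendsto_at_iff_tendsto_nhds)
  show ?thesis
  proof (cases "gap v0 > 0")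
    case True
    from order_tendstoD(1)[OF t this] show ?thesis using True by (auto elim: eventually_mono)
  next
    case False
    then have "gap v0 < 0" using assms by simp
    from order_tendstoD(2)[OF t this] show ?thesis using \<open>gap v0 < 0\<close> by (auto elim: eventually_mono)
  qed
qed

text \<open>By the normal form, \<open>\<bar>w\<^sub>\<xi>\<bar>\<close> is a monotone function of \<open>\<bar>gap(w)\<bar>\<close>, and near a nonsonic value \<open>\<bar>gap\<bar>\<close> is a monotone
  function of \<open>c\<close>; so extrema of \<open>c\<close> become extrema of the slope. For the inflection point, \<open>w\<^sub>\<xi>\<^sub>\<xi>\<close> has the
  sign of \<open>gap(w(\<xi>)) c'(w)\<close>, and a nonconstant \<open>w\<close> crosses the value \<open>w(\<xi>)\<close> strictly.\<close>

lemma local_extremum_nonsonic: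
  assumes comp: "composed_of_local_waves c s w" and glob: "global_traveling_wave c s w"
    and ns: "gap (w \<xi>) \<noteq> 0" and ext: "local_extremum c (w \<xi>)"
  shows "\<exists>\<epsilon>>0. local_classical_wave c s w {\<xi> - \<epsilon><..<\<xi> + \<epsilon>} \<and> monotone_wave_on {\<xi> - \<epsilon><..<\<xi> + \<epsilon>} w"
    "deriv (deriv w) \<xi> = 0" "local_extremum (deriv w) \<xi>"
    "changes_sign (deriv c) (w \<xi>) \<Longrightarrow> constant_near w \<xi> \<or> inflection_point w \<xi>"
proof -
  obtain \<epsilon> where \<epsilon>: "\<epsilon> > 0" and loc: "local_classical_wave c s w {\<xi> - \<epsilon><..<\<xi> + \<epsilon>}"
    and nse: "\<And>\<eta>. \<bar>\<eta> - \<xi>\<bar> < \<epsilon> \<Longrightarrow> gap (w \<eta>) \<noteq> 0"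
    using nonsonic_imp_local_wave[OF comp glob ns] by blast
  define J where "J = {\<xi> - \<epsilon><..<\<xi> + \<epsilon>}"
  have J: "open J" "is_interval J" "\<xi> \<in> J" using \<epsilon> by (auto simp: J_def)
  have nsJ: "gap (w \<eta>) \<noteq> 0" if "\<eta> \<in> J" for \<eta> using that by (intro nse) (auto simp: J_def)
  note D = local_waveD[OF loc, folded J_def]
  obtain \<kappa> where \<kappa>: "\<And>\<eta>. \<eta> \<in> J \<Longrightarrow> deriv w \<eta> = \<kappa> / sqrt \<bar>gap (w \<eta>)\<bar>"
    using local_wave_normal_form[OF loc[folded J_def] nsJ] by blast
  have D1: "(w has_real_derivative \<kappa> / sqrt \<bar>gap (w \<eta>)\<bar>) (at \<eta>)" if "\<eta> \<in> J" for \<eta>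
    using D(1)[OF that] \<kappa>[OF that] by simp
  note N = normal_form_monotone[of J w, OF J(2) nsJ D1]
  show "\<exists>\<epsilon>>0. local_classical_wave c s w {\<xi> - \<epsilon><..<\<xi> + \<epsilon>} \<and> monotone_wave_on {\<xi> - \<epsilon><..<\<xi> + \<epsilon>} w"
    using \<epsilon> loc N(3) by (auto simp: J_def)
  have c'0: "deriv c (w \<xi>) = 0"
    using ext unfolding local_extremum_def eventually_nhds_metric dist_real_def
    using DERIV_local_max[OF DERIV_c] DERIV_local_min[OF DERIV_c] by (metis abs_minus_commute)
  then show "deriv (deriv w) \<xi> = 0" using D(3)[OF J(3)] ns by simp
  have wc: "isCont w \<eta>" if "\<eta> \<in> J" for \<eta> using D(1)[OF that] by (rule DERIV_isCont)
  have ntw: "filterlim w (nhds (w \<xi>)) (nhds \<xi>)" using wc[OF J(3)] by (simp add: isCont_def tendsto_at_iff_tendsto_nhds)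
  have evJ: "\<forall>\<^sub>F \<eta> in nhds \<xi>. \<eta> \<in> J" using J by (intro eventually_nhds_in_open)
  show "local_extremum (deriv w) \<xi>"
  proof -
    define v0 where "v0 = w \<xi>"
    have "local_extremum (\<lambda>v. \<bar>gap v\<bar>) v0"
    proof (cases "gap v0 > 0")
      case True
      have "local_extremum (\<lambda>v. - \<bar>gap v\<bar>) v0"
      proof (rule local_extremum_mono[OF ext[folded v0_def]])
        show "\<forall>\<^sub>F v in nhds v0. (c v \<le> c v0 \<longrightarrow> - \<bar>gap v\<bar> \<le> - \<bar>gap v0\<bar>) \<and> (c v0 \<le> c v \<longrightarrow> - \<bar>gap v0\<bar> \<le> - \<bar>gap v\<bar>)"
          using eventually_gap_sgn[of v0] True
          by (auto elim!: eventually_mono simp: sgn_if gap_def intro!: power_mono less_imp_le[OF c_pos] split: if_splits)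
      qed
      then show ?thesis by (simp add: local_extremum_uminus)
    next
      case False
      then have "gap v0 < 0" using ns by (simp add: v0_def)
      then show ?thesis
        using eventually_gap_sgn[of v0]
        by (intro local_extremum_mono[OF ext[folded v0_def]])
          (auto elim!: eventually_mono simp: sgn_if gap_def intro!: power_mono less_imp_le[OF c_pos] split: if_splits)
    qed
    then have "local_extremum (\<lambda>\<eta>. \<bar>gap (w \<eta>)\<bar>) \<xi>"
      unfolding v0_def by (rule local_extremum_compose[OF wc[OF J(3)]])
    then have *: "local_extremum (\<lambda>\<eta>. - (\<bar>\<kappa>\<bar> / sqrt \<bar>gap (w \<eta>)\<bar>)) \<xi>"
    proof (rule local_extremum_mono)
      show "\<forall>\<^sub>F \<eta> in nhds \<xi>. (\<bar>gap (w \<eta>)\<bar> \<le> \<bar>gap (w \<xi>)\<bar> \<longrightarrow> - (\<bar>\<kappa>\<bar> / sqrt \<bar>gap (w \<eta>)\<bar>) \<le> - (\<bar>\<kappa>\<bar> / sqrt \<bar>gap (w \<xi>)\<bar>)) \<and>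
          (\<bar>gap (w \<xi>)\<bar> \<le> \<bar>gap (w \<eta>)\<bar> \<longrightarrow> - (\<bar>\<kappa>\<bar> / sqrt \<bar>gap (w \<xi>)\<bar>) \<le> - (\<bar>\<kappa>\<bar> / sqrt \<bar>gap (w \<eta>)\<bar>))"
        using evJ
      proof eventually_elim
        case (elim \<eta>)
        then have "gap (w \<eta>) \<noteq> 0" by (rule nsJ)
        then show ?case using ns by (auto intro!: divide_left_mono)
      qed
    qed
    have **: "local_extremum (\<lambda>\<eta>. \<kappa> / sqrt \<bar>gap (w \<eta>)\<bar>) \<xi>"
    proof (cases "\<kappa> \<ge> 0")
      case True
      then show ?thesis using * by (simp add: local_extremum_uminus)
    qed (use * in simp)
    show ?thesis
      by (rule local_extremum_mono[OF **]) (use evJ J in \<open>auto elim!: eventually_mono simp: \<kappa>\<close>)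
  qed
  show "constant_near w \<xi> \<or> inflection_point w \<xi>" if ch: "changes_sign (deriv c) (w \<xi>)"
  proof (cases "\<kappa> = 0")
    case True
    then have "w constant_on J" using N(1) by simp
    then have "\<forall>\<eta>\<in>J. w \<eta> = w \<xi>" using J(3) by (auto simp: constant_on_def)
    then show ?thesis using evJ by (auto simp: constant_near_def elim: eventually_mono)
  next
    case False
    then have N2: "strictly_monotone_wave_on J w" using N(2) by simp
    have "changes_sign (\<lambda>\<eta>. deriv c (w \<eta>)) \<xi>"
      by (rule changes_sign_compose[OF ch strictly_monotone_crossing[OF wc[OF J(3)] J(1,3) N2]])
    then have "changes_sign (deriv (deriv w)) \<xi>"
    proof (rule changes_sign_sgn)
      show "sgn (gap (w \<xi>)) \<noteq> 0" using ns by (simp add: sgn_if)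
      have "\<forall>\<^sub>F \<eta> in nhds \<xi>. sgn (gap (w \<eta>)) = sgn (gap (w \<xi>))"
        using ntw eventually_gap_sgn[OF ns] unfolding filterlim_iff by blast
      with evJ have "\<forall>\<^sub>F \<eta> in nhds \<xi>. sgn (deriv (deriv w) \<eta>) = sgn (sgn (gap (w \<xi>)) * deriv c (w \<eta>))"
      proof eventually_elim
        case (elim \<eta>)
        have 1: "gap (w \<eta>) \<noteq> 0" using elim(1) by (rule nsJ)
        then have 2: "deriv w \<eta> \<noteq> 0" using False \<kappa>[OF elim(1)] by simp
        have "sgn (gap (w \<eta>)) * sgn (deriv (deriv w) \<eta>) = sgn (deriv c (w \<eta>))"
          using arg_cong[OF D(3)[OF elim(1)], of sgn] 2 c_pos[of "w \<eta>"] by (simp add: sgn_mult) (simp add: sgn_if)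
        then have "sgn (gap (w \<eta>)) * (sgn (gap (w \<eta>)) * sgn (deriv (deriv w) \<eta>)) = sgn (gap (w \<eta>)) * sgn (deriv c (w \<eta>))" by simp
        moreover have "sgn (gap (w \<eta>)) * sgn (gap (w \<eta>)) = 1" using 1 by (simp add: sgn_if)
        ultimately show ?case using elim(2) by (simp add: sgn_mult flip: mult.assoc)
      qed
      then show "\<forall>\<^sub>F \<eta> in at \<xi>. sgn (deriv (deriv w) \<eta>) = sgn (sgn (gap (w \<xi>)) * deriv c (w \<eta>))"
        by (auto simp: eventually_at_filter elim: eventually_mono)
    qed
    moreover have "\<forall>\<^sub>F \<eta> in at \<xi>. w differentiable at \<eta> \<and> deriv w differentiable at \<eta>"
      using evJ D(1,2) by (auto simp: eventually_at_filter real_differentiable_def elim!: eventually_mono)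
    ultimately show ?thesis using wc[OF J(3)] by (simp add: inflection_point_def)
  qed
qed

section \<open>Sonic values with nonzero derivative of the wave speed\<close>

text \<open>If \<open>F' = gap\<close>, then \<open>(F \<circ> w)' = gap(w) w\<^sub>\<xi> = 0\<close>. By continuity \<open>w\<close> takes all values between \<open>w p\<close> and \<open>w \<xi>\<close>, so
  \<open>F\<close> is constant between them.\<close>

lemma silent_side:
  assumes cw: "continuous_on UNIV w" and loc: "local_classical_wave c s w J"
    and seg: "open_segment p \<xi> \<subseteq> J" and k: "\<And>\<eta>. \<eta> \<in> J \<Longrightarrow> gap (w \<eta>) * deriv w \<eta> = 0"
    and v: "v \<in> open_segment (w p) (w \<xi>)"
  shows "gap v = 0"
proof -
  \<comment> \<open>An antiderivative is taken on a compact interval slightly larger than the range of \<open>w\<close> on the segment.\<close>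
  have "compact (w ` closed_segment p \<xi>)"
    by (intro compact_continuous_image continuous_on_subset[OF cw]) auto
  then obtain A B where AB: "w ` closed_segment p \<xi> \<subseteq> {A..B}" using compact_subset_Icc by blast
  obtain F where F: "\<And>y. y \<in> {A - 1..B + 1} \<Longrightarrow> (F has_vector_derivative gap y) (at y within {A - 1..B + 1})"
    using antiderivative_continuous[OF continuous_on_subset[OF continuous_gap subset_UNIV]] by blast
  have DF: "(F has_real_derivative gap y) (at y)" if "y \<in> {A..B}" for y
  proof -
    have "at y within {A - 1..B + 1} = at y" using that by (intro at_within_Icc_at) auto
    then show ?thesis using F[of y] that by (simp add: has_real_derivative_iff_has_vector_derivative)
  qed
  have wAB: "w \<eta> \<in> {A..B}" if "\<eta> \<in> closed_segment p \<xi>" for \<eta> using AB that by blast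
  have Fw: "F (w \<eta>) = F (w p)" if \<eta>: "\<eta> \<in> closed_segment p \<xi>" for \<eta>
  proof (rule eq_at_endpoint[of p \<eta> "\<lambda>\<eta>. F (w \<eta>)"])
    have sub: "closed_segment p \<eta> \<subseteq> closed_segment p \<xi>" using \<eta> by (simp add: subset_closed_segment)
    have cF: "continuous_on {A..B} F" by (intro continuous_at_imp_continuous_on ballI) (rule DERIV_isCont[OF DF])
    show "continuous_on (closed_segment p \<eta>) (\<lambda>\<eta>. F (w \<eta>))"
      using wAB sub by (intro continuous_on_compose2[OF cF continuous_on_subset[OF cw]]) auto
    fix x assume x: "x \<in> open_segment p \<eta>"
    then have "x \<in> open_segment p \<xi>" "x \<in> closed_segment p \<xi>"
      using \<eta> by (auto simp: open_segment_eq_real_ivl closed_segment_eq_real_ivl split: if_splits)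
    then have "x \<in> J" "w x \<in> {A..B}" using seg wAB by auto
    from DERIV_chain2[OF DF[OF this(2)] local_waveD(1)[OF loc this(1)]] k[OF this(1)]
    show "((\<lambda>\<eta>. F (w \<eta>)) has_real_derivative 0) (at x)" by simp
  qed
  have Fc: "F y = F (w p)" if "y \<in> open_segment (w p) (w \<xi>)" for y
  proof -
    have "connected (w ` closed_segment p \<xi>)"
      by (intro connected_continuous_image continuous_on_subset[OF cw]) auto
    then have "closed_segment (w p) (w \<xi>) \<subseteq> w ` closed_segment p \<xi>"
      by (intro closed_segment_subset) (auto simp: is_interval_convex_1 is_interval_connected_1[symmetric])
    then show ?thesis using that Fw segment_open_subset_closed by blast
  qed
  have "v \<in> {A..B}" using v wAB[of p] wAB[of \<xi>] by (auto simp: open_segment_eq_real_ivl split: if_splits)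
  have "((\<lambda>_. F (w p)) has_real_derivative gap v) (at v)"
    by (rule has_field_derivative_transform_within_open[OF DF[OF \<open>v \<in> {A..B}\<close>] _ v])
      (auto simp: Fc open_segment_eq_real_ivl)
  from DERIV_unique[OF this DERIV_const] show ?thesis .
qed

lemma gap_near_regular_zero:
  assumes "gap v0 = 0" "deriv c v0 \<noteq> 0"
  shows "\<exists>e>0. \<forall>v. \<bar>v - v0\<bar> < e \<longrightarrow> (v \<noteq> v0 \<longrightarrow> gap v * deriv c v0 * (v - v0) < 0) \<and> deriv c v * deriv c v0 > 0"
proof -
  have "((\<lambda>v. (gap v - gap v0) / (v - v0)) \<longlongrightarrow> - 2 * c v0 * deriv c v0) (at v0)"
    using DERIV_gap[of v0] by (simp add: has_field_derivative_iff)
  then have "((\<lambda>v. deriv c v0 * ((gap v - gap v0) / (v - v0))) \<longlongrightarrow> deriv c v0 * (- 2 * c v0 * deriv c v0)) (at v0)"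
    by (intro tendsto_intros)
  moreover have "deriv c v0 * (- 2 * c v0 * deriv c v0) < 0"
    using assms(2) c_pos[of v0] by (simp add: zero_less_mult_iff mult_less_0_iff) (metis linorder_neqE_linordered_idom)
  ultimately have "\<forall>\<^sub>F v in at v0. deriv c v0 * ((gap v - gap v0) / (v - v0)) < 0" by (rule order_tendstoD(2))
  then obtain e1 where e1: "e1 > 0" "\<And>v. v \<noteq> v0 \<Longrightarrow> \<bar>v - v0\<bar> < e1 \<Longrightarrow> deriv c v0 * (gap v / (v - v0)) < 0"
    using assms(1) by (auto simp: eventually_at dist_real_def)
  have 1: "gap v * deriv c v0 * (v - v0) < 0" if "\<bar>v - v0\<bar> < e1" "v \<noteq> v0" for v
  proof -
    have "gap v * deriv c v0 * (v - v0) = deriv c v0 * (gap v / (v - v0)) * (v - v0)\<^sup>2"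
      using that by (simp add: power2_eq_square)
    also have "\<dots> < 0" using mult_neg_pos[OF e1(2)[OF that(2,1)], of "(v - v0)\<^sup>2"] that(2) by simp
    finally show ?thesis .
  qed
  have "(deriv c \<longlongrightarrow> deriv c v0) (nhds v0)"
    using DERIV_isCont[OF DERIV_deriv_c, of v0] by (simp add: isCont_def tendsto_at_iff_tendsto_nhds)
  then have "((\<lambda>v. deriv c v * deriv c v0) \<longlongrightarrow> deriv c v0 * deriv c v0) (nhds v0)" by (intro tendsto_intros)
  moreover have "0 < deriv c v0 * deriv c v0" using assms(2) by (simp add: zero_less_mult_iff) (metis linorder_neqE_linordered_idom)
  ultimately have "\<forall>\<^sub>F v in nhds v0. 0 < deriv c v * deriv c v0" by (rule order_tendstoD(1))
  then obtain e2 where e2: "e2 > 0" "\<And>v. \<bar>v - v0\<bar> < e2 \<Longrightarrow> deriv c v * deriv c v0 > 0"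
    by (auto simp: eventually_nhds_metric dist_real_def)
  show ?thesis using e1(1) e2 1 by (intro exI[of _ "min e1 e2"]) auto
qed

text \<open>The hypothesis on segments says that \<open>J\<close> is an interval adjacent to \<open>p\<close>, on either side. In the silent case \<open>gap\<close>
  would vanish between \<open>w p\<close> and any other value of \<open>w\<close>, but its zero \<open>w p\<close> is isolated. In the other case
  \<open>w\<^sub>\<xi>\<^sub>\<xi> = c c' w\<^sub>\<xi>\<^sup>2 / gap\<close> has the sign of \<open>- (w - w p)\<close>, and \<open>w - w p\<close> has the sign of \<open>\<kappa> (\<eta> - p)\<close>.\<close>

lemma sonic_side:
  assumes cw: "continuous_on UNIV w" and loc: "local_classical_wave c s w J"
    and seg: "\<And>\<xi>. \<xi> \<in> J \<Longrightarrow> open_segment p \<xi> \<subseteq> J"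
    and gap0: "gap (w p) = 0" and c'0: "deriv c (w p) \<noteq> 0"
    and near: "\<And>\<xi>. \<xi> \<in> J \<Longrightarrow> w \<xi> \<noteq> w p \<Longrightarrow> gap (w \<xi>) * deriv c (w p) * (w \<xi> - w p) < 0"
      "\<And>\<xi>. \<xi> \<in> J \<Longrightarrow> deriv c (w \<xi>) * deriv c (w p) > 0"
  shows "(\<forall>\<eta>\<in>J. w \<eta> = w p) \<or>
    (\<exists>\<kappa>. \<kappa> \<noteq> 0 \<and> (\<forall>\<eta>\<in>J. gap (w \<eta>) \<noteq> 0 \<and> deriv w \<eta> = \<kappa> / sqrt \<bar>gap (w \<eta>)\<bar> \<and> deriv (deriv w) \<eta> * (\<kappa> * (\<eta> - p)) < 0))"
  using local_wave_dichotomy[OF loc]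
proof (elim disjE)
  assume k: "\<forall>\<xi>\<in>J. gap (w \<xi>) * deriv w \<xi> = 0"
  have "w \<eta> = w p" if "\<eta> \<in> J" for \<eta>
  proof (rule ccontr)
    assume ne: "w \<eta> \<noteq> w p"
    have g0: "gap v = 0" if "v \<in> open_segment (w p) (w \<eta>)" for v
      using silent_side[OF cw loc seg[OF \<open>\<eta> \<in> J\<close>] _ that] k by blast
    obtain e where e: "e > 0" "\<And>v. \<bar>v - w p\<bar> < e \<Longrightarrow> v \<noteq> w p \<Longrightarrow> gap v * deriv c (w p) * (v - w p) < 0"
      "\<And>v. \<bar>v - w p\<bar> < e \<Longrightarrow> deriv c v * deriv c (w p) > 0"
      using gap_near_regular_zero[OF gap0 c'0] by auto
    \<comment> \<open>A point of the segment that is close enough to \<open>w p\<close>.\<close>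
    define t where "t = min (1 / 2) (e / (2 * \<bar>w \<eta> - w p\<bar>))"
    have t: "0 < t" "t < 1" using e(1) ne by (auto simp: t_def)
    define v where "v = (1 - t) * w p + t * w \<eta>"
    have vs: "v \<in> open_segment (w p) (w \<eta>)" using t ne by (auto simp: v_def in_segment)
    have vw: "v - w p = t * (w \<eta> - w p)" by (simp add: v_def algebra_simps)
    have "t * \<bar>w \<eta> - w p\<bar> \<le> e / 2"
      using ne mult_right_mono[of t "e / (2 * \<bar>w \<eta> - w p\<bar>)" "\<bar>w \<eta> - w p\<bar>"] by (simp add: t_def)
    then have "\<bar>v - w p\<bar> < e" using vw t e(1) by (simp add: abs_mult)
    moreover have "v \<noteq> w p" using vw t ne by auto
    ultimately show False using e(2)[of v] g0[OF vs] by simp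
  qed
  then show ?thesis by blast
next
  assume r: "\<forall>\<xi>\<in>J. gap (w \<xi>) \<noteq> 0 \<and> deriv w \<xi> \<noteq> 0"
  show ?thesis
  proof (cases "J = {}")
    case False
    obtain \<kappa> where \<kappa>: "\<And>\<xi>. \<xi> \<in> J \<Longrightarrow> deriv w \<xi> = \<kappa> / sqrt \<bar>gap (w \<xi>)\<bar>"
    proof (rule local_wave_normal_form[OF loc])
      show "gap (w \<xi>) \<noteq> 0" if "\<xi> \<in> J" for \<xi> using r that by blast
    qed blast
    have "\<kappa> \<noteq> 0" using False \<kappa> r by fastforce
    moreover have "deriv (deriv w) \<eta> * (\<kappa> * (\<eta> - p)) < 0" if \<eta>: "\<eta> \<in> J" for \<eta>
    proof -
      have "\<eta> \<noteq> p" using r \<eta> gap0 by auto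
      then obtain z where z: "z \<in> open_segment p \<eta>" "w \<eta> - w p = (\<eta> - p) * deriv w z"
        using mean_value_from_endpoint[OF cw, of p \<eta> "deriv w"] local_waveD(1)[OF loc] seg[OF \<eta>] by blast
      then have "z \<in> J" using seg[OF \<eta>] by blast
      define q where "q = sqrt \<bar>gap (w z)\<bar>"
      have "q > 0" using r \<open>z \<in> J\<close> by (simp add: q_def)
      have wq: "(w \<eta> - w p) * q = \<kappa> * (\<eta> - p)"
        using z(2) \<kappa>[OF \<open>z \<in> J\<close>] \<open>q > 0\<close> by (simp add: q_def[symmetric])
      let ?g = "gap (w \<eta>)" and ?d = "deriv c (w \<eta>)" and ?e = "deriv c (w p)"
      have ne: "w \<eta> \<noteq> w p" using r \<eta> gap0 by auto
      note n1 = near(1)[OF \<eta> ne] and n2 = near(2)[OF \<eta>]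
      \<comment> \<open>Multiplication by a square removes the division by \<open>gap\<close> from the sign argument.\<close>
      have "deriv (deriv w) \<eta> * (w \<eta> - w p) * (?g * ?g * ?e * ?e)
        = (?g * deriv (deriv w) \<eta>) * ?e * (?g * ?e * (w \<eta> - w p))" by (simp add: mult_ac)
      also have "\<dots> = c (w \<eta>) * (deriv w \<eta>)\<^sup>2 * (?d * ?e) * (?g * ?e * (w \<eta> - w p))"
        unfolding local_waveD(3)[OF loc \<eta>] by (simp add: mult_ac)
      also have "\<dots> < 0"
      proof (rule mult_pos_neg[OF mult_pos_pos[OF mult_pos_pos n2] n1])
        show "0 < (deriv w \<eta>)\<^sup>2" using r \<eta> by simp
      qed (rule c_pos)
      finally have "deriv (deriv w) \<eta> * (w \<eta> - w p) * ((?g * ?e)\<^sup>2) < 0" by (simp add: power2_eq_square mult_ac)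
      then have "deriv (deriv w) \<eta> * (w \<eta> - w p) < 0" by (simp add: mult_less_0_iff not_less)
      then have "deriv (deriv w) \<eta> * (w \<eta> - w p) * q < 0" using \<open>q > 0\<close> by (rule mult_neg_pos)
      then show ?thesis by (simp add: mult.assoc wq)
    qed
    ultimately show ?thesis using \<kappa> r by blast
  qed auto
qed

lemma unbounded_slope:
  assumes wc: "isCont w p" and gap0: "gap (w p) = 0" and k: "\<kappa> \<noteq> 0" and "p islimpt J"
    and J: "\<And>\<eta>. \<eta> \<in> J \<Longrightarrow> gap (w \<eta>) \<noteq> 0 \<and> deriv w \<eta> = \<kappa> / sqrt \<bar>gap (w \<eta>)\<bar>"
  shows "\<not> bounded (deriv w ` J)"
proof
  assume "bounded (deriv w ` J)"
  then obtain B where B: "\<And>\<eta>. \<eta> \<in> J \<Longrightarrow> \<bar>deriv w \<eta>\<bar> \<le> B" by (auto simp: bounded_iff)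
  define q where "q \<eta> = sqrt \<bar>gap (w \<eta>)\<bar>" for \<eta>
  have "isCont q p" unfolding q_def
    by (intro continuous_intros isCont_o2[OF wc DERIV_isCont[OF DERIV_gap]])
  then have "(q \<longlongrightarrow> 0) (at p within J)"
    using gap0 by (auto simp: isCont_def q_def intro: tendsto_within_subset)
  moreover have "0 < \<bar>\<kappa>\<bar> / (\<bar>B\<bar> + 1)" using k by simp
  ultimately have "\<forall>\<^sub>F \<eta> in at p within J. q \<eta> < \<bar>\<kappa>\<bar> / (\<bar>B\<bar> + 1)" by (rule order_tendstoD(2))
  moreover have "\<forall>\<^sub>F \<eta> in at p within J. \<eta> \<in> J" by (simp add: eventually_at_filter)
  ultimately have "\<forall>\<^sub>F \<eta> in at p within J. q \<eta> < \<bar>\<kappa>\<bar> / (\<bar>B\<bar> + 1) \<and> \<eta> \<in> J" by eventually_elim simp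
  moreover have "at p within J \<noteq> bot" using \<open>p islimpt J\<close> by (simp add: trivial_limit_within)
  ultimately obtain \<eta> where \<eta>: "q \<eta> < \<bar>\<kappa>\<bar> / (\<bar>B\<bar> + 1)" "\<eta> \<in> J"
    using eventually_happens by blast
  have "q \<eta> > 0" using J[OF \<eta>(2)] by (simp add: q_def)
  then have "\<bar>B\<bar> + 1 < \<bar>\<kappa>\<bar> / q \<eta>" using \<eta>(1) by (simp add: field_simps)
  also have "\<dots> = \<bar>deriv w \<eta>\<bar>" using J[OF \<eta>(2)] \<open>q \<eta> > 0\<close> by (simp add: q_def abs_divide)
  finally show False using B[OF \<eta>(2)] by linarith
qed

text \<open>Each side is constant or strictly monotone with \<open>w\<^sub>\<xi>\<^sub>\<xi>\<close> of the sign of \<open>w\<^sub>\<xi>\<close> on the left and of \<open>- w\<^sub>\<xi>\<close> on the right. Slopes of the same sign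
  therefore give curvatures of opposite signs, hence an inflection point, and slopes of opposite signs give curvatures
  of the same sign, hence a cusp.\<close>

lemma regular_sonic_point:
  assumes comp: "composed_of_local_waves c s w" and gap0: "gap (w p) = 0" and c'0: "deriv c (w p) \<noteq> 0"
  shows "constant_near w p \<or> singularity w p \<and>
      (\<exists>\<epsilon>>0. local_classical_wave c s w {p - \<epsilon><..<p} \<and> monotone_wave_on {p - \<epsilon><..p} w \<and>
             local_classical_wave c s w {p<..<p + \<epsilon>} \<and> monotone_wave_on {p..<p + \<epsilon>} w \<and>
             (same_sign_scenario w p \<epsilon> \<or> opposite_sign_scenario w p \<epsilon> \<or> one_sided_constant_scenario w p \<epsilon>))"
proof -
  have cw: "continuous_on UNIV w" using comp by (simp add: composed_of_local_waves_def)
  then have wc: "isCont w \<eta>" for \<eta> by (simp add: continuous_on_eq_continuous_at)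
  obtain \<epsilon>0 where e0: "\<epsilon>0 > 0" "local_classical_wave c s w {p - \<epsilon>0<..<p}" "local_classical_wave c s w {p<..<p + \<epsilon>0}"
    using composed_sides[OF comp, of p] by blast
  obtain e where e: "e > 0" "\<And>v. \<bar>v - w p\<bar> < e \<Longrightarrow> v \<noteq> w p \<Longrightarrow> gap v * deriv c (w p) * (v - w p) < 0"
    "\<And>v. \<bar>v - w p\<bar> < e \<Longrightarrow> deriv c v * deriv c (w p) > 0"
    using gap_near_regular_zero[OF gap0 c'0] by auto
  obtain \<delta> where \<delta>: "\<delta> > 0" "\<And>\<eta>. \<bar>\<eta> - p\<bar> < \<delta> \<Longrightarrow> \<bar>w \<eta> - w p\<bar> < e"
    using wc[of p] e(1) unfolding continuous_at_eps_delta dist_real_def by meson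
  define \<epsilon> where "\<epsilon> = min \<epsilon>0 \<delta>"
  have \<epsilon>: "\<epsilon> > 0" "\<epsilon> \<le> \<epsilon>0" "\<epsilon> \<le> \<delta>" using e0(1) \<delta>(1) by (auto simp: \<epsilon>_def)
  define L R where "L = {p - \<epsilon><..<p}" and "R = {p<..<p + \<epsilon>}"
  have locL: "local_classical_wave c s w L" unfolding L_def by (rule local_wave_subset[OF e0(2)]) (use \<epsilon> in auto)
  have locR: "local_classical_wave c s w R" unfolding R_def by (rule local_wave_subset[OF e0(3)]) (use \<epsilon> in auto)
  have close: "\<bar>w \<eta> - w p\<bar> < e" if "\<eta> \<in> L \<union> R" for \<eta>
    using that \<epsilon> by (intro \<delta>(2)) (auto simp: L_def R_def)
  define reg where "reg J \<kappa> \<longleftrightarrow> \<kappa> \<noteq> 0 \<and> (\<forall>\<eta>\<in>J. gap (w \<eta>) \<noteq> 0 \<and> deriv w \<eta> = \<kappa> / sqrt \<bar>gap (w \<eta>)\<bar> \<and> deriv (deriv w) \<eta> * (\<kappa> * (\<eta> - p)) < 0)" for J \<kappa>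
  have sideL: "(\<forall>\<eta>\<in>L. w \<eta> = w p) \<or> (\<exists>\<kappa>. reg L \<kappa>)" unfolding reg_def
    by (rule sonic_side[OF cw locL _ gap0 c'0])
      (use close e in \<open>auto simp: L_def open_segment_eq_real_ivl split: if_splits\<close>)
  have sideR: "(\<forall>\<eta>\<in>R. w \<eta> = w p) \<or> (\<exists>\<kappa>. reg R \<kappa>)" unfolding reg_def
    by (rule sonic_side[OF cw locR _ gap0 c'0])
      (use close e in \<open>auto simp: R_def open_segment_eq_real_ivl split: if_splits\<close>)
  have sgnd: "deriv w \<eta> * \<kappa> > 0" if "reg J \<kappa>" "\<eta> \<in> J" for J \<kappa> \<eta>
  proof -
    have "deriv w \<eta> * \<kappa> = \<kappa>\<^sup>2 / sqrt \<bar>gap (w \<eta>)\<bar>" using that by (simp add: reg_def power2_eq_square)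
    then show ?thesis using that by (auto simp: reg_def)
  qed
  have iL: "interior {p - \<epsilon><..p} \<subseteq> L" and iR: "interior {p..<p + \<epsilon>} \<subseteq> R"
    using interior_mono[of "{p - \<epsilon><..p}" "{p - \<epsilon>..p}"] interior_mono[of "{p..<p + \<epsilon>}" "{p..p + \<epsilon>}"]
    by (auto simp: L_def R_def)
  have mL: "strictly_monotone_wave_on {p - \<epsilon><..p} w" if "(\<forall>\<eta>\<in>L. deriv w \<eta> > 0) \<or> (\<forall>\<eta>\<in>L. deriv w \<eta> < 0)"
    using iL that local_waveD(1)[OF locL]
    by (intro strictly_monotone_on_intervalI[where d = "deriv w"] continuous_on_subset[OF cw]) auto
  have mR: "strictly_monotone_wave_on {p..<p + \<epsilon>} w" if "(\<forall>\<eta>\<in>R. deriv w \<eta> > 0) \<or> (\<forall>\<eta>\<in>R. deriv w \<eta> < 0)"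
    using iR that local_waveD(1)[OF locR]
    by (intro strictly_monotone_on_intervalI[where d = "deriv w"] continuous_on_subset[OF cw]) auto
  have L1: "(\<forall>\<eta>\<in>L. deriv w \<eta> > 0) \<and> (\<forall>\<eta>\<in>L. deriv (deriv w) \<eta> > 0)
      \<or> (\<forall>\<eta>\<in>L. deriv w \<eta> < 0) \<and> (\<forall>\<eta>\<in>L. deriv (deriv w) \<eta> < 0)" if "reg L \<kappa>" for \<kappa>
  proof -
    have "0 < deriv w \<eta> * \<kappa>" "0 < deriv (deriv w) \<eta> * \<kappa>" if "\<eta> \<in> L" for \<eta>
      using sgnd[OF \<open>reg L \<kappa>\<close> that] \<open>reg L \<kappa>\<close> that
      by (auto simp: reg_def L_def mult_less_0_iff zero_less_mult_iff)
    then show ?thesis by (cases "\<kappa> > 0") (auto simp: zero_less_mult_iff)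
  qed
  have R1: "(\<forall>\<eta>\<in>R. deriv w \<eta> > 0) \<and> (\<forall>\<eta>\<in>R. deriv (deriv w) \<eta> < 0)
      \<or> (\<forall>\<eta>\<in>R. deriv w \<eta> < 0) \<and> (\<forall>\<eta>\<in>R. deriv (deriv w) \<eta> > 0)" if "reg R \<kappa>" for \<kappa>
  proof -
    have "0 < deriv w \<eta> * \<kappa>" "deriv (deriv w) \<eta> * \<kappa> < 0" if "\<eta> \<in> R" for \<eta>
      using sgnd[OF \<open>reg R \<kappa>\<close> that] \<open>reg R \<kappa>\<close> that
      by (auto simp: reg_def R_def mult_less_0_iff zero_less_mult_iff)
    then show ?thesis by (cases "\<kappa> > 0") (auto simp: zero_less_mult_iff mult_less_0_iff)
  qed
  have sing: "singularity w p" if "reg L \<kappa> \<or> reg R \<kappa>" for \<kappa>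
    unfolding singularity_def
  proof (intro conjI allI impI notI wc)
    fix e :: real assume "e > 0" and b: "bounded (deriv w ` ({p - e<..<p + e} - {p}))"
    define JL JR where "JL = {p - min \<epsilon> e<..<p}" and "JR = {p<..<p + min \<epsilon> e}"
    have sub: "JL \<subseteq> {p - e<..<p + e} - {p}" "JR \<subseteq> {p - e<..<p + e} - {p}" "JL \<subseteq> L" "JR \<subseteq> R"
      using \<epsilon>(1) \<open>e > 0\<close> by (auto simp: JL_def JR_def L_def R_def)
    have lim: "p islimpt JL" "p islimpt JR" unfolding JL_def JR_def
      using \<epsilon>(1) \<open>e > 0\<close> by (auto intro: islimpt_greaterThanLessThan1 islimpt_greaterThanLessThan2)
    have "bounded (deriv w ` JL)" "bounded (deriv w ` JR)"
      using sub(1,2) by (auto intro!: bounded_subset[OF b] image_mono)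
    then show False
      using that unbounded_slope[OF wc gap0 _ lim(1), of \<kappa>] unbounded_slope[OF wc gap0 _ lim(2), of \<kappa>] sub(3,4)
      unfolding reg_def by blast
  qed
  have convL: "convex_on L w" if "\<forall>\<eta>\<in>L. deriv (deriv w) \<eta> > 0"
    using that local_waveD(1,2)[OF locL]
    by (intro f''_ge0_imp_convex[of L w "deriv w" "deriv (deriv w)"]) (auto simp: L_def less_imp_le)
  have convR: "convex_on R w" if "\<forall>\<eta>\<in>R. deriv (deriv w) \<eta> > 0"
    using that local_waveD(1,2)[OF locR]
    by (intro f''_ge0_imp_convex[of R w "deriv w" "deriv (deriv w)"]) (auto simp: R_def less_imp_le)
  have concL: "concave_on L w" if "\<forall>\<eta>\<in>L. deriv (deriv w) \<eta> < 0"
    using that local_waveD(1,2)[OF locL]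
    by (intro f''_le0_imp_concave[of L w "deriv w" "deriv (deriv w)"]) (auto simp: L_def less_imp_le)
  have concR: "concave_on R w" if "\<forall>\<eta>\<in>R. deriv (deriv w) \<eta> < 0"
    using that local_waveD(1,2)[OF locR]
    by (intro f''_le0_imp_concave[of R w "deriv w" "deriv (deriv w)"]) (auto simp: R_def less_imp_le)
  have evLR: "\<forall>\<^sub>F \<eta> in at_left p. \<eta> \<in> L" "\<forall>\<^sub>F \<eta> in at_right p. \<eta> \<in> R"
    unfolding L_def R_def using \<epsilon>(1) by (auto intro: eventually_at_leftI eventually_at_rightI)
  have eL: "\<forall>\<^sub>F \<eta> in at_left p. P \<eta>" if "\<forall>\<eta>\<in>L. P \<eta>" for P
    using evLR(1) by eventually_elim (use that in blast)
  have eR: "\<forall>\<^sub>F \<eta> in at_right p. P \<eta>" if "\<forall>\<eta>\<in>R. P \<eta>" for P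
    using evLR(2) by eventually_elim (use that in blast)
  have infl: "inflection_point w p"
    if "(\<forall>\<eta>\<in>L. deriv (deriv w) \<eta> > 0) \<and> (\<forall>\<eta>\<in>R. deriv (deriv w) \<eta> < 0) \<or> (\<forall>\<eta>\<in>L. deriv (deriv w) \<eta> < 0) \<and> (\<forall>\<eta>\<in>R. deriv (deriv w) \<eta> > 0)"
    unfolding inflection_point_def
  proof (intro conjI wc)
    have "\<forall>\<^sub>F \<eta> in at p. \<eta> \<in> L \<union> R" using evLR by (auto simp: eventually_at_split elim: eventually_mono)
    then show "\<forall>\<^sub>F \<eta> in at p. w differentiable at \<eta> \<and> deriv w differentiable at \<eta>"
    proof (rule eventually_mono)
      fix \<eta> assume "\<eta> \<in> L \<union> R"
      then show "w differentiable at \<eta> \<and> deriv w differentiable at \<eta>"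
        using local_waveD(1,2)[OF locL, of \<eta>] local_waveD(1,2)[OF locR, of \<eta>]
        unfolding real_differentiable_def by blast
    qed
    show "changes_sign (deriv (deriv w)) p"
      using that
    proof (elim disjE conjE)
      assume "\<forall>\<eta>\<in>L. deriv (deriv w) \<eta> > 0" "\<forall>\<eta>\<in>R. deriv (deriv w) \<eta> < 0"
      from eL[OF this(1)] eR[OF this(2)] show ?thesis unfolding changes_sign_def by blast
    next
      assume "\<forall>\<eta>\<in>L. deriv (deriv w) \<eta> < 0" "\<forall>\<eta>\<in>R. deriv (deriv w) \<eta> > 0"
      from eL[OF this(1)] eR[OF this(2)] show ?thesis unfolding changes_sign_def by blast
    qed
  qed
  have cusp: "cusp_singularity w p" if "singularity w p"
  proof -
    have "w ` {p - \<epsilon><..<p + \<epsilon>} \<subseteq> {w p - e..w p + e}"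
    proof (rule image_subsetI)
      fix \<eta> assume "\<eta> \<in> {p - \<epsilon><..<p + \<epsilon>}"
      then have "\<bar>w \<eta> - w p\<bar> < e" using \<epsilon>(3) by (intro \<delta>(2)) auto
      then show "w \<eta> \<in> {w p - e..w p + e}" by auto
    qed
    then have "bounded (w ` {p - \<epsilon><..<p + \<epsilon>})" by (rule bounded_subset[OF bounded_closed_interval])
    then show ?thesis using that \<epsilon>(1) by (auto simp: cusp_singularity_def)
  qed
  consider (cc) "\<forall>\<eta>\<in>L. w \<eta> = w p" "\<forall>\<eta>\<in>R. w \<eta> = w p" | (cr) \<kappa> where "\<forall>\<eta>\<in>L. w \<eta> = w p" "reg R \<kappa>"
    | (rc) \<kappa> where "reg L \<kappa>" "\<forall>\<eta>\<in>R. w \<eta> = w p" | (rr) \<kappa> \<kappa>' where "reg L \<kappa>" "reg R \<kappa>'"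
    using sideL sideR by blast
  then show ?thesis
  proof cases
    case cc
    have eq: "w \<eta> = w p" if "\<eta> \<in> {p - \<epsilon><..<p + \<epsilon>}" for \<eta>
      using cc that by (cases \<eta> p rule: linorder_cases) (auto simp: L_def R_def)
    have "\<forall>\<^sub>F \<eta> in nhds p. \<eta> \<in> {p - \<epsilon><..<p + \<epsilon>}"
      by (rule eventually_nhds_in_open) (use \<epsilon>(1) in auto)
    then have "constant_near w p" unfolding constant_near_def by (rule eventually_mono) (rule eq)
    then show ?thesis ..
  next
    case cr
    have c: "\<forall>\<eta>\<in>{p - \<epsilon><..p}. w \<eta> = w p" using cr(1) by (auto simp: L_def order_le_less)
    have m: "strictly_monotone_wave_on {p..<p + \<epsilon>} w" using mR R1[OF cr(2)] by blast
    have "monotone_wave_on {p - \<epsilon><..p} w" using c by (rule constant_imp_monotone)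
    then show ?thesis using c m sing[of \<kappa>] cr(2) \<epsilon>(1) locL locR strictly_monotone_imp_monotone[OF m]
      unfolding one_sided_constant_scenario_def L_def R_def by blast
  next
    case rc
    have c: "\<forall>\<eta>\<in>{p..<p + \<epsilon>}. w \<eta> = w p" using rc(2) by (auto simp: R_def order_le_less)
    have m: "strictly_monotone_wave_on {p - \<epsilon><..p} w" using mL L1[OF rc(1)] by blast
    have "monotone_wave_on {p..<p + \<epsilon>} w" using c by (rule constant_imp_monotone)
    then show ?thesis using c m sing[of \<kappa>] rc(1) \<epsilon>(1) locL locR strictly_monotone_imp_monotone[OF m]
      unfolding one_sided_constant_scenario_def L_def R_def by blast
  next
    case rr
    have mm: "strictly_monotone_wave_on {p - \<epsilon><..p} w" "strictly_monotone_wave_on {p..<p + \<epsilon>} w"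
      using mL mR L1[OF rr(1)] R1[OF rr(2)] by blast+
    have si: "singularity w p" using sing rr by blast
    have "same_sign_scenario w p \<epsilon> \<or> opposite_sign_scenario w p \<epsilon>"
      unfolding same_sign_scenario_def opposite_sign_scenario_def L_def[symmetric] R_def[symmetric]
      using L1[OF rr(1)] R1[OF rr(2)] infl cusp[OF si] convL convR concL concR by blast
    then show ?thesis
      using si \<epsilon>(1) locL locR mm[THEN strictly_monotone_imp_monotone] unfolding L_def R_def by blast
  qed
qed

section \<open>Degenerate sonic values\<close>

text \<open>Otherwise \<open>w\<^sub>\<xi> = \<kappa> / sqrt \<bar>gap(w)\<bar>\<close> with \<open>\<kappa> \<noteq> 0\<close>, and \<open>\<bar>\<kappa>\<bar> \<le> C \<bar>w\<^sub>\<xi>\<bar> \<bar>w - w p\<bar>\<close>. The derivative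
  \<open>2 w\<^sub>\<xi> / (w - w p)\<close> of \<open>ln ((w - w p)\<^sup>2)\<close> is then at most \<open>(2 C / \<bar>\<kappa>\<bar>) w\<^sub>\<xi>\<^sup>2\<close> in absolute value, so the
  logarithm stays bounded up to \<open>p\<close>, where it should tend to \<open>-\<infinity>\<close>.\<close>

lemma degenerate_side:
  assumes cw: "continuous_on UNIV w" and wd: "weak_deriv UNIV 1 w g" and g: "L2_loc g"
    and loc: "local_classical_wave c s w J" and seg: "\<And>\<xi>. \<xi> \<in> J \<Longrightarrow> open_segment p \<xi> \<subseteq> J"
    and C: "C > 0" "\<And>v. \<bar>gap v\<bar> \<le> C\<^sup>2 * (v - w p)\<^sup>2" and \<xi>: "\<xi> \<in> J"
  shows "gap (w \<xi>) * deriv w \<xi> = 0"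
proof (rule ccontr)
  assume "gap (w \<xi>) * deriv w \<xi> \<noteq> 0"
  with local_wave_dichotomy[OF loc] \<xi> have r: "\<And>\<eta>. \<eta> \<in> J \<Longrightarrow> gap (w \<eta>) \<noteq> 0 \<and> deriv w \<eta> \<noteq> 0" by blast
  obtain \<kappa> where \<kappa>: "\<And>\<eta>. \<eta> \<in> J \<Longrightarrow> deriv w \<eta> = \<kappa> / sqrt \<bar>gap (w \<eta>)\<bar>"
  proof (rule local_wave_normal_form[OF loc])
    show "gap (w \<xi>) \<noteq> 0" if "\<xi> \<in> J" for \<xi> using r that by blast
  qed blast
  have k: "\<kappa> \<noteq> 0" using r[OF \<xi>] \<kappa>[OF \<xi>] by auto
  have ne: "w \<eta> \<noteq> w p" if "\<eta> \<in> J" for \<eta> using r[OF that] C(2)[of "w \<eta>"] by auto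
  have low: "\<bar>\<kappa>\<bar> \<le> C * \<bar>deriv w \<eta>\<bar> * \<bar>w \<eta> - w p\<bar>" if "\<eta> \<in> J" for \<eta>
  proof -
    have "sqrt \<bar>gap (w \<eta>)\<bar> \<le> sqrt (C\<^sup>2 * (w \<eta> - w p)\<^sup>2)" using C(2) by simp
    also have "\<dots> = C * \<bar>w \<eta> - w p\<bar>" using C(1) by (simp add: real_sqrt_mult)
    finally have "sqrt \<bar>gap (w \<eta>)\<bar> * \<bar>deriv w \<eta>\<bar> \<le> C * \<bar>w \<eta> - w p\<bar> * \<bar>deriv w \<eta>\<bar>"
      by (rule mult_right_mono) simp
    moreover have "sqrt \<bar>gap (w \<eta>)\<bar> * \<bar>deriv w \<eta>\<bar> = \<bar>\<kappa>\<bar>" using r[OF that] \<kappa>[OF that] by (simp add: abs_divide)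
    ultimately show ?thesis by (simp add: mult_ac)
  qed
  define K where "K = closed_segment p \<xi>"
  define M where "M = (2 * C / \<bar>\<kappa>\<bar>) * (LINT x:K|lborel. (g x)\<^sup>2)"
  have gK: "set_integrable lborel K (\<lambda>x. (g x)\<^sup>2)" using g by (auto simp: L2_loc_def K_def)
  have openJ: "open J" using loc by (simp add: local_classical_wave_def)
  have ae: "AE x in lborel. x \<in> J \<longrightarrow> g x = deriv w x"
    using weak_deriv_eq_classical[OF wd L2_loc_imp_locally_integrable(1)[OF g] openJ local_waveD(1)[OF loc]
        local_wave_continuous_deriv[OF loc]] by blast
  have bound: "\<bar>ln ((w b - w p)\<^sup>2) - ln ((w a - w p)\<^sup>2)\<bar> \<le> M" if ab: "a \<le> b" "{a..b} \<subseteq> J" "{a..b} \<subseteq> K" for a b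
  proof -
    let ?f' = "\<lambda>x. 2 * deriv w x / (w x - w p)"
    have D: "((\<lambda>x. ln ((w x - w p)\<^sup>2)) has_vector_derivative ?f' x) (at x within {a..b})" if "x \<in> {a..b}" for x
    proof -
      have x: "x \<in> J" using that ab by blast
      have "((\<lambda>x. ln ((w x - w p)\<^sup>2)) has_real_derivative (2 * (w x - w p) * deriv w x) / (w x - w p)\<^sup>2) (at x)"
        using ne[OF x] by (auto intro!: derivative_eq_intros local_waveD(1)[OF loc x] simp: divide_inverse)
      also have "(2 * (w x - w p) * deriv w x) / (w x - w p)\<^sup>2 = ?f' x"
      proof -
        have "w x - w p \<noteq> 0" using ne[OF x] by simp
        moreover have "2 * u * a / u\<^sup>2 = 2 * a / u" if "u \<noteq> 0" for a u :: real
          using that by (simp add: power2_eq_square)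
        ultimately show ?thesis by blast
      qed
      finally show ?thesis
        by (simp add: has_real_derivative_iff_has_vector_derivative has_vector_derivative_at_within)
    qed
    have I: "(?f' has_integral (ln ((w b - w p)\<^sup>2) - ln ((w a - w p)\<^sup>2))) {a..b}"
      by (rule fundamental_theorem_of_calculus[OF ab(1) D])
    have cd: "continuous_on {a..b} (deriv w)" by (rule continuous_on_subset[OF local_wave_continuous_deriv[OF loc] ab(2)])
    let ?h = "\<lambda>x. (2 * C / \<bar>\<kappa>\<bar>) * (deriv w x)\<^sup>2"
    have ch: "continuous_on {a..b} ?h" by (intro continuous_intros cd)
    have "norm (?f' x) \<le> ?h x" if "x \<in> {a..b}" for x
    proof -
      have x: "x \<in> J" using that ab by blast
      have "\<bar>deriv w x\<bar> * \<bar>\<kappa>\<bar> \<le> \<bar>deriv w x\<bar> * (C * \<bar>deriv w x\<bar> * \<bar>w x - w p\<bar>)"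
        using low[OF x] by (intro mult_left_mono) auto
      also have "\<dots> = C * (\<bar>deriv w x\<bar> * \<bar>deriv w x\<bar>) * \<bar>w x - w p\<bar>" by (simp only: mult_ac)
      also have "\<dots> = C * (deriv w x)\<^sup>2 * \<bar>w x - w p\<bar>" by (simp only: abs_mult_self_eq power2_eq_square)
      finally show ?thesis using ne[OF x] k by (simp add: abs_mult abs_divide field_simps)
    qed
    then have "norm (integral {a..b} ?f') \<le> integral {a..b} ?h"
      using I ch by (intro integral_norm_bound_integral integrable_continuous_real has_integral_integrable)
    also have "integral {a..b} ?h = (2 * C / \<bar>\<kappa>\<bar>) * integral {a..b} (\<lambda>x. (deriv w x)\<^sup>2)" by simp
    also have "integral {a..b} (\<lambda>x. (deriv w x)\<^sup>2) = (LINT x:{a..b}|lborel. (deriv w x)\<^sup>2)"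
      by (intro set_borel_integral_eq_integral(2)[symmetric] borel_integrable_atLeastAtMost' continuous_intros cd)
    also have "\<dots> = (LINT x:{a..b}|lborel. (g x)\<^sup>2)"
    proof -
      have "set_integrable lborel {a..b} (\<lambda>x. (deriv w x)\<^sup>2)" "set_integrable lborel {a..b} (\<lambda>x. (g x)\<^sup>2)"
        using g by (auto simp: L2_loc_def intro!: borel_integrable_atLeastAtMost' continuous_intros cd)
      then show ?thesis unfolding set_integrable_def set_lebesgue_integral_def
        using ab(2) by (intro integral_cong_AE borel_measurable_integrable)
          (use ae in \<open>auto elim!: eventually_mono simp: indicator_def\<close>)
    qed
    also have "(LINT x:{a..b}|lborel. (g x)\<^sup>2) \<le> (LINT x:K|lborel. (g x)\<^sup>2)"
    proof -
      have "set_integrable lborel {a..b} (\<lambda>x. (g x)\<^sup>2)" using g by (auto simp: L2_loc_def)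
      then show ?thesis using gK ab(3) unfolding set_integrable_def set_lebesgue_integral_def
        by (intro integral_mono) (auto simp: indicator_def)
    qed
    finally show ?thesis using I C(1) by (simp add: M_def integral_unique mult_left_mono divide_right_mono)
  qed
  have sub: "open_segment p \<xi> \<union> {\<xi>} \<subseteq> J" using seg[OF \<xi>] \<xi> by blast
  have low_ln: "ln ((w \<xi> - w p)\<^sup>2) - M \<le> ln ((w \<eta> - w p)\<^sup>2)" if \<eta>: "\<eta> \<in> open_segment p \<xi>" for \<eta>
  proof (cases "\<eta> \<le> \<xi>")
    case True
    then have "{\<eta>..\<xi>} \<subseteq> open_segment p \<xi> \<union> {\<xi>}" "{\<eta>..\<xi>} \<subseteq> K"
      using \<eta> by (auto simp: K_def open_segment_eq_real_ivl closed_segment_eq_real_ivl split: if_splits)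
    then show ?thesis using bound[OF True] sub by fastforce
  next
    case False
    then have "{\<xi>..\<eta>} \<subseteq> open_segment p \<xi> \<union> {\<xi>}" "{\<xi>..\<eta>} \<subseteq> K"
      using \<eta> by (auto simp: K_def open_segment_eq_real_ivl closed_segment_eq_real_ivl split: if_splits)
    then show ?thesis using bound[of \<xi> \<eta>] False sub by fastforce
  qed
  have "p \<noteq> \<xi>" using ne[OF \<xi>] by auto
  \<comment> \<open>A point \<open>\<eta>\<close> of the segment is chosen so close to \<open>p\<close> that \<open>(w \<eta> - w p)\<^sup>2\<close> lies below the bound that \<open>low_ln\<close> imposes.\<close>
  define m where "m = exp (ln ((w \<xi> - w p)\<^sup>2) - M)"
  have "((\<lambda>\<eta>. (w \<eta> - w p)\<^sup>2) \<longlongrightarrow> (w p - w p)\<^sup>2) (at p)"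
    using cw by (intro tendsto_intros) (auto simp: continuous_on_eq_continuous_at isCont_def)
  then have "\<forall>\<^sub>F \<eta> in at p. (w \<eta> - w p)\<^sup>2 < m"
    by (rule order_tendstoD(2)) (simp add: m_def)
  then obtain d where d: "d > 0" "\<And>\<eta>. \<eta> \<noteq> p \<Longrightarrow> \<bar>\<eta> - p\<bar> < d \<Longrightarrow> (w \<eta> - w p)\<^sup>2 < m"
    by (auto simp: eventually_at dist_real_def)
  define t where "t = min (1 / 2) (d / (2 * \<bar>\<xi> - p\<bar>))"
  have t: "0 < t" "t < 1" using d(1) \<open>p \<noteq> \<xi>\<close> by (auto simp: t_def)
  define \<eta> where "\<eta> = (1 - t) * p + t * \<xi>"
  have \<eta>s: "\<eta> \<in> open_segment p \<xi>" using t \<open>p \<noteq> \<xi>\<close> by (auto simp: \<eta>_def in_segment)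
  have \<eta>p: "\<eta> - p = t * (\<xi> - p)" by (simp add: \<eta>_def algebra_simps)
  have "t * \<bar>\<xi> - p\<bar> \<le> d / 2"
    using \<open>p \<noteq> \<xi>\<close> mult_right_mono[of t "d / (2 * \<bar>\<xi> - p\<bar>)" "\<bar>\<xi> - p\<bar>"] by (simp add: t_def)
  then have "\<bar>\<eta> - p\<bar> < d" using \<eta>p t d(1) by (simp add: abs_mult)
  moreover have "\<eta> \<noteq> p" using \<eta>p t \<open>p \<noteq> \<xi>\<close> by auto
  ultimately have "(w \<eta> - w p)\<^sup>2 < m" using d(2) by blast
  moreover have "0 < (w \<eta> - w p)\<^sup>2" using ne[of \<eta>] \<eta>s sub by auto
  moreover have "0 < m" by (simp add: m_def)
  ultimately have "ln ((w \<eta> - w p)\<^sup>2) < ln m" using ln_less_cancel_iff by blast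
  then show False using low_ln[OF \<eta>s] by (simp add: m_def)
qed

text \<open>\<open>c'\<close> is Lipschitz with constant \<open>K2\<close> and vanishes at \<open>v0\<close>, so \<open>\<bar>c v - c v0\<bar> \<le> K2 (v - v0)\<^sup>2\<close>.\<close>

lemma gap_le_square:
  assumes gap0: "gap v0 = 0" and c'0: "deriv c v0 = 0"
    and K2: "\<And>v. \<bar>deriv (deriv c) v\<bar> \<le> K2" and \<beta>: "\<And>v. c v \<le> \<beta>"
  shows "\<bar>gap v\<bar> \<le> 2 * \<beta> * K2 * (v - v0)\<^sup>2"
proof -
  have lip: "\<bar>deriv c z\<bar> \<le> K2 * \<bar>z - v0\<bar>" for z
    using field_differentiable_bound[of UNIV "deriv c" "deriv (deriv c)" K2 v0 z] DERIV_deriv_c K2 c'0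
    by (simp add: abs_minus_commute)
  have K2': "K2 \<ge> 0" using K2[of 0] by linarith
  have "\<bar>c v - c v0\<bar> \<le> K2 * \<bar>v - v0\<bar> * \<bar>v - v0\<bar>"
  proof -
    have "norm (c v - c v0) \<le> K2 * \<bar>v - v0\<bar> * norm (v - v0)"
    proof (rule field_differentiable_bound[where S = "closed_segment v0 v" and f' = "deriv c"])
      fix z assume z: "z \<in> closed_segment v0 v"
      show "(c has_field_derivative deriv c z) (at z within closed_segment v0 v)"
        using DERIV_c by (rule has_field_derivative_at_within)
      have "\<bar>z - v0\<bar> \<le> \<bar>v - v0\<bar>" using z by (auto simp: closed_segment_eq_real_ivl split: if_splits)
      then show "norm (deriv c z) \<le> K2 * \<bar>v - v0\<bar>"
        using lip[of z] K2' by (auto intro: order_trans mult_left_mono)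
    qed auto
    then show ?thesis by simp
  qed
  then have 1: "\<bar>c v - c v0\<bar> \<le> K2 * (v - v0)\<^sup>2" by (simp add: power2_eq_square mult.assoc flip: abs_mult)
  have s: "s\<^sup>2 = (c v0)\<^sup>2" using gap0 by (simp add: gap_def)
  have "gap v = (c v0)\<^sup>2 - (c v)\<^sup>2" by (simp add: gap_def s)
  also have "\<dots> = (c v0 - c v) * (c v0 + c v)" by (simp add: algebra_simps power2_eq_square)
  finally have "\<bar>gap v\<bar> = \<bar>c v - c v0\<bar> * (c v0 + c v)"
    using c_pos[of v0] c_pos[of v] by (simp add: abs_mult abs_minus_commute)
  also have "\<dots> \<le> K2 * (v - v0)\<^sup>2 * (\<beta> + \<beta>)"
    using 1 \<beta>[of v0] \<beta>[of v] c_pos[of v0] c_pos[of v] K2' by (intro mult_mono add_mono) auto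
  finally show ?thesis by (simp add: algebra_simps)
qed

text \<open>The set where \<open>w = w p\<close> is closed, and it is open because every one of its points is again a degenerate sonic point with
  the same value.\<close>

lemma degenerate_sonic_point:
  assumes comp: "composed_of_local_waves c s w" and glob: "global_traveling_wave c s w"
    and gap0: "gap (w p) = 0" and c'0: "deriv c (w p) = 0"
    and K2: "\<And>v. \<bar>deriv (deriv c) v\<bar> \<le> K2" and \<beta>: "\<And>v. c v \<le> \<beta>"
    and plateau: "\<not> moves_on_plateau c s w"
  shows "w constant_on UNIV"
proof -
  have cw: "continuous_on UNIV w" using comp by (simp add: composed_of_local_waves_def)
  obtain g where g: "weak_deriv UNIV 1 w g" "L2_loc g" using glob by (auto simp: global_traveling_wave_def)
  have pos: "0 < \<beta>" "0 \<le> K2" using \<beta>[of 0] c_pos[of 0] K2[of 0] by linarith+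
  define C where "C = sqrt (2 * \<beta> * K2) + 1"
  have C: "C > 0" unfolding C_def using pos by (intro add_nonneg_pos) auto
  have "2 * \<beta> * K2 = (sqrt (2 * \<beta> * K2))\<^sup>2" using pos by simp
  also have "\<dots> \<le> C\<^sup>2" unfolding C_def using pos by (intro power_mono) auto
  finally have "2 * \<beta> * K2 \<le> C\<^sup>2" .
  then have gC: "\<bar>gap v\<bar> \<le> C\<^sup>2 * (v - w p)\<^sup>2" for v
    using gap_le_square[OF gap0 c'0 K2 \<beta>, of v] by (meson mult_right_mono order_trans zero_le_power2)
  have side: "w \<xi> = w p"
    if q: "w q = w p" and loc: "local_classical_wave c s w J" and seg: "\<And>\<xi>. \<xi> \<in> J \<Longrightarrow> open_segment q \<xi> \<subseteq> J"
      and \<xi>: "\<xi> \<in> J" for q J \<xi>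
  proof (rule ccontr)
    assume ne: "w \<xi> \<noteq> w p"
    have "gap (w \<eta>) * deriv w \<eta> = 0" if "\<eta> \<in> J" for \<eta>
      using degenerate_side[OF cw g loc seg C _ that] gC q by metis
    then have g0: "gap v = 0" if "v \<in> open_segment (w p) (w \<xi>)" for v
      using silent_side[OF cw loc seg[OF \<xi>], of v] that q by metis
    \<comment> \<open>\<open>gap\<close> is known to vanish on an open interval only; its middle third is a compact interval inside.\<close>
    define a b where "a = (2 * min (w p) (w \<xi>) + max (w p) (w \<xi>)) / 3" and "b = (min (w p) (w \<xi>) + 2 * max (w p) (w \<xi>)) / 3"
    have ab: "a < b" using ne by (auto simp: a_def b_def min_def max_def)
    have sub: "{a..b} \<subseteq> open_segment (w p) (w \<xi>)"
      using ne by (auto simp: a_def b_def open_segment_eq_real_ivl min_def max_def split: if_splits)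
    have "connected (range w)" using cw by (intro connected_continuous_image) auto
    then have "closed_segment (w p) (w \<xi>) \<subseteq> range w"
      by (intro closed_segment_subset) (auto simp: is_interval_convex_1 is_interval_connected_1[symmetric])
    then have "{a..b} \<subseteq> range w" using sub segment_open_subset_closed by blast
    moreover have "c v = \<bar>s\<bar>" if "v \<in> {a..b}" for v using g0[of v] that sub gap_eq_0_iff[of v] by auto
    ultimately show False using plateau ab unfolding moves_on_plateau_def by blast
  qed
  define Z where "Z = {\<eta>. w \<eta> = w p}"
  have "closed Z" unfolding Z_def using cw by (intro closed_Collect_eq) auto
  moreover have "open Z" unfolding open_dist
  proof
    fix q assume "q \<in> Z"
    then have q: "w q = w p" by (simp add: Z_def)
    obtain \<epsilon> where \<epsilon>: "\<epsilon> > 0" "local_classical_wave c s w {q - \<epsilon><..<q}" "local_classical_wave c s w {q<..<q + \<epsilon>}"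
      using composed_sides[OF comp, of q] by blast
    have "w y = w p" if "\<bar>y - q\<bar> < \<epsilon>" for y
    proof (cases y q rule: linorder_cases)
      case less
      then show ?thesis using that
        by (intro side[OF q \<epsilon>(2)]) (auto simp: open_segment_eq_real_ivl split: if_splits)
    next
      case greater
      then show ?thesis using that
        by (intro side[OF q \<epsilon>(3)]) (auto simp: open_segment_eq_real_ivl split: if_splits)
    qed (simp add: q)
    then show "\<exists>e>0. \<forall>y. dist y q < e \<longrightarrow> y \<in> Z" using \<epsilon>(1) by (auto simp: Z_def dist_real_def)
  qed
  ultimately have "Z = UNIV" using clopen[of Z] by (auto simp: Z_def)
  then show ?thesis by (auto simp: Z_def constant_on_def)
qed

end

section \<open>Construction of bounded waves\<close>

lemma weak_deriv_shift:
  fixes w g :: "real \<Rightarrow> real"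
  assumes "weak_deriv UNIV 1 w g"
  shows "weak_deriv UNIV 1 (\<lambda>x. w (x - k)) (\<lambda>x. g (x - k))"
  unfolding weak_deriv_def
proof (intro allI impI)
  fix \<psi> :: "real \<Rightarrow> real" assume \<psi>: "test_function UNIV \<psi>"
  define \<psi>k where "\<psi>k = (\<lambda>x. \<psi> (x + k))"
  obtain K where K: "compact K" "\<And>x. x \<notin> K \<Longrightarrow> \<psi> x = 0" using test_functionE[OF \<psi>] by metis
  have t: "test_function UNIV \<psi>k" unfolding test_function_def
  proof (intro conjI allI exI)
    show "Ck_on n UNIV \<psi>k" for n
      using Ck_on_affine[OF test_function_smooth[OF \<psi>, rule_format] bounded_linear_ident, of n k]
      by (simp add: \<psi>k_def add.commute)
    show "compact ((\<lambda>x. x - k) ` K)" by (intro compact_continuous_image continuous_intros K)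
    show "x \<notin> (\<lambda>x. x - k) ` K \<longrightarrow> \<psi>k x = 0" for x
      using K(2)[of "x + k"] by (force simp: \<psi>k_def image_iff)
  qed simp
  have d: "dir_deriv 1 \<psi>k x = dir_deriv 1 \<psi> (x + k)" for x
  proof (rule DERIV_unique[OF test_function_DERIV[OF t]])
    show "(\<psi>k has_real_derivative dir_deriv 1 \<psi> (x + k)) (at x)"
      unfolding \<psi>k_def using test_function_DERIV[OF \<psi>, of "x + k"] by (simp add: DERIV_shift)
  qed
  have tr: "integrable lborel (\<lambda>x. f (x - k) * h x)" "(LINT x|lborel. f (x - k) * h x) = (LINT x|lborel. f x * h (x + k))"
    if "integrable lborel (\<lambda>x. f x * h (x + k))" for f h :: "real \<Rightarrow> real"
    using lborel_integrable_real_affine[OF that, of 1 "- k"]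
      lborel_integral_real_affine[of 1 "\<lambda>x. f x * h (x + k)" "- k"] by simp_all
  show "set_integrable lborel UNIV (\<lambda>x. w (x - k) * dir_deriv 1 \<psi> x) \<and>
        set_integrable lborel UNIV (\<lambda>x. g (x - k) * \<psi> x) \<and>
        (LINT x:UNIV|lborel. w (x - k) * dir_deriv 1 \<psi> x) = - (LINT x:UNIV|lborel. g (x - k) * \<psi> x)"
    using assms[unfolded weak_deriv_def, rule_format, OF t] tr[of w "dir_deriv 1 \<psi>"] tr[of g \<psi>]
    by (simp add: set_integrable_def set_lebesgue_integral_def d) (simp add: \<psi>k_def)
qed

lemma interval_beside_point:
  fixes p :: real
  assumes "is_interval I" "p \<notin> I"
  shows "I \<subseteq> {..<p} \<or> I \<subseteq> {p<..}"
proof (rule ccontr)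
  assume "\<not> ?thesis"
  then obtain x y where "x \<in> I" "y \<in> I" "x \<le> p" "p \<le> y" using assms(2) by (fastforce simp: not_less)
  then show False using mem_is_interval_1_I[OF assms(1), of x y p] assms(2) by blast
qed

text \<open>The difference quotient stays above half of its limit.\<close>

lemma linear_lower_bound_at_zero:
  fixes f :: "real \<Rightarrow> real"
  assumes "(f has_real_derivative D) (at a)" "D \<noteq> 0" "f a = 0"
  shows "\<exists>e>0. \<forall>v. \<bar>v - a\<bar> < e \<longrightarrow> \<bar>D\<bar> / 2 * \<bar>v - a\<bar> \<le> \<bar>f v\<bar>"
proof -
  have "((\<lambda>v. \<bar>(f v - f a) / (v - a)\<bar>) \<longlongrightarrow> \<bar>D\<bar>) (at a)"
    using assms(1) by (intro tendsto_rabs) (simp add: has_field_derivative_iff)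
  then have "\<forall>\<^sub>F v in at a. \<bar>D\<bar> / 2 < \<bar>(f v - f a) / (v - a)\<bar>"
    by (rule order_tendstoD(1)) (use assms(2) in simp)
  then obtain e where e: "e > 0" "\<And>v. v \<noteq> a \<Longrightarrow> \<bar>v - a\<bar> < e \<Longrightarrow> \<bar>D\<bar> / 2 < \<bar>f v / (v - a)\<bar>"
    using assms(3) by (auto simp: eventually_at dist_real_def)
  show ?thesis
  proof (intro exI conjI allI impI, rule e(1))
    fix v assume v: "\<bar>v - a\<bar> < e"
    show "\<bar>D\<bar> / 2 * \<bar>v - a\<bar> \<le> \<bar>f v\<bar>"
    proof (cases "v = a")
      case False
      then show ?thesis using e(2)[OF False v] by (simp add: abs_divide field_simps)
    qed (use assms(3) in simp)
  qed
qed

lemma square_integrable_imp_L2_loc: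
  assumes "g \<in> borel_measurable borel" "integrable lborel (\<lambda>x. (g x)\<^sup>2)"
  shows "L2_loc g"
proof -
  have "set_integrable lborel K (\<lambda>x. (g x)\<^sup>2)" if "compact K" for K
    unfolding set_integrable_def
    using that by (intro integrable_mult_indicator assms(2)) (simp add: borel_compact)
  with assms(1) show ?thesis by (simp add: L2_loc_def)
qed

context wave_speed begin

text \<open>Global square integrability of \<open>g\<close> is what a weak solution requires at each time, beyond a global travelling wave.\<close>

lemma travelling_weak_solution:
  assumes cw: "continuous_on UNIV w" and bw: "bounded (range w)"
    and gm: "g \<in> borel_measurable borel" and gi: "integrable lborel (\<lambda>x. (g x)\<^sup>2)"
    and wg: "weak_deriv UNIV 1 w g"
    and HR: "weak_deriv UNIV 1 (\<lambda>\<xi>. ((c (w \<xi>))\<^sup>2 - s\<^sup>2) * g \<xi>) (\<lambda>\<xi>. c (w \<xi>) * deriv c (w \<xi>) * (g \<xi>)\<^sup>2)"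
  shows "global_traveling_wave c s w" "weak_solution c (\<lambda>t x. w (x - s * t))"
proof -
  have g2: "L2_loc g" by (rule square_integrable_imp_L2_loc[OF gm gi])
  have wf: "weak_form c (\<lambda>t x. w (x - s * t)) (\<lambda>t x. - s * g (x - s * t)) (\<lambda>t x. g (x - s * t))"
    using weak_form_travelling_iff[OF continuous_c continuous_deriv_c cw g2] HR by blast
  show "global_traveling_wave c s w"
    unfolding global_traveling_wave_def using cw wg g2 wf by blast
  have wm: "w \<in> borel_measurable borel" using cw by (rule borel_measurable_continuous_onI)
  obtain B where B: "\<And>x. \<bar>w x\<bar> \<le> B" using bw by (auto simp: bounded_iff)
  have sh: "integrable lborel (\<lambda>x. (g (x - k))\<^sup>2)" for k
    using lborel_integrable_real_affine[OF gi, of 1 "- k"] by simp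
  have "Linfty (\<lambda>x. w (x - s * t)) \<and> L2 (\<lambda>x. - s * g (x - s * t)) \<and> L2 (\<lambda>x. g (x - s * t))
      \<and> weak_deriv UNIV 1 (\<lambda>x. w (x - s * t)) (\<lambda>x. g (x - s * t))" for t
  proof (intro conjI)
    show "Linfty (\<lambda>x. w (x - s * t))" unfolding Linfty_def using wm B by auto
    show "L2 (\<lambda>x. g (x - s * t))" unfolding L2_def using gm sh by auto
    show "L2 (\<lambda>x. - s * g (x - s * t))" unfolding L2_def power_mult_distrib using gm sh by auto
  qed (rule weak_deriv_shift[OF wg])
  then show "weak_solution c (\<lambda>t x. w (x - s * t))"
    unfolding weak_solution_def
    using weak_deriv_travelling[OF locally_integrable_continuous[OF cw] L2_loc_imp_locally_integrable(1)[OF g2] wg, of s] wf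
    by (intro exI[of _ "\<lambda>t x. - s * g (x - s * t)"] exI[of _ "\<lambda>t x. g (x - s * t)"]) auto
qed

lemma constant_local_wave:
  assumes "open I" "is_interval I" "\<And>\<xi>. \<xi> \<in> I \<Longrightarrow> w \<xi> = k"
  shows "local_classical_wave c s w I"
proof (rule local_waveI[OF assms(1,2)])
  show "(w has_real_derivative 0) (at \<xi>)" if "\<xi> \<in> I" for \<xi>
    by (rule has_field_derivative_transform_within_open[OF DERIV_const assms(1) that]) (simp add: assms(3))
  show "((\<lambda>\<xi>. 0) has_real_derivative 0) (at \<xi>)" for \<xi> :: real by simp
qed auto

lemma constant_wave:
  "composed_of_local_waves c s (\<lambda>\<xi>. 0)" "global_traveling_wave c s (\<lambda>\<xi>. 0)" "weak_solution c (\<lambda>t x. 0)"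
proof -
  have 0: "weak_deriv UNIV 1 (\<lambda>\<xi>::real. 0) (\<lambda>\<xi>. 0)"
    by (rule weak_deriv_piecewise[of "{}"]) (auto intro: locally_integrable_continuous)
  show "composed_of_local_waves c s (\<lambda>\<xi>. 0)" unfolding composed_of_local_waves_def
    by (intro conjI exI[of _ "{}"] exI[of _ 1]) (auto intro: constant_local_wave)
  show "global_traveling_wave c s (\<lambda>\<xi>. 0)"
    by (rule travelling_weak_solution(1)[where g = "\<lambda>\<xi>. 0"]) (auto simp: 0)
  show "weak_solution c (\<lambda>t x. 0)"
    using travelling_weak_solution(2)[where g = "\<lambda>\<xi>. 0" and w = "\<lambda>\<xi>. 0"] 0 by simp
qed

text \<open>Near \<open>a\<close> and \<open>b\<close> by the simple zeros of \<open>gap\<close>, and in between by compactness.\<close>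

lemma joinable_gap_lower_bound:
  assumes ab: "a < b" and ga: "gap a = 0" "deriv c a \<noteq> 0" and gb: "gap b = 0" "deriv c b \<noteq> 0"
    and ns: "\<And>v. a < v \<Longrightarrow> v < b \<Longrightarrow> gap v \<noteq> 0"
  obtains m where "m > 0" "\<And>v. a \<le> v \<Longrightarrow> v \<le> b \<Longrightarrow> m * ((v - a) * (b - v)) \<le> \<bar>gap v\<bar>"
proof -
  define Da Db where "Da = \<bar>- 2 * c a * deriv c a\<bar> / 2" and "Db = \<bar>- 2 * c b * deriv c b\<bar> / 2"
  have D: "Da > 0" "Db > 0" using ga gb c_pos[of a] c_pos[of b] by (auto simp: Da_def Db_def)
  have na: "- 2 * c a * deriv c a \<noteq> 0" and nb: "- 2 * c b * deriv c b \<noteq> 0"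
    using D by (auto simp: Da_def Db_def)
  obtain ea where ea: "ea > 0" "\<And>v. \<bar>v - a\<bar> < ea \<Longrightarrow> Da * \<bar>v - a\<bar> \<le> \<bar>gap v\<bar>"
    using linear_lower_bound_at_zero[OF DERIV_gap[of a] na ga(1), folded Da_def] by blast
  obtain eb where eb: "eb > 0" "\<And>v. \<bar>v - b\<bar> < eb \<Longrightarrow> Db * \<bar>v - b\<bar> \<le> \<bar>gap v\<bar>"
    using linear_lower_bound_at_zero[OF DERIV_gap[of b] nb gb(1), folded Db_def] by blast
  define e where "e = min (min ea eb) (b - a) / 3"
  have e: "e > 0" "e < ea" "e < eb" "a + e \<le> b - e"
  proof -
    define M where "M = min (min ea eb) (b - a)"
    have "M > 0" "M \<le> ea" "M \<le> eb" "M \<le> b - a" using ea(1) eb(1) ab by (auto simp: M_def)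
    moreover have "e = M / 3" by (simp add: e_def M_def)
    ultimately show "e > 0" "e < ea" "e < eb" "a + e \<le> b - e" by linarith+
  qed
  have "continuous_on {a + e..b - e} (\<lambda>v. \<bar>gap v\<bar>)"
    by (intro continuous_intros continuous_on_subset[OF continuous_gap]) auto
  from continuous_attains_inf[OF _ _ this] e(4)
  obtain v1 where v1: "v1 \<in> {a + e..b - e}" "\<And>v. v \<in> {a + e..b - e} \<Longrightarrow> \<bar>gap v1\<bar> \<le> \<bar>gap v\<bar>" by auto
  have g1: "\<bar>gap v1\<bar> > 0" using ns[of v1] v1(1) e(1) by auto
  define m where "m = min (min (Da / (b - a)) (Db / (b - a))) (\<bar>gap v1\<bar> / (b - a)\<^sup>2)"
  have m: "m > 0" using D g1 ab by (simp add: m_def)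
  have "m * ((v - a) * (b - v)) \<le> \<bar>gap v\<bar>" if v: "a \<le> v" "v \<le> b" for v
  proof -
    have va: "0 \<le> v - a" "v - a \<le> b - a" "0 \<le> b - v" "b - v \<le> b - a" using v by auto
    consider "v < a + e" | "b - e < v" | "a + e \<le> v" "v \<le> b - e" by linarith
    then show ?thesis
    proof cases
      case 1
      have "m * ((v - a) * (b - v)) \<le> (Da / (b - a)) * ((v - a) * (b - a))"
        using va D ab by (intro mult_mono) (auto simp: m_def)
      also have "\<dots> = Da * \<bar>v - a\<bar>" using ab v by simp
      also have "\<dots> \<le> \<bar>gap v\<bar>" using 1 v e by (intro ea(2)) auto
      finally show ?thesis .
    next
      case 2
      have "m * ((v - a) * (b - v)) \<le> (Db / (b - a)) * ((b - a) * (b - v))"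
        using va D ab by (intro mult_mono) (auto simp: m_def)
      also have "\<dots> = Db * \<bar>v - b\<bar>" using ab v by simp
      also have "\<dots> \<le> \<bar>gap v\<bar>" using 2 v e by (intro eb(2)) auto
      finally show ?thesis .
    next
      case 3
      have "m * ((v - a) * (b - v)) \<le> (\<bar>gap v1\<bar> / (b - a)\<^sup>2) * ((b - a) * (b - a))"
        using va D ab by (intro mult_mono) (auto simp: m_def)
      also have "\<dots> = \<bar>gap v1\<bar>" using ab by (simp add: power2_eq_square)
      also have "\<dots> \<le> \<bar>gap v\<bar>" using 3 by (intro v1(2)) auto
      finally show ?thesis .
    qed
  qed
  with m show ?thesis by (rule that)
qed

text \<open>The profile is the inverse of \<open>X y = \<integral> sqrt \<bar>gap\<bar>\<close> over \<open>[a, y]\<close>, so that \<open>w\<^sub>\<xi> = 1 / sqrt \<bar>gap(w)\<bar>\<close>. Clamping the argument to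
  \<open>[0, L]\<close> continues it by the constants \<open>a\<close> and \<open>b\<close>.\<close>

lemma joining_profile:
  assumes ab: "a < b" and ns: "\<And>v. a < v \<Longrightarrow> v < b \<Longrightarrow> gap v \<noteq> 0"
  obtains L w where "0 < L" "continuous_on UNIV w" "\<And>\<xi>. \<xi> \<le> 0 \<Longrightarrow> w \<xi> = a" "\<And>\<xi>. L \<le> \<xi> \<Longrightarrow> w \<xi> = b"
    "\<And>\<xi>. 0 < \<xi> \<Longrightarrow> \<xi> < L \<Longrightarrow> a < w \<xi> \<and> w \<xi> < b"
    "\<And>\<xi>. 0 < \<xi> \<Longrightarrow> \<xi> < L \<Longrightarrow> (w has_real_derivative 1 / sqrt \<bar>gap (w \<xi>)\<bar>) (at \<xi>)"
proof -
  define q where "q v = sqrt \<bar>gap v\<bar>" for v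
  have cq: "continuous_on {a..b} q" unfolding q_def
    by (intro continuous_intros continuous_on_subset[OF continuous_gap]) auto
  have qpos: "q v > 0" if "a < v" "v < b" for v using ns[OF that] by (simp add: q_def)
  define X where "X y = integral {a..y} q" for y
  have DXw: "(X has_real_derivative q y) (at y within {a..b})" if "y \<in> {a..b}" for y
    unfolding X_def [abs_def] by (rule integral_has_real_derivative[OF cq that])
  have DX: "(X has_real_derivative q y) (at y)" if "a < y" "y < b" for y
  proof -
    have "at y within {a..b} = at y" using that by (intro at_within_Icc_at) auto
    then show ?thesis using DXw[of y] that by simp
  qed
  have cX: "continuous_on {a..b} X" using DXw DERIV_continuous_on by blast
  have mX: "strict_mono_on {a..b} X"
    using qpos DX by (intro strict_mono_on_intervalI[where d = q] cX) auto
  define L where "L = X b"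
  have Xa: "X a = 0" by (simp add: X_def)
  have L: "L > 0" using mX ab unfolding L_def by (auto simp: monotone_on_def simp flip: Xa)
  have inj: "inj_on X {a..b}" by (rule strict_mono_on_imp_inj_on[OF mX])
  have im: "X ` {a..b} = {0..L}"
  proof
    show "X ` {a..b} \<subseteq> {0..L}"
    proof
      fix y assume "y \<in> X ` {a..b}"
      then obtain v where v: "v \<in> {a..b}" "y = X v" by blast
      have "X a \<le> X v" "X v \<le> X b" using v(1) ab by (auto intro!: strict_mono_on_leD[OF mX])
      then show "y \<in> {0..L}" by (simp add: v(2) L_def Xa)
    qed
    show "{0..L} \<subseteq> X ` {a..b}"
    proof
      fix y assume "y \<in> {0..L}"
      then show "y \<in> X ` {a..b}"
        using IVT'[of X a y b] cX ab by (auto simp: L_def Xa)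
    qed
  qed
  define Y where "Y = inv_into {a..b} X"
  have YX: "Y (X v) = v" if "v \<in> {a..b}" for v unfolding Y_def using inj that by (rule inv_into_f_f)
  have XY: "X (Y \<xi>) = \<xi>" "Y \<xi> \<in> {a..b}" if "\<xi> \<in> {0..L}" for \<xi>
    unfolding Y_def using that im by (auto intro: f_inv_into_f) (metis atLeastAtMost_iff im inv_into_into that)+
  have cY: "continuous_on {0..L} Y"
    using continuous_on_inv[OF cX compact_Icc, of Y] YX im by simp
  define w where "w \<xi> = Y (max 0 (min L \<xi>))" for \<xi>
  have cw: "continuous_on UNIV w" unfolding w_def
    using L by (intro continuous_on_compose2[OF cY] continuous_intros) auto
  have w0: "w \<xi> = a" if "\<xi> \<le> 0" for \<xi>
    using that L YX[of a] ab by (simp add: w_def Xa)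
  have wL: "w \<xi> = b" if "L \<le> \<xi>" for \<xi>
    using that L YX[of b] ab by (simp add: w_def L_def)
  have wY: "w \<xi> = Y \<xi>" if "0 < \<xi>" "\<xi> < L" for \<xi> using that by (simp add: w_def)
  have wab: "a < w \<xi> \<and> w \<xi> < b" if "0 < \<xi>" "\<xi> < L" for \<xi>
  proof -
    have "Y \<xi> \<noteq> a" "Y \<xi> \<noteq> b" using XY(1)[of \<xi>] that Xa L_def by auto
    then show ?thesis using XY(2)[of \<xi>] that by (auto simp: wY)
  qed
  have "(w has_real_derivative 1 / sqrt \<bar>gap (w \<xi>)\<bar>) (at \<xi>)" if \<xi>: "0 < \<xi>" "\<xi> < L" for \<xi>
  proof -
    have "(w has_real_derivative inverse (q (w \<xi>))) (at \<xi>)"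
    proof (rule DERIV_inverse_function[where f = X and a = 0 and b = L])
      show "(X has_real_derivative q (w \<xi>)) (at (w \<xi>))" using wab[OF \<xi>] by (intro DX) auto
      show "q (w \<xi>) \<noteq> 0" using wab[OF \<xi>] qpos[of "w \<xi>"] by auto
      show "X (w y) = y" if "0 < y" "y < L" for y using XY(1)[of y] that by (simp add: wY)
      show "isCont w \<xi>" using cw by (simp add: continuous_on_eq_continuous_at)
    qed (use \<xi> in auto)
    then show ?thesis by (simp add: q_def divide_inverse)
  qed
  with L cw w0 wL wab show ?thesis by (intro that)
qed

text \<open>Square integrability comes from \<open>w\<^sub>\<xi>\<^sup>2 = w\<^sub>\<xi> / sqrt \<bar>gap(w)\<bar> \<le> w\<^sub>\<xi> / sqrt (m (w - a) (b - w))\<close>, whose right-hand side is a multiple of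
  the derivative of an arcsine. The flux \<open>- sqrt (gap(w))\<close> (with the odd square root) is continuous, because \<open>gap\<close> vanishes at \<open>a\<close> and \<open>b\<close>; this
  makes the glued profile satisfy the weak form.\<close>

lemma joining_wave:
  assumes "joinable_levels c s a b"
  obtains w where "composed_of_local_waves c s w" "global_traveling_wave c s w"
    "weak_solution c (\<lambda>t x. w (x - s * t))" "bounded (range w)" "\<not> w constant_on UNIV"
proof -
  have ab: "a < b" and g0: "gap a = 0" "gap b = 0" and d0: "deriv c a \<noteq> 0" "deriv c b \<noteq> 0"
    and ns: "\<And>v. a < v \<Longrightarrow> v < b \<Longrightarrow> gap v \<noteq> 0"
    using assms by (auto simp: joinable_levels_def gap_eq_0_iff)
  obtain L w where L: "0 < L" and cw: "continuous_on UNIV w" and w0: "\<And>\<xi>. \<xi> \<le> 0 \<Longrightarrow> w \<xi> = a" and wL: "\<And>\<xi>. L \<le> \<xi> \<Longrightarrow> w \<xi> = b"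
    and wab: "\<And>\<xi>. 0 < \<xi> \<Longrightarrow> \<xi> < L \<Longrightarrow> a < w \<xi> \<and> w \<xi> < b"
    and Dw: "\<And>\<xi>. 0 < \<xi> \<Longrightarrow> \<xi> < L \<Longrightarrow> (w has_real_derivative 1 / sqrt \<bar>gap (w \<xi>)\<bar>) (at \<xi>)"
    by (rule joining_profile[OF ab ns]) (assumption | rule that)+
  have wcl: "a \<le> w \<xi>" "w \<xi> \<le> b" for \<xi>
    using w0[of \<xi>] wL[of \<xi>] wab[of \<xi>] ab by (cases "\<xi> \<le> 0"; cases "L \<le> \<xi>"; force)+
  have bw: "bounded (range w)"
    using wcl by (intro bounded_subset[OF bounded_closed_interval[of a b]]) auto
  have nc: "\<not> w constant_on UNIV"
  proof
    assume "w constant_on UNIV"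
    then have "w 0 = w L" by (auto simp: constant_on_def)
    then show False using w0[of 0] wL[of L] ab by simp
  qed
  define J where "J = {0<..<L}"
  have nsJ: "gap (w \<xi>) \<noteq> 0" if "\<xi> \<in> J" for \<xi> using wab[of \<xi>] ns that by (auto simp: J_def)
  have locJ: "local_classical_wave c s w J"
    by (rule normal_form_imp_local_wave[OF _ _ nsJ Dw]) (auto simp: J_def)
  have comp: "composed_of_local_waves c s w"
    unfolding composed_of_local_waves_def
  proof (intro conjI cw exI[of _ "{0, L}"] exI[of _ L] allI impI L)
    show "\<forall>x\<in>{0, L}. \<forall>y\<in>{0, L}. x \<noteq> y \<longrightarrow> L \<le> \<bar>x - y\<bar>" using L by auto
    fix I :: "real set" assume I: "open I \<and> is_interval I \<and> I \<inter> {0, L} = {}"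
    then have "I \<subseteq> {..<0} \<or> I \<subseteq> {0<..}" "I \<subseteq> {..<L} \<or> I \<subseteq> {L<..}"
      using interval_beside_point[of I 0] interval_beside_point[of I L] by auto
    moreover have "{0<..} \<inter> {..<L} = J" by (auto simp: J_def)
    ultimately consider "I \<subseteq> {..<0}" | "I \<subseteq> J" | "I \<subseteq> {L<..}" by blast
    then show "local_classical_wave c s w I"
    proof cases
      case 1
      then show ?thesis using I by (intro constant_local_wave[where k = a] w0) auto
    next
      case 2
      then show ?thesis using I by (intro local_wave_subset[OF locJ]) auto
    next
      case 3
      then show ?thesis using I by (intro constant_local_wave[where k = b] wL) auto
    qed
  qed
  define g where "g \<xi> = indicator J \<xi> * (1 / sqrt \<bar>gap (w \<xi>)\<bar>)" for \<xi>
  have gJ: "g \<xi> = deriv w \<xi>" if "\<xi> \<in> J" for \<xi>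
    using DERIV_imp_deriv[OF Dw[of \<xi>]] that by (auto simp: g_def J_def)
  have cgw: "continuous_on UNIV (\<lambda>\<xi>. gap (w \<xi>))"
    using continuous_on_compose2[OF continuous_gap cw] by auto
  note [measurable] = borel_measurable_continuous_onI[OF cgw] borel_measurable_continuous_onI[OF cw]
  have J_sets [measurable]: "J \<in> sets borel" by (simp add: J_def)
  have gm: "g \<in> borel_measurable borel" unfolding g_def [abs_def] by measurable
  obtain m where m: "m > 0" "\<And>v. a \<le> v \<Longrightarrow> v \<le> b \<Longrightarrow> m * ((v - a) * (b - v)) \<le> \<bar>gap v\<bar>"
    using joinable_gap_lower_bound[OF ab g0(1) d0(1) g0(2) d0(2) ns] by blast
  have gi: "integrable lborel (\<lambda>\<xi>. (g \<xi>)\<^sup>2)"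
  proof -
    define h where "h \<xi> = indicator J \<xi> * (1 / sqrt \<bar>gap (w \<xi>)\<bar> / sqrt ((w \<xi> - a) * (b - w \<xi>)))" for \<xi>
    \<comment> \<open>\<open>A\<close> is continuous up to the gluing points and has the derivative \<open>h\<close> between them.\<close>
    define A where "A \<xi> = arcsin ((2 * w \<xi> - a - b) / (b - a))" for \<xi>
    have hm: "h \<in> borel_measurable borel" unfolding h_def [abs_def] by measurable
    have h0: "0 \<le> h \<xi>" for \<xi>
      using wcl[of \<xi>] by (auto simp: h_def)
    have "(h has_integral (A L - A 0)) {0..L}"
    proof (rule fundamental_theorem_of_calculus_interior_strong[of "{}"])
      show "continuous_on {0..L} A" unfolding A_def
        using wcl ab by (intro continuous_intros continuous_on_subset[OF cw]) (auto simp: field_simps)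
      fix \<xi> assume "\<xi> \<in> {0<..<L} - {}"
      then have \<xi>: "0 < \<xi>" "\<xi> < L" by auto
      let ?y = "(2 * w \<xi> - a - b) / (b - a)"
      have p: "0 < (w \<xi> - a) * (b - w \<xi>)" using wab[OF \<xi>] by simp
      have 1: "1 - ?y\<^sup>2 = (2 / (b - a))\<^sup>2 * ((w \<xi> - a) * (b - w \<xi>))"
      proof -
        have "1 - ?y\<^sup>2 = ((b - a)\<^sup>2 - (2 * w \<xi> - a - b)\<^sup>2) / (b - a)\<^sup>2"
          unfolding power_divide diff_divide_distrib[of "(b - a)\<^sup>2"] using ab by simp
        also have "(b - a)\<^sup>2 - (2 * w \<xi> - a - b)\<^sup>2 = 2\<^sup>2 * ((w \<xi> - a) * (b - w \<xi>))"
          by (simp add: power2_eq_square algebra_simps)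
        finally show ?thesis by (simp add: power_divide)
      qed
      have 2: "sqrt (1 - ?y\<^sup>2) = 2 / (b - a) * sqrt ((w \<xi> - a) * (b - w \<xi>))"
        unfolding 1 using ab by (simp add: real_sqrt_mult)
      have "-1 < ?y" "?y < 1" using wab[OF \<xi>] ab by (auto simp: field_simps)
      then have "(A has_real_derivative (2 * (1 / sqrt \<bar>gap (w \<xi>)\<bar>) / (b - a)) * inverse (sqrt (1 - ?y\<^sup>2))) (at \<xi>)"
        unfolding A_def
        by (auto intro!: derivative_eq_intros Dw[OF \<xi>] simp: divide_inverse)
      also have "(2 * (1 / sqrt \<bar>gap (w \<xi>)\<bar>) / (b - a)) * inverse (sqrt (1 - ?y\<^sup>2)) = h \<xi>"
      proof -
        have "2 * x / d * inverse (2 / d * z) = x / z" if "d \<noteq> 0" for x d z :: real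
          using that by (cases "z = 0") (auto simp: field_simps)
        moreover have "h \<xi> = 1 / sqrt \<bar>gap (w \<xi>)\<bar> / sqrt ((w \<xi> - a) * (b - w \<xi>))"
          using \<xi> by (simp add: h_def J_def)
        moreover have "b - a \<noteq> 0" using ab by simp
        ultimately show ?thesis unfolding 2 by metis
      qed
      finally show "(A has_vector_derivative h \<xi>) (at \<xi>)"
        by (simp add: has_real_derivative_iff_has_vector_derivative)
    qed (use L in auto)
    moreover have "(\<lambda>\<xi>. if \<xi> \<in> {0..L} then h \<xi> else 0) = h" by (auto simp: h_def J_def fun_eq_iff)
    ultimately have "(h has_integral (A L - A 0)) UNIV"
      using has_integral_restrict_UNIV[of "{0..L}" h "A L - A 0"] by simp
    then have "(\<integral>\<^sup>+ \<xi>. h \<xi> \<partial>lborel) = A L - A 0"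
      by (intro nn_integral_has_integral_lborel hm h0)
    then have hi: "integrable lborel h"
      using hm h0 by (intro integrableI_nonneg) auto
    show ?thesis
    proof (rule Bochner_Integration.integrable_bound)
      show "integrable lborel (\<lambda>\<xi>. (1 / sqrt m) * h \<xi>)" using hi by simp
      show "(\<lambda>\<xi>. (g \<xi>)\<^sup>2) \<in> borel_measurable lborel" using gm by simp
      show "AE \<xi> in lborel. norm ((g \<xi>)\<^sup>2) \<le> norm ((1 / sqrt m) * h \<xi>)"
      proof (rule AE_I2)
        fix \<xi>
        show "norm ((g \<xi>)\<^sup>2) \<le> norm ((1 / sqrt m) * h \<xi>)"
        proof (cases "\<xi> \<in> J")
          case True
          then have p: "0 < (w \<xi> - a) * (b - w \<xi>)" using wab[of \<xi>] by (auto simp: J_def)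
          let ?q = "sqrt \<bar>gap (w \<xi>)\<bar>" and ?p = "sqrt ((w \<xi> - a) * (b - w \<xi>))"
          have q: "?q > 0" using nsJ[OF True] by simp
          have "sqrt m * ?p \<le> ?q" using m(2)[OF wcl] by (simp flip: real_sqrt_mult)
          then have "1 / ?q \<le> 1 / (sqrt m * ?p)" using p m(1) q by (intro divide_left_mono) auto
          then have "1 / ?q * (1 / ?q) \<le> 1 / ?q * (1 / (sqrt m * ?p))" using q by (intro mult_left_mono) auto
          then show ?thesis using True p m(1) q by (simp add: g_def h_def power2_eq_square abs_mult field_simps)
        qed (simp add: g_def)
      qed
    qed
  qed
  have gli: "locally_integrable g" "locally_integrable (\<lambda>\<xi>. c (w \<xi>) * deriv c (w \<xi>) * (g \<xi>)\<^sup>2)"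
  proof -
    have "L2_loc g" by (rule square_integrable_imp_L2_loc[OF gm gi])
    then show "locally_integrable g" "locally_integrable (\<lambda>\<xi>. c (w \<xi>) * deriv c (w \<xi>) * (g \<xi>)\<^sup>2)"
      using L2_loc_imp_locally_integrable(1) flux_locally_integrable(2)[OF continuous_c continuous_deriv_c cw] by auto
  qed
  have wg: "weak_deriv UNIV 1 w g"
  proof (rule weak_deriv_piecewise[of "{0, L}"])
    fix \<xi> assume "\<xi> \<notin> {0, L}"
    then consider "\<xi> < 0" | "\<xi> \<in> J" | "L < \<xi>" by (force simp: J_def)
    then show "(w has_real_derivative g \<xi>) (at \<xi>)"
    proof cases
      case 1
      have "((\<lambda>_. a) has_real_derivative 0) (at \<xi>)" by simp
      then have "(w has_real_derivative 0) (at \<xi>)"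
        by (rule has_field_derivative_transform_within_open[where S = "{..<0}"]) (use 1 w0 in auto)
      then show ?thesis using 1 by (simp add: g_def J_def)
    next
      case 2
      then show ?thesis using local_waveD(1)[OF locJ 2] gJ[OF 2] by simp
    next
      case 3
      have "((\<lambda>_. b) has_real_derivative 0) (at \<xi>)" by simp
      then have "(w has_real_derivative 0) (at \<xi>)"
        by (rule has_field_derivative_transform_within_open[where S = "{L<..}"]) (use 3 wL in auto)
      then show ?thesis using 3 by (simp add: g_def J_def)
    qed
  qed (use cw gli in auto)
  have Heq: "((c (w \<xi>))\<^sup>2 - s\<^sup>2) * g \<xi> = - sqrt (gap (w \<xi>))" for \<xi>
  proof (cases "\<xi> \<in> J")
    case True
    let ?y = "gap (w \<xi>)"
    have "?y * (1 / sqrt \<bar>?y\<bar>) = sqrt ?y"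
    proof (cases "?y > 0")
      case True then show ?thesis by (simp add: real_div_sqrt)
    next
      case False
      then have "?y < 0" using nsJ[OF \<open>\<xi> \<in> J\<close>] by simp
      then show ?thesis using real_div_sqrt[of "- ?y"] by (simp add: real_sqrt_minus)
    qed
    moreover have "(c (w \<xi>))\<^sup>2 - s\<^sup>2 = - ?y" by (simp add: gap_def)
    ultimately show ?thesis using True by (simp add: g_def)
  next
    case False
    then have "\<xi> \<le> 0 \<or> L \<le> \<xi>" by (auto simp: J_def)
    then have "gap (w \<xi>) = 0" using w0 wL g0 by auto
    then show ?thesis using False by (simp add: g_def)
  qed
  have HR: "weak_deriv UNIV 1 (\<lambda>\<xi>. ((c (w \<xi>))\<^sup>2 - s\<^sup>2) * g \<xi>) (\<lambda>\<xi>. c (w \<xi>) * deriv c (w \<xi>) * (g \<xi>)\<^sup>2)"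
  proof (rule weak_deriv_piecewise[of "{0, L}"])
    show "continuous_on UNIV (\<lambda>\<xi>. ((c (w \<xi>))\<^sup>2 - s\<^sup>2) * g \<xi>)"
      unfolding Heq by (intro continuous_intros cgw)
    fix \<xi> assume "\<xi> \<notin> {0, L}"
    then consider "\<xi> \<in> J" | "\<xi> \<in> {..<0} \<union> {L<..}" by (force simp: J_def)
    then show "((\<lambda>\<xi>. ((c (w \<xi>))\<^sup>2 - s\<^sup>2) * g \<xi>) has_real_derivative c (w \<xi>) * deriv c (w \<xi>) * (g \<xi>)\<^sup>2) (at \<xi>)"
    proof cases
      case 1
      show ?thesis unfolding gJ[OF 1]
        by (rule has_field_derivative_transform_within_open[OF DERIV_flux[OF locJ 1], of J])
          (use 1 gJ in \<open>auto simp: J_def gap_def\<close>)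
    next
      case 2
      have "((\<lambda>_. 0) has_real_derivative 0) (at \<xi>)" by simp
      then have "((\<lambda>\<xi>. ((c (w \<xi>))\<^sup>2 - s\<^sup>2) * g \<xi>) has_real_derivative 0) (at \<xi>)"
        by (rule has_field_derivative_transform_within_open[OF _ _ 2]) (use L in \<open>auto simp: g_def J_def\<close>)
      then show ?thesis using 2 L by (auto simp: g_def J_def)
    qed
  qed (use gli in auto)
  show ?thesis
    using that[OF comp travelling_weak_solution[OF cw bw gm gi wg HR] bw nc] .
qed

end

section \<open>The classification of travelling waves\<close>

theorem theorem1p1:
  fixes c :: "real \<Rightarrow> real" and s \<alpha> \<beta> K1 K2 :: real
  assumes c_C2: "Ck_on 2 UNIV c"
    and c_min: "\<alpha> \<in> range c" "\<forall>v. \<alpha> \<le> c v"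
    and c_max: "\<beta> \<in> range c" "\<forall>v. c v \<le> \<beta>"
    and bounds: "0 < \<alpha>" "\<alpha> < \<beta>"
    and K1: "0 < K1" "\<forall>v. \<bar>deriv c v\<bar> \<le> K1"
    and K2: "0 < K2" "\<forall>v. \<bar>deriv (deriv c) v\<bar> \<le> K2"
  shows
    "(\<forall>w. composed_of_local_waves c s w \<and> global_traveling_wave c s w \<longrightarrow>
        (\<bar>s\<bar> \<notin> {\<alpha>..\<beta>} \<longrightarrow>
           monotone_wave_on UNIV w \<and> local_classical_wave c s w UNIV \<and>
           (\<not> w constant_on UNIV \<longrightarrow> \<not> bounded (range w)))
        \<and>
        (\<bar>s\<bar> \<in> {\<alpha><..<\<beta>} \<longrightarrow>
           (\<forall>\<xi>. gluing_point c s w \<xi> \<longrightarrow> \<bar>s\<bar> = c (w \<xi>))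
           \<and>
           (\<forall>\<xi>. \<bar>s\<bar> \<noteq> c (w \<xi>) \<and> local_extremum c (w \<xi>) \<longrightarrow>
              (\<exists>\<epsilon>>0. local_classical_wave c s w {\<xi> - \<epsilon><..<\<xi> + \<epsilon>} \<and>
                     monotone_wave_on {\<xi> - \<epsilon><..<\<xi> + \<epsilon>} w) \<and>
              deriv (deriv w) \<xi> = 0 \<and> local_extremum (deriv w) \<xi> \<and>
              (changes_sign (deriv c) (w \<xi>) \<longrightarrow> constant_near w \<xi> \<or> inflection_point w \<xi>))
           \<and>
           (\<forall>\<xi>. \<bar>s\<bar> = c (w \<xi>) \<and> deriv c (w \<xi>) \<noteq> 0 \<longrightarrow>
              constant_near w \<xi> \<or>
              singularity w \<xi> \<and>
              (\<exists>\<epsilon>>0.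
                 local_classical_wave c s w {\<xi> - \<epsilon><..<\<xi>} \<and> monotone_wave_on {\<xi> - \<epsilon><..\<xi>} w \<and>
                 local_classical_wave c s w {\<xi><..<\<xi> + \<epsilon>} \<and> monotone_wave_on {\<xi>..<\<xi> + \<epsilon>} w \<and>
                 (same_sign_scenario w \<xi> \<epsilon> \<or> opposite_sign_scenario w \<xi> \<epsilon> \<or>
                  one_sided_constant_scenario w \<xi> \<epsilon>)))
           \<and>
           (\<forall>\<xi>. \<bar>s\<bar> = c (w \<xi>) \<and> deriv c (w \<xi>) = 0 \<and> \<not> moves_on_plateau c s w \<longrightarrow>
              w constant_on UNIV)))
     \<and>
     (\<bar>s\<bar> \<in> {\<alpha>..\<beta>} \<longrightarrow>
        (\<exists>w. composed_of_local_waves c s w \<and> global_traveling_wave c s w \<and>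
             weak_solution c (\<lambda>t x. w (x - s * t)) \<and> bounded (range w) \<and>
             ((\<exists>a b. joinable_levels c s a b) \<longrightarrow> \<not> w constant_on UNIV)))"
proof -
  interpret wave_speed c s
    using c_C2 c_min(2) bounds(1) by unfold_locales (auto intro: less_le_trans)
  have gap0: "gap v = 0 \<longleftrightarrow> \<bar>s\<bar> = c v" for v by (rule gap_eq_0_iff)
  have \<beta>: "c v \<le> \<beta>" and \<alpha>: "\<alpha> \<le> c v" for v using c_max(2) c_min(2) by blast+
  have K2': "\<bar>deriv (deriv c) v\<bar> \<le> K2" for v using K2(2) by blast
  have far: "gap v \<noteq> 0" "\<bar>gap v\<bar> \<le> s\<^sup>2 + \<beta>\<^sup>2" if "\<bar>s\<bar> \<notin> {\<alpha>..\<beta>}" for v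
  proof -
    show "gap v \<noteq> 0" using that \<alpha>[of v] \<beta>[of v] by (auto simp: gap0)
    have "(c v)\<^sup>2 \<le> \<beta>\<^sup>2" using \<beta> c_pos[of v] by (intro power_mono) (auto intro: less_imp_le)
    then show "\<bar>gap v\<bar> \<le> s\<^sup>2 + \<beta>\<^sup>2"
      unfolding gap_def abs_le_iff using zero_le_power2[of s] zero_le_power2[of "c v"] by linarith
  qed
  show ?thesis
  proof (intro conjI allI impI; (elim conjE)?)
    fix w assume w: "composed_of_local_waves c s w" "global_traveling_wave c s w"
    {
      assume s: "\<bar>s\<bar> \<notin> {\<alpha>..\<beta>}"
      note N = nonsonic_speed[OF w far[OF s]]
      show "monotone_wave_on UNIV w" "local_classical_wave c s w UNIV" by (fact N(1,2))+
      show "\<not> bounded (range w)" if "\<not> w constant_on UNIV" by (rule N(3)[OF that])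
    next
      show "\<bar>s\<bar> = c (w \<xi>)" if "gluing_point c s w \<xi>" for \<xi> using gluing_point_sonic[OF w that] .
    next
      fix \<xi> assume "\<bar>s\<bar> \<noteq> c (w \<xi>)" and e: "local_extremum c (w \<xi>)"
      then have "gap (w \<xi>) \<noteq> 0" by (simp add: gap0)
      note E = local_extremum_nonsonic[OF w this e]
      show "\<exists>\<epsilon>>0. local_classical_wave c s w {\<xi> - \<epsilon><..<\<xi> + \<epsilon>} \<and> monotone_wave_on {\<xi> - \<epsilon><..<\<xi> + \<epsilon>} w"
        and "deriv (deriv w) \<xi> = 0" and "local_extremum (deriv w) \<xi>" by (fact E(1-3))+
      show "constant_near w \<xi> \<or> inflection_point w \<xi>" if "changes_sign (deriv c) (w \<xi>)" using E(4)[OF that] .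
    next
      fix \<xi> assume "\<bar>s\<bar> = c (w \<xi>)" and d: "deriv c (w \<xi>) \<noteq> 0"
      then have "gap (w \<xi>) = 0" by (simp add: gap0)
      from regular_sonic_point[OF w(1) this d] show "constant_near w \<xi> \<or> singularity w \<xi> \<and>
          (\<exists>\<epsilon>>0. local_classical_wave c s w {\<xi> - \<epsilon><..<\<xi>} \<and> monotone_wave_on {\<xi> - \<epsilon><..\<xi>} w \<and>
             local_classical_wave c s w {\<xi><..<\<xi> + \<epsilon>} \<and> monotone_wave_on {\<xi>..<\<xi> + \<epsilon>} w \<and>
             (same_sign_scenario w \<xi> \<epsilon> \<or> opposite_sign_scenario w \<xi> \<epsilon> \<or> one_sided_constant_scenario w \<xi> \<epsilon>))" .
    next
      fix \<xi> assume "\<bar>s\<bar> = c (w \<xi>)" and d: "deriv c (w \<xi>) = 0" and p: "\<not> moves_on_plateau c s w"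
      then have "gap (w \<xi>) = 0" by (simp add: gap0)
      from degenerate_sonic_point[OF w this d K2' \<beta> p] show "w constant_on UNIV" .
    }
  next
    show "\<exists>w. composed_of_local_waves c s w \<and> global_traveling_wave c s w \<and>
        weak_solution c (\<lambda>t x. w (x - s * t)) \<and> bounded (range w) \<and>
        ((\<exists>a b. joinable_levels c s a b) \<longrightarrow> \<not> w constant_on UNIV)"
    \<comment> \<open>Without joinable levels any constant serves.\<close>
    proof (cases "\<exists>a b. joinable_levels c s a b")
      case True
      then obtain a b where "joinable_levels c s a b" by blast
      then show ?thesis by (rule joining_wave) blast
    next
      case False
      have "bounded (range (\<lambda>\<xi>::real. 0::real))" by simp
      then show ?thesis using False constant_wave by (intro exI[of _ "\<lambda>\<xi>. 0"]) auto
    qed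
  qed
qed

end
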